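(* The Diameter Constrained Steiner Tree (DCST) problem polynomial-time Turing reduces to the Directed Diameter Constrained Steiner Tree (DDCST) problem.
   Context: DCST problem: input $(V,E,T,D)$ where $G=(V,E)$ is a simple undirected graph with non-negative edge weights (weight $\infty$ meaning an absent edge), $T\subseteq V$ a set of terminals, $D>0$ an integer; output the minimum weight of a sub-tree of $G$ containing all vertices of $T$ with diameter at most $D$, or FAIL if none exists. The diameter of an undirected tree is the maximum number of edges (ignoring weights) on a path between two leaves. DDCST problem: input $(V,E,T,r,D)$ where $G=(V,E)$ is a directed graph with non-negative weights $E(i,j)$ on ordered pairs (weight $\infty$ meaning absent), $E(i,i)=0$, $E(i,j)$ and $E(j,i)$ possibly unrelated; $T\subseteq V$ terminals; a root $r\in V\setminus T$; integer $D>0$; output the minimum weight of a directed sub-tree of $G$ rooted at $r$ (edges directed away from $r$) containing all of $T$ with diameter at most $D$, or FAIL if none exists. The diameter of a rooted directed tree is the maximum number of edges on a path from the root to a leaf. In both problems the weight of a sub-tree is the sum of its edge weights. *)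

theory Defs
  imports "HOL-Computational_Algebra.Polynomial"
begin

section \<open>Oracle Turing machines and polynomial-time Turing reductions\<close>

text \<open>
  Deterministic multitape oracle Turing machines over the alphabet \<open>{0, 1, blank}\<close>, where
  \<open>None\<close> is the blank. A tape is two-way infinite; \<open>(l, r)\<close> stands for the cells to the left of the
  head (nearest first) and the cells from the head onwards, all remaining cells being blank.
  Tape 0 is the input/output tape, tape 1 the oracle query tape, tape 2 the oracle answer tape.
\<close>

type_synonym symbol = "bool option"
type_synonym tape = "symbol list \<times> symbol list"

datatype move = Move_Left | Stay | Move_Right

record otm =
  tapes :: nat
  states :: nat
  start_state :: nat
  halt_state :: nat
  query_state :: nat
  resume_state :: nat
  delta :: "nat \<Rightarrow> symbol list \<Rightarrow> nat \<times> (symbol \<times> move) list"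

definition wf_otm :: "otm \<Rightarrow> bool" where
  "wf_otm M \<longleftrightarrow>
     3 \<le> tapes M \<and>
     start_state M < states M \<and> halt_state M < states M \<and>
     query_state M < states M \<and> resume_state M < states M \<and>
     halt_state M \<noteq> query_state M \<and>
     (\<forall>q < states M. \<forall>ss. length ss = tapes M \<longrightarrow>
        fst (delta M q ss) < states M \<and> length (snd (delta M q ss)) = tapes M)"

fun scanned :: "tape \<Rightarrow> symbol" where
  "scanned (l, []) = None"
| "scanned (l, s # r) = s"

fun act :: "symbol \<times> move \<Rightarrow> tape \<Rightarrow> tape" where
  "act (s, Move_Left) ([], r) = ([], None # s # tl r)"
| "act (s, Move_Left) (x # l, r) = (l, x # s # tl r)"
| "act (s, Stay) (l, r) = (l, s # tl r)"
| "act (s, Move_Right) (l, r) = (s # l, tl r)"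

definition blank_tape :: tape where
  "blank_tape = ([], [])"

definition tape_of :: "bool list \<Rightarrow> tape" where
  "tape_of w = ([], map Some w)"

text \<open>The word on a tape is the maximal blank-free block starting at the head.\<close>

definition word_of :: "tape \<Rightarrow> bool list" where
  "word_of t = map the (takeWhile (\<lambda>s. s \<noteq> None) (snd t))"

type_synonym config = "nat \<times> tape list"

definition init_config :: "otm \<Rightarrow> bool list \<Rightarrow> config" where
  "init_config M x = (start_state M, tape_of x # replicate (tapes M - 1) blank_tape)"

text \<open>
  An oracle call takes one step: the query tape is erased and the answer tape is overwritten with
  the oracle's answer. Halting configurations are fixed points.
\<close>

definition step :: "(bool list \<Rightarrow> bool list) \<Rightarrow> otm \<Rightarrow> config \<Rightarrow> config" where
  "step f M c =
     (let (q, ts) = c in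
      if q = halt_state M then c
      else if q = query_state M then
        (resume_state M, ts[1 := blank_tape, 2 := tape_of (f (word_of (ts ! 1)))])
      else
        (let (q', as) = delta M q (map scanned ts) in (q', map2 act as ts)))"

definition computes_within ::
  "otm \<Rightarrow> (bool list \<Rightarrow> bool list) \<Rightarrow> bool list \<Rightarrow> bool list \<Rightarrow> nat \<Rightarrow> bool" where
  "computes_within M f x y b \<longleftrightarrow>
     (\<exists>t \<le> b. \<exists>ts. (step f M ^^ t) (init_config M x) = (halt_state M, ts) \<and> word_of (ts ! 0) = y)"

text \<open>
  A function problem is the set of pairs (encoded valid instance, encoded correct output). On words
  that encode no valid instance nothing is required, neither of a solver nor of an oracle.
\<close>

type_synonym problem = "(bool list \<times> bool list) set"

definition solves :: "(bool list \<Rightarrow> bool list) \<Rightarrow> problem \<Rightarrow> bool" where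
  "solves f Q \<longleftrightarrow> (\<forall>(x, y) \<in> Q. f x = y)"

definition poly_time_Turing_reducible :: "problem \<Rightarrow> problem \<Rightarrow> bool" where
  "poly_time_Turing_reducible P Q \<longleftrightarrow>
     (\<exists>M (p :: nat poly). wf_otm M \<and>
        (\<forall>f. solves f Q \<longrightarrow>
           (\<forall>(x, y) \<in> P. computes_within M f x y (poly p (length x)))))"

lemma oracle_exists:
  assumes "single_valued Q"
  shows "\<exists>f. solves f Q"
proof
  show "solves (\<lambda>x. THE y. (x, y) \<in> Q) Q"
    using assms unfolding solves_def single_valued_def by (auto intro!: the_equality)
qed


section \<open>Encodings\<close>

fun bin :: "nat \<Rightarrow> bool list" where
  "bin n = (if n = 0 then [] else odd n # bin (n div 2))"

declare bin.simps [simp del]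

definition enc_bool :: "bool \<Rightarrow> bool list" where
  "enc_bool b = [b]"

fun enc_list :: "('a \<Rightarrow> bool list) \<Rightarrow> 'a list \<Rightarrow> bool list" where
  "enc_list e [] = [False]"
| "enc_list e (x # xs) = True # e x @ enc_list e xs"

fun enc_option :: "('a \<Rightarrow> bool list) \<Rightarrow> 'a option \<Rightarrow> bool list" where
  "enc_option e None = [False]"
| "enc_option e (Some x) = True # e x"

definition enc_nat :: "nat \<Rightarrow> bool list" where
  "enc_nat n = enc_list enc_bool (bin n)"

text \<open>Only used for \<open>q \<ge> 0\<close>.\<close>

definition enc_rat :: "rat \<Rightarrow> bool list" where
  "enc_rat q = enc_nat (nat (fst (quotient_of q))) @ enc_nat (nat (snd (quotient_of q)))"

definition enc_subset :: "nat \<Rightarrow> nat set \<Rightarrow> bool list" where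
  "enc_subset n T = enc_list enc_bool (map (\<lambda>i. i \<in> T) [0..<n])"

definition enc_matrix :: "nat \<Rightarrow> (nat \<Rightarrow> nat \<Rightarrow> rat option) \<Rightarrow> bool list" where
  "enc_matrix n A =
     enc_list (enc_list (enc_option enc_rat)) (map (\<lambda>i. map (A i) [0..<n]) [0..<n])"


section \<open>The optimization problems\<close>

text \<open>
  Weights are partial maps: \<open>None\<close> is the weight \<open>\<infinity>\<close>, i.e. an absent edge. An optimal value
  \<open>None\<close> means FAIL.
\<close>

definition min_or_fail :: "rat set \<Rightarrow> rat option" where
  "min_or_fail W = (if W = {} then None else Some (Min W))"

subsection \<open>Undirected graphs\<close>

text \<open>Paths are lists of vertices, edges are two-element sets of vertices.\<close>

definition path :: "'a set set \<Rightarrow> 'a \<Rightarrow> 'a list \<Rightarrow> 'a \<Rightarrow> bool" where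
  "path F u xs v \<longleftrightarrow>
     xs \<noteq> [] \<and> hd xs = u \<and> last xs = v \<and> distinct xs \<and> successively (\<lambda>x y. {x, y} \<in> F) xs"

definition cycle :: "'a set set \<Rightarrow> 'a list \<Rightarrow> bool" where
  "cycle F xs \<longleftrightarrow>
     3 \<le> length xs \<and> distinct xs \<and> successively (\<lambda>x y. {x, y} \<in> F) xs \<and> {last xs, hd xs} \<in> F"

definition tree :: "'a set \<Rightarrow> 'a set set \<Rightarrow> bool" where
  "tree U F \<longleftrightarrow>
     finite U \<and> U \<noteq> {} \<and> (\<forall>e \<in> F. e \<subseteq> U \<and> card e = 2) \<and>
     (\<forall>u \<in> U. \<forall>v \<in> U. \<exists>xs. path F u xs v) \<and> (\<nexists>xs. cycle F xs)"

text \<open>The vertex of a one-vertex tree counts as a leaf, so that such a tree has diameter 0.\<close>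

definition leaf :: "'a set \<Rightarrow> 'a set set \<Rightarrow> 'a \<Rightarrow> bool" where
  "leaf U F v \<longleftrightarrow> v \<in> U \<and> card {e \<in> F. v \<in> e} \<le> 1"

definition diameter :: "'a set \<Rightarrow> 'a set set \<Rightarrow> nat" where
  "diameter U F = Max {length xs - 1 | xs u v. leaf U F u \<and> leaf U F v \<and> path F u xs v}"

definition dcst_instance :: "'a set \<Rightarrow> ('a set \<rightharpoonup> rat) \<Rightarrow> 'a set \<Rightarrow> nat \<Rightarrow> bool" where
  "dcst_instance V E T D \<longleftrightarrow>
     finite V \<and> (\<forall>e \<in> dom E. e \<subseteq> V \<and> card e = 2) \<and> (\<forall>c \<in> ran E. 0 \<le> c) \<and> T \<subseteq> V \<and> 0 < D"

definition dcst_weights :: "'a set \<Rightarrow> ('a set \<rightharpoonup> rat) \<Rightarrow> 'a set \<Rightarrow> nat \<Rightarrow> rat set" where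
  "dcst_weights V E T D =
     {(\<Sum>e\<in>F. the (E e)) | U F.
        U \<subseteq> V \<and> F \<subseteq> dom E \<and> tree U F \<and> T \<subseteq> U \<and> diameter U F \<le> D}"

definition dcst :: "'a set \<Rightarrow> ('a set \<rightharpoonup> rat) \<Rightarrow> 'a set \<Rightarrow> nat \<Rightarrow> rat option" where
  "dcst V E T D = min_or_fail (dcst_weights V E T D)"

subsection \<open>Directed graphs\<close>

definition diwalk :: "('a \<times> 'a) set \<Rightarrow> 'a \<Rightarrow> 'a list \<Rightarrow> 'a \<Rightarrow> bool" where
  "diwalk F u xs v \<longleftrightarrow>
     xs \<noteq> [] \<and> hd xs = u \<and> last xs = v \<and> successively (\<lambda>x y. (x, y) \<in> F) xs"

text \<open>
  A directed tree rooted at \<open>r\<close> (arborescence): every vertex is reached from \<open>r\<close> by exactly one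
  directed walk. In particular there are no loops, and the walks from \<open>r\<close> are paths.
\<close>

definition ditree :: "'a set \<Rightarrow> ('a \<times> 'a) set \<Rightarrow> 'a \<Rightarrow> bool" where
  "ditree U F r \<longleftrightarrow>
     finite U \<and> r \<in> U \<and> F \<subseteq> U \<times> U \<and> (\<forall>v \<in> U. \<exists>!xs. diwalk F r xs v)"

definition dileaf :: "'a set \<Rightarrow> ('a \<times> 'a) set \<Rightarrow> 'a \<Rightarrow> bool" where
  "dileaf U F v \<longleftrightarrow> v \<in> U \<and> (\<nexists>w. (v, w) \<in> F)"

definition didiameter :: "'a set \<Rightarrow> ('a \<times> 'a) set \<Rightarrow> 'a \<Rightarrow> nat" where
  "didiameter U F r = Max {length xs - 1 | xs v. dileaf U F v \<and> diwalk F r xs v}"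

definition ddcst_instance ::
  "'a set \<Rightarrow> ('a \<times> 'a \<rightharpoonup> rat) \<Rightarrow> 'a set \<Rightarrow> 'a \<Rightarrow> nat \<Rightarrow> bool" where
  "ddcst_instance V E T r D \<longleftrightarrow>
     finite V \<and> dom E \<subseteq> V \<times> V \<and> (\<forall>c \<in> ran E. 0 \<le> c) \<and> (\<forall>i \<in> V. E (i, i) = Some 0) \<and>
     T \<subseteq> V \<and> r \<in> V - T \<and> 0 < D"

definition ddcst_weights ::
  "'a set \<Rightarrow> ('a \<times> 'a \<rightharpoonup> rat) \<Rightarrow> 'a set \<Rightarrow> 'a \<Rightarrow> nat \<Rightarrow> rat set" where
  "ddcst_weights V E T r D =
     {(\<Sum>e\<in>F. the (E e)) | U F.
        U \<subseteq> V \<and> F \<subseteq> dom E \<and> ditree U F r \<and> T \<subseteq> U \<and> didiameter U F r \<le> D}"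

definition ddcst :: "'a set \<Rightarrow> ('a \<times> 'a \<rightharpoonup> rat) \<Rightarrow> 'a set \<Rightarrow> 'a \<Rightarrow> nat \<Rightarrow> rat option" where
  "ddcst V E T r D = min_or_fail (ddcst_weights V E T r D)"

subsection \<open>The problems as sets of words\<close>

text \<open>
  For the encoding, the vertices are numbered \<open>0, \<dots>, n - 1\<close>; the graph is given by its weighted
  adjacency matrix, and all numbers are in binary.
\<close>

definition enc_dcst :: "nat \<Rightarrow> (nat set \<rightharpoonup> rat) \<Rightarrow> nat set \<Rightarrow> nat \<Rightarrow> bool list" where
  "enc_dcst n E T D = enc_matrix n (\<lambda>i j. E {i, j}) @ enc_subset n T @ enc_nat D"

definition enc_ddcst :: "nat \<Rightarrow> (nat \<times> nat \<rightharpoonup> rat) \<Rightarrow> nat set \<Rightarrow> nat \<Rightarrow> nat \<Rightarrow> bool list" where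
  "enc_ddcst n E T r D =
     enc_matrix n (\<lambda>i j. E (i, j)) @ enc_subset n T @ enc_nat r @ enc_nat D"

definition DCST :: problem where
  "DCST =
     {(enc_dcst n E T D, enc_option enc_rat (dcst {..<n} E T D)) | n E T D.
        dcst_instance {..<n} E T D}"

definition DDCST :: problem where
  "DDCST =
     {(enc_ddcst n E T r D, enc_option enc_rat (ddcst {..<n} E T r D)) | n E T r D.
        ddcst_instance {..<n} E T r D}"


section \<open>Well-definedness\<close>

text \<open>
  The minima range over finite sets, and the encodings are injective, so both problems are
  single-valued; in particular oracles for them exist.
\<close>

lemma finite_dcst_weights:
  assumes "dcst_instance V E T D"
  shows "finite (dcst_weights V E T D)"
proof -
  have "dom E \<subseteq> Pow V" "finite V"
    using assms by (auto simp: dcst_instance_def)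
  then have "finite ((\<lambda>F. \<Sum>e\<in>F. the (E e)) ` Pow (dom E))"
    by (meson finite_Pow_iff finite_imageI finite_subset)
  then show ?thesis
    by (rule rev_finite_subset) (auto simp: dcst_weights_def)
qed

lemma finite_ddcst_weights:
  assumes "ddcst_instance V E T r D"
  shows "finite (ddcst_weights V E T r D)"
proof -
  have "dom E \<subseteq> V \<times> V" "finite V"
    using assms by (auto simp: ddcst_instance_def)
  then have "finite ((\<lambda>F. \<Sum>e\<in>F. the (E e)) ` Pow (dom E))"
    by (meson finite_Pow_iff finite_imageI finite_subset finite_SigmaI)
  then show ?thesis
    by (rule rev_finite_subset) (auto simp: ddcst_weights_def)
qed

definition prefix_inj_on :: "'a set \<Rightarrow> ('a \<Rightarrow> bool list) \<Rightarrow> bool" where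
  "prefix_inj_on A e \<longleftrightarrow> (\<forall>x\<in>A. \<forall>y\<in>A. \<forall>s t. e x @ s = e y @ t \<longrightarrow> x = y \<and> s = t)"

lemma prefix_inj_onI:
  "(\<And>x y s t. x \<in> A \<Longrightarrow> y \<in> A \<Longrightarrow> e x @ s = e y @ t \<Longrightarrow> x = y \<and> s = t) \<Longrightarrow> prefix_inj_on A e"
  unfolding prefix_inj_on_def by blast

lemma prefix_inj_onD:
  "prefix_inj_on A e \<Longrightarrow> e x @ s = e y @ t \<Longrightarrow> x \<in> A \<Longrightarrow> y \<in> A \<Longrightarrow> x = y \<and> s = t"
  unfolding prefix_inj_on_def by blast

lemma bin_inj: "bin m = bin n \<Longrightarrow> m = n"
proof (induction m arbitrary: n rule: less_induct)
  case (less m)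
  show ?case
  proof (cases "m = 0 \<or> n = 0")
    case True
    then show ?thesis
      using less.prems by (auto simp: bin.simps[of m] bin.simps[of n] split: if_splits)
  next
    case False
    then have "odd m = odd n" "bin (m div 2) = bin (n div 2)"
      using less.prems by (auto simp: bin.simps[of m] bin.simps[of n])
    moreover from this False have "m div 2 = n div 2"
      using less.IH[of "m div 2"] by simp
    ultimately show ?thesis
      by (metis bit_eq_rec)
  qed
qed

lemma prefix_inj_bool: "prefix_inj_on UNIV enc_bool"
  by (auto simp: prefix_inj_on_def enc_bool_def)

lemma prefix_inj_list:
  assumes "prefix_inj_on A e"
  shows "prefix_inj_on (lists A) (enc_list e)"
proof -
  have "xs = ys \<and> s = t"
    if "enc_list e xs @ s = enc_list e ys @ t" "xs \<in> lists A" "ys \<in> lists A" for xs ys s t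
    using that
  proof (induction xs arbitrary: ys)
    case Nil
    then show ?case by (cases ys) auto
  next
    case (Cons x xs)
    then obtain y ys' where ys: "ys = y # ys'" by (cases ys) auto
    with Cons.prems have
      "e x @ enc_list e xs @ s = e y @ enc_list e ys' @ t" "x \<in> A" "y \<in> A" by auto
    then have "x = y \<and> enc_list e xs @ s = enc_list e ys' @ t"
      using prefix_inj_onD[OF assms] by blast
    with Cons ys show ?case by auto
  qed
  from this show ?thesis by (rule prefix_inj_onI)
qed

lemma enc_nat_append_eq: "enc_nat m @ s = enc_nat n @ t \<longleftrightarrow> m = n \<and> s = t"
  using prefix_inj_onD[OF prefix_inj_list[OF prefix_inj_bool], of "bin m" s "bin n" t] bin_inj[of m n]
  by (auto simp: enc_nat_def)

lemma prefix_inj_rat: "prefix_inj_on {0..} enc_rat"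
proof -
  have "x = y \<and> s = t" if "0 \<le> x" "0 \<le> y" and eq: "enc_rat x @ s = enc_rat y @ t" for x y s t
  proof -
    obtain a b c d where q: "quotient_of x = (a, b)" "quotient_of y = (c, d)"
      by fastforce
    then have pos: "b > 0" "d > 0"
      by (auto simp: quotient_of_denom_pos)
    moreover have "x = of_int a / of_int b" "y = of_int c / of_int d"
      using q by (auto simp: quotient_of_div)
    ultimately have nonneg: "0 \<le> a" "0 \<le> c"
      using that by (auto simp: zero_le_divide_iff)
    from eq q have "enc_nat (nat a) @ enc_nat (nat b) @ s = enc_nat (nat c) @ enc_nat (nat d) @ t"
      by (simp add: enc_rat_def)
    then have "nat a = nat c \<and> nat b = nat d \<and> s = t"
      by (simp add: enc_nat_append_eq)
    with pos nonneg have "quotient_of x = quotient_of y \<and> s = t"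
      using q by (auto simp: eq_nat_nat_iff)
    then show ?thesis
      using quotient_of_inject by blast
  qed
  from this show ?thesis by (rule prefix_inj_onI) (simp_all only: atLeast_iff)
qed

lemma prefix_inj_weight: "prefix_inj_on {w. \<forall>c. w = Some c \<longrightarrow> 0 \<le> c} (enc_option enc_rat)"
proof (rule prefix_inj_onI)
  fix x y :: "rat option" and s t
  assume "x \<in> {w. \<forall>c. w = Some c \<longrightarrow> 0 \<le> c}" "y \<in> {w. \<forall>c. w = Some c \<longrightarrow> 0 \<le> c}"
    "enc_option enc_rat x @ s = enc_option enc_rat y @ t"
  then show "x = y \<and> s = t"
    using prefix_inj_onD[OF prefix_inj_rat, of "the x" s "the y" t] by (cases x; cases y) simp_all
qed

lemma enc_matrix_inj:
  assumes "enc_matrix m A @ s = enc_matrix n B @ t"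
    and "\<forall>i j c. A i j = Some c \<longrightarrow> 0 \<le> c" "\<forall>i j c. B i j = Some c \<longrightarrow> 0 \<le> c"
  shows "m = n" "i < n \<Longrightarrow> j < n \<Longrightarrow> A i j = B i j" "s = t"
proof -
  let ?W = "{w :: rat option. \<forall>c. w = Some c \<longrightarrow> 0 \<le> c}"
  have "map (\<lambda>i. map (A i) [0..<m]) [0..<m] \<in> lists (lists ?W)"
       "map (\<lambda>i. map (B i) [0..<n]) [0..<n] \<in> lists (lists ?W)"
    using assms(2,3) by auto
  then have *: "map (\<lambda>i. map (A i) [0..<m]) [0..<m] = map (\<lambda>i. map (B i) [0..<n]) [0..<n] \<and> s = t"
    using assms(1) unfolding enc_matrix_def
    by (intro prefix_inj_onD[OF prefix_inj_list[OF prefix_inj_list[OF prefix_inj_weight]]])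
  then show mn: "m = n"
    by (metis length_map length_upt minus_nat.diff_0)
  show "s = t" using * by blast
  assume "i < n" "j < n"
  with * mn show "A i j = B i j"
    by auto
qed

lemma enc_subset_inj:
  assumes "enc_subset n S @ s = enc_subset n T @ t" "S \<subseteq> {..<n}" "T \<subseteq> {..<n}"
  shows "S = T" "s = t"
proof -
  have *: "map (\<lambda>i. i \<in> S) [0..<n] = map (\<lambda>i. i \<in> T) [0..<n] \<and> s = t"
    using assms(1) unfolding enc_subset_def
    by (intro prefix_inj_onD[OF prefix_inj_list[OF prefix_inj_bool]]) simp_all
  then show "s = t" by blast
  from * have "\<forall>i<n. i \<in> S \<longleftrightarrow> i \<in> T"
    by auto
  with assms(2,3) show "S = T" by blast
qed

lemma dcst_instance_nonneg:
  assumes "dcst_instance V E T D" "E e = Some c"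
  shows "0 \<le> c"
proof -
  have "c \<in> ran E" using assms(2) by (rule ranI)
  with assms(1) show ?thesis by (simp add: dcst_instance_def)
qed

lemma ddcst_instance_nonneg:
  assumes "ddcst_instance V E T r D" "E e = Some c"
  shows "0 \<le> c"
proof -
  have "c \<in> ran E" using assms(2) by (rule ranI)
  with assms(1) show ?thesis by (simp add: ddcst_instance_def)
qed

lemma enc_dcst_inj:
  assumes eq: "enc_dcst m E S C = enc_dcst n F T D"
    and E: "dcst_instance {..<m} E S C" and F: "dcst_instance {..<n} F T D"
  shows "m = n \<and> E = F \<and> S = T \<and> C = D"
proof -
  have eq': "enc_matrix m (\<lambda>i j. E {i, j}) @ enc_subset m S @ enc_nat C @ [] =
             enc_matrix n (\<lambda>i j. F {i, j}) @ enc_subset n T @ enc_nat D @ []"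
    using eq unfolding enc_dcst_def append_Nil2 .
  have nonneg: "\<forall>i j c. E {i, j} = Some c \<longrightarrow> 0 \<le> c"
      "\<forall>i j c. F {i, j} = Some c \<longrightarrow> 0 \<le> c"
    by (auto dest: dcst_instance_nonneg[OF E] dcst_instance_nonneg[OF F])
  note M = enc_matrix_inj[OF eq' nonneg]
  have "m = n" by (rule M(1))
  have ST: "S \<subseteq> {..<n}" "T \<subseteq> {..<n}"
    using E F \<open>m = n\<close> by (auto simp: dcst_instance_def)
  note R = enc_subset_inj[OF M(3)[unfolded \<open>m = n\<close>] ST]
  have "C = D"
    using R(2) unfolding enc_nat_append_eq by blast
  moreover have "E e = F e" for e
  proof (cases "e \<in> dom E \<union> dom F")
    case True
    then have "e \<subseteq> {..<n}" "card e = 2"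
      using E F \<open>m = n\<close> unfolding dcst_instance_def by blast+
    then obtain i j where "e = {i, j}" "i < n" "j < n"
      by (auto simp: card_2_iff)
    then show ?thesis using M(2) by simp
  next
    case False
    then have "E e = None" "F e = None" by auto
    then show ?thesis by simp
  qed
  ultimately show ?thesis using \<open>m = n\<close> R(1) by blast
qed

lemma enc_ddcst_inj:
  assumes eq: "enc_ddcst m E S q C = enc_ddcst n F T r D"
    and E: "ddcst_instance {..<m} E S q C" and F: "ddcst_instance {..<n} F T r D"
  shows "m = n \<and> E = F \<and> S = T \<and> q = r \<and> C = D"
proof -
  have eq': "enc_matrix m (\<lambda>i j. E (i, j)) @ enc_subset m S @ enc_nat q @ enc_nat C @ [] =
             enc_matrix n (\<lambda>i j. F (i, j)) @ enc_subset n T @ enc_nat r @ enc_nat D @ []"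
    using eq unfolding enc_ddcst_def append_Nil2 .
  have nonneg: "\<forall>i j c. E (i, j) = Some c \<longrightarrow> 0 \<le> c"
      "\<forall>i j c. F (i, j) = Some c \<longrightarrow> 0 \<le> c"
    by (auto dest: ddcst_instance_nonneg[OF E] ddcst_instance_nonneg[OF F])
  note M = enc_matrix_inj[OF eq' nonneg]
  have "m = n" by (rule M(1))
  have ST: "S \<subseteq> {..<n}" "T \<subseteq> {..<n}"
    using E F \<open>m = n\<close> unfolding ddcst_instance_def by blast+
  note R = enc_subset_inj[OF M(3)[unfolded \<open>m = n\<close>] ST]
  have "q = r" "C = D"
    using R(2) unfolding enc_nat_append_eq by blast+
  moreover have "E e = F e" for e
  proof (cases "e \<in> dom E \<union> dom F")
    case True
    moreover have "dom E \<union> dom F \<subseteq> {..<n} \<times> {..<n}"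
      using E F \<open>m = n\<close> by (simp add: ddcst_instance_def)
    ultimately obtain i j where "e = (i, j)" "i < n" "j < n" by blast
    then show ?thesis using M(2) by simp
  next
    case False
    then have "E e = None" "F e = None" by auto
    then show ?thesis by simp
  qed
  ultimately show ?thesis using \<open>m = n\<close> R(1) by blast
qed

lemma single_valued_DCST: "single_valued DCST"
proof (rule single_valuedI)
  fix x y z
  assume "(x, y) \<in> DCST"
  then obtain m E S C where
    y: "x = enc_dcst m E S C" "dcst_instance {..<m} E S C"
    "y = enc_option enc_rat (dcst {..<m} E S C)"
    unfolding DCST_def by blast
  assume "(x, z) \<in> DCST"
  then obtain n F T D where
    z: "x = enc_dcst n F T D" "dcst_instance {..<n} F T D"
    "z = enc_option enc_rat (dcst {..<n} F T D)"
    unfolding DCST_def by blast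
  have "m = n \<and> E = F \<and> S = T \<and> C = D"
    using y(1) z(1) by (intro enc_dcst_inj[OF _ y(2) z(2)]) simp
  then show "y = z"
    using y(3) z(3) by simp
qed

lemma single_valued_DDCST: "single_valued DDCST"
proof (rule single_valuedI)
  fix x y z
  assume "(x, y) \<in> DDCST"
  then obtain m E S q C where
    y: "x = enc_ddcst m E S q C" "ddcst_instance {..<m} E S q C"
    "y = enc_option enc_rat (ddcst {..<m} E S q C)"
    unfolding DDCST_def by blast
  assume "(x, z) \<in> DDCST"
  then obtain n F T r D where
    z: "x = enc_ddcst n F T r D" "ddcst_instance {..<n} F T r D"
    "z = enc_option enc_rat (ddcst {..<n} F T r D)"
    unfolding DDCST_def by blast
  have "m = n \<and> E = F \<and> S = T \<and> q = r \<and> C = D"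
    using y(1) z(1) by (intro enc_ddcst_inj[OF _ y(2) z(2)]) simp
  then show "y = z"
    using y(3) z(3) by simp
qed

end

theory Submission
  imports Defs
begin

text \<open>
  A tree has diameter at most \<open>D\<close> iff it has a centre, which is a vertex or, for odd \<open>D\<close>, possibly an
  edge, from which every vertex is at most \<open>D div 2\<close> edges away. Guess the centre \<open>{u, v}\<close>, shift all
  vertices by one and add a new root \<open>0\<close> with an edge of weight \<open>0\<close> to \<open>u\<close> and, if \<open>D\<close> is odd and
  \<open>u \<noteq> v\<close>, an edge to \<open>v\<close> that has the weight of \<open>{u, v}\<close>. The directed trees of height at most
  \<open>D div 2 + 1\<close> in this graph correspond to the trees with that centre, so the wanted weight is the
  minimum over all \<open>u\<close> and \<open>v\<close> of the answers of the oracle. The minimum of two answers is itself the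
  answer to a query on three vertices, so the machine only copies words and never calculates with
  rational numbers.
\<close>

section \<open>Structured programs for oracle Turing machines\<close>

subsection \<open>Tapes up to trailing blanks\<close>

text \<open>The centre has to be guessed because the directed problem limits only the depth of a
  tree; the extra 1 in the bound pays for the edge that leaves the new root. With an edge as centre
  both ends hang from the root, so \<open>{u, v}\<close> itself is lost and its weight is charged to
  the edge to \<open>v\<close>. A directed tree may, however, use \<open>v\<close> alone and pay
  this weight for nothing. Hence the answer to a query is in general only an upper bound of the
  optimum, attained when the centre is guessed correctly.

  The machine has to be exhibited, and its time bounded for every oracle that is correct on valid
  instances, with no assumption elsewhere. Therefore the minimum of two answers must itself be a
  valid instance with non-negative weights, and the absent diagonal of the undirected matrix has to
  be overwritten by zeros. Since answers are copied into later queries, their length matters too: it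
  is bounded by estimating reduced fractions under addition.\<close>

definition strip :: "symbol list \<Rightarrow> symbol list" where
  "strip xs = rev (dropWhile (\<lambda>s. s = None) (rev xs))"

definition scons :: "symbol \<Rightarrow> symbol list \<Rightarrow> symbol list" where
  "scons s xs = (if s = None \<and> xs = [] then [] else s # xs)"

fun hd0 :: "symbol list \<Rightarrow> symbol" where
  "hd0 [] = None"
| "hd0 (s # xs) = s"

text \<open>The tape lists of a machine can end in explicit blanks, left by moves beyond the written
  part, so one content has several representations. Programs are verified on the canonical one; the
  scanned symbol and the word at the head do not depend on the choice.\<close>

definition norm_tape :: "tape \<Rightarrow> tape" where
  "norm_tape t = (strip (fst t), strip (snd t))"

text \<open>\<open>act\<close> on canonical tapes. With \<open>hd0 [] = None\<close> and
  \<open>tl [] = []\<close> the two left moves of \<open>act\<close> become one equation.\<close>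

fun nact :: "symbol \<times> move \<Rightarrow> tape \<Rightarrow> tape" where
  "nact (s, Move_Left) (l, r) = (tl l, scons (hd0 l) (scons s (tl r)))"
| "nact (s, Stay) (l, r) = (l, scons s (tl r))"
| "nact (s, Move_Right) (l, r) = (scons s l, tl r)"

lemma strip_Nil [simp]: "strip [] = []"
  by (simp add: strip_def)

lemma strip_Cons [simp]: "strip (s # xs) = scons s (strip xs)"
  by (auto simp: strip_def scons_def dropWhile_append dropWhile_eq_Nil_conv split: if_splits)

lemma scons_Some [simp]: "scons (Some b) xs = Some b # xs"
  by (simp add: scons_def)

lemma scons_None_Nil [simp]: "scons None [] = []"
  by (simp add: scons_def)

lemma hd0_scons [simp]: "hd0 (scons s xs) = s"
  by (simp add: scons_def)

lemma tl_scons [simp]: "tl (scons s xs) = xs"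
  by (simp add: scons_def)

lemma strip_tl: "strip (tl xs) = tl (strip xs)"
  by (cases xs) auto

lemma strip_map_Some [simp]: "strip (map Some w) = map Some w"
  by (induction w) auto

lemma scons_hd0_strip [simp]: "scons (hd0 xs) (tl (strip xs)) = strip xs"
  by (cases xs) auto

lemma scanned_eq: "scanned t = hd0 (snd t)"
  by (cases t rule: scanned.cases) auto

lemma hd0_strip [simp]: "hd0 (strip xs) = hd0 xs"
  by (cases xs) auto

lemma scanned_norm [simp]: "scanned (norm_tape t) = scanned t"
  by (simp add: scanned_eq norm_tape_def)

lemma norm_act: "norm_tape (act x t) = nact x (norm_tape t)"
  by (cases "(x, t)" rule: act.cases) (auto simp: norm_tape_def strip_tl)

lemma nact_Stay: "nact (scanned t, Stay) (norm_tape t) = norm_tape t"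
  by (simp add: norm_tape_def scanned_eq)

lemma takeWhile_strip: "takeWhile (\<lambda>s. s \<noteq> None) (strip xs) = takeWhile (\<lambda>s. s \<noteq> None) xs"
  by (induction xs) (auto simp: scons_def)

lemma word_of_norm [simp]: "word_of (norm_tape t) = word_of t"
  by (simp only: word_of_def norm_tape_def snd_conv takeWhile_strip)

subsection \<open>Syntax and semantics\<close>

text \<open>The label of a query tells the compiled machine, which has a single resume state, where to
  continue; it is kept on tape 3 during the oracle call.\<close>

datatype com =
    Skip
  | Act nat "(nat \<Rightarrow> symbol) \<Rightarrow> symbol" move
  | Seq com com (infixr ";;" 60)
  | Cond "(nat \<Rightarrow> symbol) \<Rightarrow> bool" com com
  | Loop "(nat \<Rightarrow> symbol) \<Rightarrow> bool" com
  | Query bool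

type_synonym state = "nat \<Rightarrow> tape"

abbreviation scan :: "state \<Rightarrow> nat \<Rightarrow> symbol" where
  "scan s i \<equiv> scanned (s i)"

text \<open>Small-step control as a stack of pending programs. The stack carries no data and guards
  see scanned symbols only, as a finite control requires; the empty stack is stationary, like a
  halting configuration.\<close>

fun nxt :: "(nat \<Rightarrow> symbol) \<Rightarrow> com list \<Rightarrow> com list" where
  "nxt sc [] = []"
| "nxt sc (Skip # K) = K"
| "nxt sc (Act i e m # K) = K"
| "nxt sc ((a ;; b) # K) = a # b # K"
| "nxt sc (Cond g a b # K) = (if g sc then a else b) # K"
| "nxt sc (Loop g a # K) = (if g sc then a # Loop g a # K else K)"
| "nxt sc (Query l # K) = K"

fun upd :: "(bool list \<Rightarrow> bool list) \<Rightarrow> com list \<Rightarrow> state \<Rightarrow> state" where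
  "upd f (Act i e m # K) s = s(i := nact (e (scan s), m) (s i))"
| "upd f (Query l # K) s =
     s(3 := nact (Some l, Stay) (s 3), 1 := blank_tape, 2 := tape_of (f (word_of (s 1))))"
| "upd f K s = s"

definition cstep :: "(bool list \<Rightarrow> bool list) \<Rightarrow> com list \<times> state \<Rightarrow> com list \<times> state" where
  "cstep f c = (nxt (scan (snd c)) (fst c), upd f (fst c) (snd c))"

text \<open>Quantifying over the rest \<open>K\<close> of the stack makes runs compose, and
  \<open>n\<close> is only an upper bound, so that it may be weakened. Unfolding a sequence, a
  conditional or a loop costs one step: the source of the \<open>+ 1\<close> in the rules
  below.\<close>

definition run :: "(bool list \<Rightarrow> bool list) \<Rightarrow> com \<Rightarrow> state \<Rightarrow> nat \<Rightarrow> state \<Rightarrow> bool" where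
  "run f c s n s' \<longleftrightarrow> (\<forall>K. \<exists>t \<le> n. (cstep f ^^ t) (c # K, s) = (K, s'))"

lemma run_cstep:
  assumes "\<And>K. cstep f (c # K, s) = (K, s')" "1 \<le> n"
  shows "run f c s n s'"
  unfolding run_def using assms by (auto intro!: exI[of _ 1])

lemma run_weaken: "run f c s n s' \<Longrightarrow> n \<le> m \<Longrightarrow> run f c s m s'"
  unfolding run_def by (meson le_trans)

lemma funpow_cstep_trans:
  assumes "(cstep f ^^ t) x = y" "(cstep f ^^ u) y = z"
  shows "(cstep f ^^ (u + t)) x = z"
  using assms by (simp add: funpow_add)

lemma run_Skip: "run f Skip s 1 s"
  by (rule run_cstep) (auto simp: cstep_def)

lemma run_Act: "run f (Act i e m) s 1 (s(i := nact (e (scan s), m) (s i)))"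
  by (rule run_cstep) (auto simp: cstep_def)

lemma run_Query:
  "run f (Query l) s 1
     (s(3 := nact (Some l, Stay) (s 3), 1 := blank_tape, 2 := tape_of (f (word_of (s 1)))))"
  by (rule run_cstep) (auto simp: cstep_def)

lemma run_Seq:
  assumes "run f a s n s'" "run f b s' m s''"
  shows "run f (a ;; b) s (n + m + 1) s''"
  unfolding run_def
proof
  fix K
  obtain t where t: "t \<le> n" "(cstep f ^^ t) (a # b # K, s) = (b # K, s')"
    using assms(1) unfolding run_def by blast
  obtain u where u: "u \<le> m" "(cstep f ^^ u) (b # K, s') = (K, s'')"
    using assms(2) unfolding run_def by blast
  have "(cstep f ^^ 1) ((a ;; b) # K, s) = (a # b # K, s)"
    by (simp add: cstep_def)
  then have "(cstep f ^^ (u + (t + 1))) ((a ;; b) # K, s) = (K, s'')"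
    using t u by (intro funpow_cstep_trans)
  with t u show "\<exists>t\<le>n + m + 1. (cstep f ^^ t) ((a ;; b) # K, s) = (K, s'')"
    by (intro exI[of _ "u + (t + 1)"]) auto
qed

lemma run_Cond:
  assumes "run f (if g (scan s) then a else b) s n s'"
  shows "run f (Cond g a b) s (n + 1) s'"
  unfolding run_def
proof
  fix K
  obtain t where t: "t \<le> n"
      "(cstep f ^^ t) ((if g (scan s) then a else b) # K, s) = (K, s')"
    using assms unfolding run_def by blast
  have "(cstep f ^^ 1) (Cond g a b # K, s) = ((if g (scan s) then a else b) # K, s)"
    by (simp add: cstep_def)
  then have "(cstep f ^^ (t + 1)) (Cond g a b # K, s) = (K, s')"
    using t by (intro funpow_cstep_trans)
  with t show "\<exists>t\<le>n + 1. (cstep f ^^ t) (Cond g a b # K, s) = (K, s')"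
    by (intro exI[of _ "t + 1"]) auto
qed

lemma run_Loop_exit: "\<not> g (scan s) \<Longrightarrow> run f (Loop g a) s 1 s"
  by (rule run_cstep) (auto simp: cstep_def)

lemma run_Loop_step:
  assumes "g (scan s)" "run f a s n s'" "run f (Loop g a) s' m s''"
  shows "run f (Loop g a) s (n + m + 1) s''"
  unfolding run_def
proof
  fix K
  obtain t where t: "t \<le> n" "(cstep f ^^ t) (a # Loop g a # K, s) = (Loop g a # K, s')"
    using assms(2) unfolding run_def by blast
  obtain u where u: "u \<le> m" "(cstep f ^^ u) (Loop g a # K, s') = (K, s'')"
    using assms(3) unfolding run_def by blast
  have "(cstep f ^^ 1) (Loop g a # K, s) = (a # Loop g a # K, s)"
    using assms(1) by (simp add: cstep_def)
  then have "(cstep f ^^ (u + (t + 1))) (Loop g a # K, s) = (K, s'')"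
    using t u by (intro funpow_cstep_trans)
  with t u show "\<exists>t\<le>n + m + 1. (cstep f ^^ t) (Loop g a # K, s) = (K, s'')"
    by (intro exI[of _ "u + (t + 1)"]) auto
qed

subsection \<open>Compilation\<close>

text \<open>The control states of the compiled machine are the continuations (stacks of programs still to
  be executed) that can occur during a run.\<close>

fun conts :: "com \<Rightarrow> com list \<Rightarrow> com list set" where
  "conts (a ;; b) K = {(a ;; b) # K} \<union> conts a (b # K) \<union> conts b K"
| "conts (Cond g a b) K = {Cond g a b # K} \<union> conts a K \<union> conts b K"
| "conts (Loop g a) K = {Loop g a # K} \<union> conts a (Loop g a # K)"
| "conts c K = {c # K}"

lemma finite_conts: "finite (conts c K)"
  by (induction c arbitrary: K) auto

lemma conts_self: "c # K \<in> conts c K"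
  by (cases c) auto

text \<open>Execution leaves the set only towards \<open>K\<close>. The body of a loop runs in front
  of the loop itself, so an iteration returns to a stack that is already in the set; this is why
  loops do not make the control infinite.\<close>

lemma nxt_conts: "X \<in> conts c K \<Longrightarrow> nxt sc X \<in> insert K (conts c K)"
proof (induction c arbitrary: K)
  case (Seq a b)
  show ?case
    using Seq.prems Seq.IH(1)[of "b # K"] Seq.IH(2)[of K] conts_self[of a "b # K"]
      conts_self[of b K] by auto
next
  case (Cond g a b)
  show ?case
    using Cond.prems Cond.IH(1)[of K] Cond.IH(2)[of K] conts_self[of a K] conts_self[of b K] by auto
next
  case (Loop g a)
  show ?case
    using Loop.prems Loop.IH[of "Loop g a # K"] conts_self[of a "Loop g a # K"]
    by (cases "g sc") auto
qed auto

fun labels :: "com \<Rightarrow> bool list" where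
  "labels (a ;; b) = labels a @ labels b"
| "labels (Cond g a b) = labels a @ labels b"
| "labels (Loop g a) = labels a"
| "labels (Query l) = [l]"
| "labels c = []"

lemma Query_conts_labels: "Query l # X \<in> conts c K \<Longrightarrow> l \<in> set (labels c)"
  by (induction c arbitrary: K) auto

text \<open>All answers arrive in the same machine state. If no label occurs twice in the program,
  the label alone determines the stack on which execution continues.\<close>

lemma Query_conts_unique:
  assumes "distinct (labels c)" "Query l # X \<in> conts c K" "Query l # Y \<in> conts c K"
  shows "X = Y"
  using assms
proof (induction c arbitrary: K)
  case (Seq a b)
  then show ?case using Query_conts_labels by fastforce
next
  case (Cond g a b)
  then show ?case using Query_conts_labels by fastforce
qed auto

fun max_tape :: "com \<Rightarrow> nat" where
  "max_tape (a ;; b) = max (max_tape a) (max_tape b)"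
| "max_tape (Cond g a b) = max (max_tape a) (max_tape b)"
| "max_tape (Loop g a) = max_tape a"
| "max_tape (Act i e m) = i"
| "max_tape c = 0"

lemma Act_conts_max_tape: "Act i e m # X \<in> conts c K \<Longrightarrow> i \<le> max_tape c"
  by (induction c arbitrary: K) (auto simp: le_max_iff_disj)

definition kset :: "com \<Rightarrow> com list set" where
  "kset c = insert [] (conts c [])"

definition code :: "com \<Rightarrow> com list \<Rightarrow> nat" where
  "code c = (SOME h. bij_betw h (kset c) {0..<card (kset c)})"

lemma bij_code: "bij_betw (code c) (kset c) {0..<card (kset c)}"
proof -
  have "finite (kset c)" by (simp add: kset_def finite_conts)
  then show ?thesis unfolding code_def by (rule someI_ex[OF ex_bij_betw_finite_nat])
qed

lemma code_less: "X \<in> kset c \<Longrightarrow> code c X < card (kset c)"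
  using bij_code[of c] by (auto simp: bij_betw_def)

lemma code_inv: "X \<in> kset c \<Longrightarrow> inv_into (kset c) (code c) (code c X) = X"
  using bij_code[of c] by (auto simp: bij_betw_def inv_into_f_f)

lemma inv_code_in: "q < card (kset c) \<Longrightarrow> inv_into (kset c) (code c) q \<in> kset c"
  using bij_code[of c] by (metis atLeast0LessThan bij_betw_def inv_into_into lessThan_iff)

lemma nxt_kset: "X \<in> kset c \<Longrightarrow> nxt sc X \<in> kset c"
  using nxt_conts[of X c "[]" sc] by (auto simp: kset_def)

text \<open>The transition function must be total, also for a blank on tape 3 and for labels that no
  query uses. In these cases an arbitrary stack of \<open>kset c\<close> is chosen, which keeps the
  machine well-formed.\<close>

definition kont :: "com \<Rightarrow> symbol \<Rightarrow> com list" where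
  "kont c s = (SOME X. X \<in> kset c \<and>
     (\<forall>l. s = Some l \<longrightarrow> (\<exists>Y. Query l # Y \<in> kset c) \<longrightarrow> Query l # X \<in> kset c))"

lemma kont:
  "kont c s \<in> kset c \<and>
    (\<forall>l. s = Some l \<longrightarrow> (\<exists>Y. Query l # Y \<in> kset c) \<longrightarrow> Query l # kont c s \<in> kset c)"
  unfolding kont_def
proof (rule someI_ex)
  show "\<exists>X. X \<in> kset c \<and>
     (\<forall>l. s = Some l \<longrightarrow> (\<exists>Y. Query l # Y \<in> kset c) \<longrightarrow> Query l # X \<in> kset c)"
  proof (cases "\<exists>l Y. s = Some l \<and> Query l # Y \<in> kset c")
    case True
    then obtain l Y where "s = Some l" "Query l # Y \<in> kset c" by blast
    moreover from this have "Y \<in> kset c"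
      using nxt_kset[of "Query l # Y" c] by simp
    ultimately show ?thesis by blast
  next
    case False
    then show ?thesis by (intro exI[of _ "[]"]) (auto simp: kset_def)
  qed
qed

lemma kont_eq:
  assumes "distinct (labels c)" "Query l # X \<in> kset c"
  shows "kont c (Some l) = X"
proof -
  have "Query l # kont c (Some l) \<in> kset c"
    using kont[of c "Some l"] assms(2) by blast
  with assms show ?thesis
    by (auto simp: kset_def intro: Query_conts_unique)
qed

definition look :: "symbol list \<Rightarrow> nat \<Rightarrow> symbol" where
  "look ss j = (if j < length ss then ss ! j else None)"

text \<open>States below \<open>card (kset c)\<close> are stacks; the next two numbers are the query
  state and the resume state. A query stores its label and enters the query state, and resuming
  dispatches on the label. The branch for the query state only makes the function total, since
  \<open>step\<close> consults the oracle there.\<close>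

definition machine_delta :: "com \<Rightarrow> nat \<Rightarrow> symbol list \<Rightarrow> nat \<times> (symbol \<times> move) list" where
  "machine_delta c q ss =
    (if q = Suc (card (kset c)) then (code c (kont c (look ss 3)), map (\<lambda>s. (s, Stay)) ss)
     else if q = card (kset c) then (q, map (\<lambda>s. (s, Stay)) ss)
     else (case inv_into (kset c) (code c) q of
       Query l # K \<Rightarrow> (card (kset c), (map (\<lambda>s. (s, Stay)) ss)[3 := (Some l, Stay)])
     | Act i e m # K \<Rightarrow> (code c K, (map (\<lambda>s. (s, Stay)) ss)[i := (e (look ss), m)])
     | X \<Rightarrow> (code c (nxt (look ss) X), map (\<lambda>s. (s, Stay)) ss)))"

definition machine :: "com \<Rightarrow> otm" where
  "machine c = \<lparr>tapes = max_tape c + 4, states = Suc (Suc (card (kset c))),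
     start_state = code c [c], halt_state = code c [], query_state = card (kset c),
     resume_state = Suc (card (kset c)), delta = machine_delta c\<rparr>"

lemma machine_delta_wf:
  assumes "q < card (kset c)"
  shows "fst (machine_delta c q ss) < Suc (Suc (card (kset c)))"
    and "length (snd (machine_delta c q ss)) = length ss"
proof -
  let ?X = "inv_into (kset c) (code c) q"
  have X: "?X \<in> kset c" using assms by (rule inv_code_in)
  have "code c (nxt (look ss) ?X) < Suc (Suc (card (kset c)))"
    using code_less[OF nxt_kset[OF X, of "look ss"]] by simp
  then show "fst (machine_delta c q ss) < Suc (Suc (card (kset c)))"
    and "length (snd (machine_delta c q ss)) = length ss"
    using assms by (auto simp: machine_delta_def split: list.split com.split)
qed

lemma wf_machine: "wf_otm (machine c)"
proof -
  have k: "[] \<in> kset c" "[c] \<in> kset c"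
    using conts_self[of c "[]"] by (auto simp: kset_def)
  have "fst (machine_delta c q ss) < Suc (Suc (card (kset c))) \<and>
        length (snd (machine_delta c q ss)) = length ss"
    if q: "q < Suc (Suc (card (kset c)))" for q ss
  proof (cases "q < card (kset c)")
    case True
    then show ?thesis using machine_delta_wf by blast
  next
    case False
    with q have "q = card (kset c) \<or> q = Suc (card (kset c))" by auto
    then show ?thesis
      using code_less[of "kont c (look ss 3)" c] kont[of c "look ss 3"]
      by (auto simp: machine_delta_def)
  qed
  then show ?thesis
    using code_less[OF k(1)] code_less[OF k(2)] by (auto simp: wf_otm_def machine_def)
qed

definition simulates :: "com \<Rightarrow> com list \<times> state \<Rightarrow> config \<Rightarrow> bool" where
  "simulates c x y \<longleftrightarrow> fst x \<in> kset c \<and> fst y = code c (fst x) \<and>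
     length (snd y) = max_tape c + 4 \<and>
     snd x = (\<lambda>j. if j < max_tape c + 4 then norm_tape (snd y ! j) else blank_tape)"

lemma norm_blank [simp]: "norm_tape blank_tape = blank_tape"
  by (simp add: norm_tape_def blank_tape_def)

lemma norm_tape_of [simp]: "norm_tape (tape_of w) = tape_of w"
  by (simp add: norm_tape_def tape_of_def)

lemma norm_tape_stay [simp]: "norm_tape (act (scanned t, Stay) t) = norm_tape t"
  by (simp add: norm_act nact_Stay)

lemma code_eq_iff: "X \<in> kset c \<Longrightarrow> Y \<in> kset c \<Longrightarrow> code c X = code c Y \<longleftrightarrow> X = Y"
  by (meson bij_betw_imp_inj_on bij_code inj_on_eq_iff)

text \<open>A query takes three machine steps (store the label, oracle call, dispatch), every other
  program takes one, and the empty stack none.\<close>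

lemma simulates_step:
  assumes sim: "simulates c (X, s) (q, ts)" and dist: "distinct (labels c)"
  shows "\<exists>t\<le>3. simulates c (cstep f (X, s)) ((step f (machine c) ^^ t) (q, ts))"
proof -
  let ?k = "max_tape c + 4" and ?M = "machine c" and ?N = "card (kset c)"
  have X: "X \<in> kset c" and q: "q = code c X" and len: "length ts = ?k"
    and s: "s = (\<lambda>j. if j < ?k then norm_tape (ts ! j) else blank_tape)"
    using sim by (auto simp: simulates_def)
  have qN: "q < ?N" using code_less[OF X] q by simp
  have scan: "look (map scanned ts) = scan s"
    by (auto simp: look_def s len fun_eq_iff blank_tape_def)
  have nilk: "[] \<in> kset c" by (simp add: kset_def)
  have nx: "nxt (scan s) X \<in> kset c" by (rule nxt_kset[OF X])
  show ?thesis
  proof (cases "X = []")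
    case True
    then have "cstep f (X, s) = (X, s)" by (simp add: cstep_def)
    with sim show ?thesis by (intro exI[of _ 0]) auto
  next
    case ne: False
    then have nh: "q \<noteq> halt_state ?M" "q \<noteq> query_state ?M"
      using code_eq_iff[OF X nilk] qN q by (auto simp: machine_def)
    have inv: "inv_into (kset c) (code c) q = X"
      using code_inv[OF X] q by simp
    have stay: "map2 act (map (\<lambda>s. (s, Stay)) (map scanned ts)) ts = map (\<lambda>t. act (scanned t, Stay) t) ts"
      by (simp add: zip_map1 zip_same_conv_map)
    show ?thesis
    proof (cases "\<exists>l K. X = Query l # K")
      case True
      then obtain l K where XQ: "X = Query l # K" by blast
      define ts1 where "ts1 = map2 act ((map (\<lambda>s. (s, Stay)) (map scanned ts))[3 := (Some l, Stay)]) ts"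
      have l1: "length ts1 = ?k" by (simp add: ts1_def len)
      have n1: "norm_tape (ts1 ! j) = (s(3 := nact (Some l, Stay) (s 3))) j" if "j < ?k" for j
        using that by (auto simp: ts1_def len s norm_act nth_list_update nact_Stay)
      define ts2 where "ts2 = ts1[1 := blank_tape, 2 := tape_of (f (word_of (ts1 ! 1)))]"
      define ts3 where "ts3 = map (\<lambda>t. act (scanned t, Stay) t) ts2"
      have l3: "length ts3 = ?k" by (simp add: ts3_def ts2_def l1)
      have 1: "step f ?M (q, ts) = (query_state ?M, ts1)"
        using nh qN by (simp add: step_def, simp add: machine_def machine_delta_def inv XQ ts1_def)
      have 2: "step f ?M (query_state ?M, ts1) = (resume_state ?M, ts2)"
        using wf_machine[of c] by (simp add: step_def wf_otm_def ts2_def)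
      \<comment> \<open>The oracle step overwrites only tapes 1 and 2, so the label stored one step
        earlier is still scanned on tape 3.\<close>
      have sc3: "look (map scanned ts2) 3 = Some l"
        using n1[of 3] l1 scanned_norm[of "ts1 ! 3"]
        by (simp add: look_def ts2_def len s norm_tape_def scanned_eq)
      have K: "kont c (Some l) = K"
        using kont_eq[OF dist] X XQ by blast
      have "code c [] < ?N" by (rule code_less[OF nilk])
      then have 3: "step f ?M (resume_state ?M, ts2) = (code c K, ts3)"
        by (simp add: step_def, simp add: machine_def machine_delta_def sc3 K ts3_def
            zip_map1 zip_same_conv_map)
      have "norm_tape (ts3 ! j) = upd f X s j" if "j < ?k" for j
        using that l1 n1[of j] n1[of 1] word_of_norm[of "ts1 ! 1"]
        by (auto simp: ts3_def ts2_def XQ nth_list_update)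
      then have up: "upd f X s = (\<lambda>j. if j < ?k then norm_tape (ts3 ! j) else blank_tape)"
        by (auto simp: fun_eq_iff XQ s)
      have "(step f ?M ^^ 3) (q, ts) = (code c K, ts3)"
        by (simp add: eval_nat_numeral 1 2 3)
      moreover have "simulates c (cstep f (X, s)) (code c K, ts3)"
        using nx up l3 by (simp add: simulates_def cstep_def XQ cong: if_cong)
      ultimately show ?thesis by (intro exI[of _ 3]) simp
    next
      case noQ: False
      show ?thesis
      proof (cases "\<exists>i e m K. X = Act i e m # K")
        case True
        then obtain i e m K where XA: "X = Act i e m # K" by blast
        have i: "i < ?k"
          using Act_conts_max_tape[of i e m K c "[]"] X XA by (auto simp: kset_def)
        define ts1 where
          "ts1 = map2 act ((map (\<lambda>s. (s, Stay)) (map scanned ts))[i := (e (scan s), m)]) ts"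
        have l1: "length ts1 = ?k" by (simp add: ts1_def len)
        have "norm_tape (ts1 ! j) = upd f X s j" if "j < ?k" for j
        proof (cases "j = i")
          case True
          then show ?thesis using that by (simp add: ts1_def len XA norm_act) (simp add: s)
        next
          case False
          then show ?thesis using that by (simp add: ts1_def len XA) (simp add: s)
        qed
        then have up: "upd f X s = (\<lambda>j. if j < ?k then norm_tape (ts1 ! j) else blank_tape)"
          using i by (auto simp: fun_eq_iff XA) (simp_all add: s)
        have "step f ?M (q, ts) = (code c K, ts1)"
          using nh qN by (simp add: step_def, simp add: machine_def machine_delta_def inv XA ts1_def scan)
        moreover have "simulates c (cstep f (X, s)) (code c K, ts1)"
          using nx up l1 by (simp add: simulates_def cstep_def XA cong: if_cong)
        ultimately show ?thesis by (intro exI[of _ 1]) simp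
      next
        case noA: False
        define ts1 where "ts1 = map (\<lambda>t. act (scanned t, Stay) t) ts"
        obtain a K where aK: "X = a # K" using ne by (cases X) auto
        have d: "machine_delta c q (map scanned ts) =
            (code c (nxt (scan s) X), map (\<lambda>s. (s, Stay)) (map scanned ts))"
          using qN noQ noA by (cases a) (simp_all add: machine_delta_def inv aK scan)
        then have "step f ?M (q, ts) = (code c (nxt (scan s) X), ts1)"
          using nh by (simp add: step_def)
            (simp add: machine_def d ts1_def zip_map1 zip_same_conv_map)
        moreover have "upd f X s = s"
          using noQ noA by (cases a) (simp_all add: aK)
        then have "simulates c (cstep f (X, s)) (code c (nxt (scan s) X), ts1)"
          using nx len by (auto simp: simulates_def cstep_def ts1_def s fun_eq_iff)
        ultimately show ?thesis by (intro exI[of _ 1]) simp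
      qed
    qed
  qed
qed

lemma simulates_steps:
  assumes "simulates c x y" "distinct (labels c)"
  shows "\<exists>t\<le>3 * n. simulates c ((cstep f ^^ n) x) ((step f (machine c) ^^ t) y)"
proof (induction n)
  case 0
  then show ?case using assms(1) by auto
next
  case (Suc n)
  then obtain t where t: "t \<le> 3 * n"
      "simulates c ((cstep f ^^ n) x) ((step f (machine c) ^^ t) y)" by blast
  obtain X s q ts where eq: "(cstep f ^^ n) x = (X, s)" "(step f (machine c) ^^ t) y = (q, ts)"
    by fastforce
  obtain u where "u \<le> 3" "simulates c (cstep f (X, s)) ((step f (machine c) ^^ u) (q, ts))"
    using simulates_step[OF t(2)[unfolded eq] assms(2)] by blast
  then show ?case
    using t(1) by (intro exI[of _ "u + t"]) (simp add: funpow_add eq)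
qed

definition initial :: "bool list \<Rightarrow> state" where
  "initial x = (\<lambda>_. blank_tape)(0 := tape_of x)"

lemma computes_within_machine:
  assumes "run f c (initial x) n s" "distinct (labels c)" "word_of (s 0) = y" "3 * n \<le> b"
  shows "computes_within (machine c) f x y b"
proof -
  have "simulates c ([c], initial x) (init_config (machine c) x)"
    using conts_self[of c "[]"]
    by (auto simp: simulates_def init_config_def machine_def initial_def kset_def fun_eq_iff nth_Cons
        split: nat.split)
  moreover obtain t where t: "t \<le> n" "(cstep f ^^ t) ([c], initial x) = ([], s)"
    using assms(1) unfolding run_def by blast
  ultimately obtain u where u: "u \<le> 3 * t"
      "simulates c ([], s) ((step f (machine c) ^^ u) (init_config (machine c) x))"
    using simulates_steps[of c "([c], initial x)" "init_config (machine c) x" t f] assms(2) by auto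
  obtain q ts where qt: "(step f (machine c) ^^ u) (init_config (machine c) x) = (q, ts)"
    by fastforce
  have "q = halt_state (machine c)" "word_of (ts ! 0) = y"
    using u(2) assms(3) word_of_norm[of "ts ! 0"] unfolding qt by (auto simp: simulates_def machine_def)
  then show ?thesis
    using u(1) t(1) assms(4) qt unfolding computes_within_def
    by (intro exI[of _ u]) auto
qed

subsection \<open>Basic programs\<close>

text \<open>The block \<open>a @ b\<close> with the head \<open>length a\<close> cells after its start, right of the contents \<open>l\<close>.\<close>

definition tq :: "symbol list \<Rightarrow> bool list \<Rightarrow> bool list \<Rightarrow> tape" where
  "tq l a b = (map Some (rev a) @ l, map Some b)"

abbreviation tp :: "bool list \<Rightarrow> bool list \<Rightarrow> tape" where
  "tp \<equiv> tq []"

lemma blank_tape_tp: "blank_tape = tp [] []"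
  by (simp add: blank_tape_def tq_def)

lemma tape_of_tp: "tape_of w = tp [] w"
  by (simp add: tape_of_def tq_def)

lemma word_of_tq: "word_of (tq l a b) = b"
proof -
  have "takeWhile (\<lambda>s. s \<noteq> None) (map Some b) = map Some b"
    by (auto simp: takeWhile_eq_all_conv)
  then have "map the (takeWhile (\<lambda>s. s \<noteq> None) (map Some b)) = b"
    by (simp only: map_map o_def option.sel map_ident)
  then show ?thesis
    by (simp only: word_of_def tq_def snd_conv)
qed

lemma scanned_tq [simp]:
  "scanned (tq l a []) = None"
  "scanned (tq l a (x # b)) = Some x"
  by (auto simp: tq_def)

lemma nact_tq [simp]:
  "nact (Some x, Move_Right) (tq l a []) = tq l (a @ [x]) []"
  "nact (Some x, Move_Right) (tq l a (y # b)) = tq l (a @ [x]) b"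
  "nact (Some x, Stay) (tq l a []) = tq l a [x]"
  "nact (Some x, Stay) (tq l a (y # b)) = tq l a (x # b)"
  "nact (None, Move_Right) (tp [] b) = tp [] (tl b)"
  by (auto simp: tq_def map_tl)

lemma nact_tq_left [simp]:
  "nact (scanned (tq l (a @ [x]) b), Move_Left) (tq l (a @ [x]) b) = tq l a (x # b)"
  by (cases b) (auto simp: tq_def)

lemma run_SeqI:
  assumes "run f a s n s'" "run f b s' m s''" "n + m + 1 \<le> k"
  shows "run f (a ;; b) s k s''"
  using run_weaken[OF run_Seq[OF assms(1,2)] assms(3)] .

lemma run_eqI: "run f c s n s' \<Longrightarrow> s' = s'' \<Longrightarrow> run f c s n s''"
  by simp

lemma run_LoopI:
  assumes "g (scan s)" "run f a s n s'" "run f (Loop g a) s' m s''" "n + m + 1 \<le> k"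
  shows "run f (Loop g a) s k s''"
  using run_weaken[OF run_Loop_step[OF assms(1-3)] assms(4)] .

lemma run_Loop_exitI:
  assumes "\<not> g (scan s)" "s' = s" "1 \<le> k"
  shows "run f (Loop g a) s k s'"
  using run_weaken[OF run_Loop_exit[of g s f a] assms(3)] assms(1,2) by blast

lemma run_CondI:
  assumes "run f (if g (scan s) then a else b) s n s'" "n + 1 \<le> k"
  shows "run f (Cond g a b) s k s'"
  using run_weaken[OF run_Cond[of f g s a b, OF assms(1)] assms(2)] .

abbreviation right :: "nat \<Rightarrow> com" where
  "right i \<equiv> Act i (\<lambda>sc. sc i) Move_Right"

abbreviation left :: "nat \<Rightarrow> com" where
  "left i \<equiv> Act i (\<lambda>sc. sc i) Move_Left"

abbreviation emit :: "nat \<Rightarrow> bool \<Rightarrow> com" where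
  "emit j b \<equiv> Act j (\<lambda>_. Some b) Move_Right"

abbreviation nonblank :: "nat \<Rightarrow> (nat \<Rightarrow> symbol) \<Rightarrow> bool" where
  "nonblank i \<equiv> \<lambda>sc. sc i \<noteq> None"

abbreviation sees :: "nat \<Rightarrow> bool \<Rightarrow> (nat \<Rightarrow> symbol) \<Rightarrow> bool" where
  "sees i b \<equiv> \<lambda>sc. sc i = Some b"

lemma run_ActI: "s' = s(i := nact (e (scan s), m) (s i)) \<Longrightarrow> run f (Act i e m) s 1 s'"
  using run_Act by simp

lemma run_emit: "s j = tq l a [] \<Longrightarrow> run f (emit j b) s 1 (s(j := tq l (a @ [b]) []))"
  by (rule run_ActI) simp

lemma run_right: "s i = tq l a (x # b) \<Longrightarrow> run f (right i) s 1 (s(i := tq l (a @ [x]) b))"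
  by (rule run_ActI) simp

fun emits :: "nat \<Rightarrow> bool list \<Rightarrow> com" where
  "emits j [] = Skip"
| "emits j (b # bs) = emit j b ;; emits j bs"

lemma run_emits:
  "s j = tq l a [] \<Longrightarrow> run f (emits j w) s (2 * length w + 1) (s(j := tq l (a @ w) []))"
proof (induction w arbitrary: s a)
  case Nil
  then have "s(j := tq l (a @ []) []) = s" by auto
  then show ?case using run_Skip[of f s] by simp
next
  case (Cons b w)
  let ?s1 = "s(j := tq l (a @ [b]) [])"
  have "run f (emit j b) s 1 ?s1"
    using Cons.prems by (rule run_emit)
  moreover have "run f (emits j w) ?s1 (2 * length w + 1) (s(j := tq l (a @ b # w) []))"
    by (rule run_eqI, rule Cons.IH[of _ "a @ [b]"]) auto
  ultimately show ?case
    unfolding emits.simps by (rule run_SeqI) simp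
qed

definition copy1 :: "nat \<Rightarrow> nat \<Rightarrow> com" where
  "copy1 i j = Act j (\<lambda>sc. sc i) Move_Right ;; right i"

lemma run_copy1:
  assumes "s i = tq k a (x # b)" "s j = tq l c []" "i \<noteq> j"
  shows "run f (copy1 i j) s 3 (s(i := tq k (a @ [x]) b, j := tq l (c @ [x]) []))"
  unfolding copy1_def
proof (rule run_SeqI)
  show "run f (Act j (\<lambda>sc. sc i) Move_Right) s 1 (s(j := tq l (c @ [x]) []))"
    using assms by (intro run_ActI) simp
  show "run f (right i) (s(j := tq l (c @ [x]) [])) 1
      (s(i := tq k (a @ [x]) b, j := tq l (c @ [x]) []))"
    using assms by (intro run_ActI) (simp add: fun_upd_twist)
qed simp

definition bits :: "bool list \<Rightarrow> bool list" where
  "bits bs = concat (map (\<lambda>x. [True, x]) bs)"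

lemma bits_simps [simp]: "bits [] = []" "bits (x # bs) = True # x # bits bs"
  by (auto simp: bits_def)

lemma enc_list_bool: "enc_list enc_bool bs = bits bs @ [False]"
  by (induction bs) (auto simp: enc_bool_def)

lemma length_bits: "length (bits bs) = 2 * length bs"
  by (induction bs) auto

text \<open>The code is self-delimiting: \<open>True\<close> announces one more bit and
  \<open>False\<close> ends the list. Copying therefore needs no counter; the last
  \<open>copy1\<close> transfers the end marker.\<close>

definition copy_bits :: "nat \<Rightarrow> nat \<Rightarrow> com" where
  "copy_bits i j = Loop (sees i True) (copy1 i j ;; copy1 i j) ;; copy1 i j"

lemma run_copy_bits:
  assumes "s i = tq k a (enc_list enc_bool bs @ b)" "s j = tq l c []" "i \<noteq> j"
  shows "run f (copy_bits i j) s (5 * length (enc_list enc_bool bs))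
     (s(i := tq k (a @ enc_list enc_bool bs) b, j := tq l (c @ enc_list enc_bool bs) []))"
proof -
  have loop: "run f (Loop (sees i True) (copy1 i j ;; copy1 i j)) s (8 * length bs + 1)
      (s(i := tq k (a @ bits bs) (False # b), j := tq l (c @ bits bs) []))"
    if "s i = tq k a (bits bs @ False # b)" "s j = tq l c []" for s a c bs
    using that
  proof (induction bs arbitrary: s a c)
    case Nil
    then show ?case
      by (intro run_Loop_exitI) (auto simp: fun_eq_iff)
  next
    case (Cons x bs)
    let ?s1 = "s(i := tq k (a @ [True]) (x # bits bs @ False # b), j := tq l (c @ [True]) [])"
    let ?s2 = "s(i := tq k (a @ [True, x]) (bits bs @ False # b), j := tq l (c @ [True, x]) [])"
    have "run f (copy1 i j) s 3 ?s1"
      using Cons.prems assms(3) by (intro run_copy1) auto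
    moreover have "run f (copy1 i j) ?s1 3 ?s2"
      using run_copy1[of ?s1 i k "a @ [True]" x "bits bs @ False # b" j l "c @ [True]" f] assms(3)
      by (simp add: fun_upd_twist)
    ultimately have "run f (copy1 i j ;; copy1 i j) s 7 ?s2"
      by (rule run_SeqI) simp
    moreover have "run f (Loop (sees i True) (copy1 i j ;; copy1 i j)) ?s2 (8 * length bs + 1)
        (s(i := tq k (a @ bits (x # bs)) (False # b), j := tq l (c @ bits (x # bs)) []))"
      by (rule run_eqI, rule Cons.IH[of _ "a @ [True, x]" "c @ [True, x]"]) (use assms in \<open>auto simp: fun_eq_iff\<close>)
    ultimately show ?case
      by (rule run_LoopI[rotated]) (use Cons.prems in simp_all)
  qed
  let ?s1 = "s(i := tq k (a @ bits bs) (False # b), j := tq l (c @ bits bs) [])"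
  have "run f (copy_bits i j) s (5 * length (enc_list enc_bool bs))
     (?s1(i := tq k ((a @ bits bs) @ [False]) b, j := tq l ((c @ bits bs) @ [False]) []))"
    unfolding copy_bits_def
  proof (rule run_SeqI)
    show "run f (Loop (sees i True) (copy1 i j ;; copy1 i j)) s (8 * length bs + 1) ?s1"
      using assms enc_list_bool by (intro loop) auto
    show "run f (copy1 i j) ?s1 3
        (?s1(i := tq k ((a @ bits bs) @ [False]) b, j := tq l ((c @ bits bs) @ [False]) []))"
      using assms(3) by (intro run_copy1) auto
  qed (simp add: enc_list_bool length_bits)
  then show ?thesis
    using assms(3) by (simp add: enc_list_bool fun_upd_twist)
qed

abbreviation entry :: "rat option \<Rightarrow> bool list" where
  "entry \<equiv> enc_option enc_rat"

text \<open>The tag \<open>True\<close> is followed by numerator and denominator, hence two bit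
  lists; an absent weight is the tag \<open>False\<close> alone.\<close>

definition copy_entry :: "nat \<Rightarrow> nat \<Rightarrow> com" where
  "copy_entry i j = Cond (sees i True) (copy1 i j ;; copy_bits i j ;; copy_bits i j) (copy1 i j)"

lemma run_copy_entry:
  assumes s: "s i = tq k a (entry w @ b)" "s j = tq l c []" and ij: "i \<noteq> j"
  shows "run f (copy_entry i j) s (6 * length (entry w))
     (s(i := tq k (a @ entry w) b, j := tq l (c @ entry w) []))"
proof (cases w)
  case None
  have "run f (copy1 i j) s 3 (s(i := tq k (a @ [False]) b, j := tq l (c @ [False]) []))"
    using s ij None by (intro run_copy1) auto
  then show ?thesis
    unfolding copy_entry_def using s None by (intro run_weaken[OF run_Cond]) auto
next
  case (Some q)
  obtain m n where q: "enc_rat q = enc_list enc_bool m @ enc_list enc_bool n"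
    by (auto simp: enc_rat_def enc_nat_def)
  let ?m = "enc_list enc_bool m" and ?n = "enc_list enc_bool n"
  let ?s1 = "s(i := tq k (a @ [True]) (?m @ ?n @ b), j := tq l (c @ [True]) [])"
  let ?s2 = "s(i := tq k (a @ True # ?m) (?n @ b), j := tq l (c @ True # ?m) [])"
  let ?s3 = "s(i := tq k (a @ True # ?m @ ?n) b, j := tq l (c @ True # ?m @ ?n) [])"
  have 1: "run f (copy1 i j) s 3 ?s1"
    using s ij Some q by (intro run_copy1) auto
  have 2: "run f (copy_bits i j) ?s1 (5 * length ?m) ?s2"
    using run_copy_bits[of ?s1 i k "a @ [True]" m "?n @ b" j l "c @ [True]" f] ij
    by (simp add: fun_upd_twist)
  have 3: "run f (copy_bits i j) ?s2 (5 * length ?n) ?s3"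
    using run_copy_bits[of ?s2 i k "a @ True # ?m" n b j l "c @ True # ?m" f] ij
    by (simp add: fun_upd_twist)
  have "length ?m \<ge> 1" "length ?n \<ge> 1"
    by (cases m; simp)(cases n; simp)
  have "run f (copy1 i j ;; copy_bits i j ;; copy_bits i j) s (5 * length ?m + 5 * length ?n + 5) ?s3"
    by (rule run_SeqI[OF 1 run_Seq[OF 2 3]]) simp
  then show ?thesis
    unfolding copy_entry_def using s Some q by (intro run_weaken[OF run_Cond]) auto
qed

definition copy_all :: "nat \<Rightarrow> nat \<Rightarrow> com" where
  "copy_all i j = Loop (nonblank i) (copy1 i j)"

lemma run_copy_all:
  assumes "s i = tq k a b" "s j = tq l c []" "i \<noteq> j"
  shows "run f (copy_all i j) s (4 * length b + 1) (s(i := tq k (a @ b) [], j := tq l (c @ b) []))"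
  using assms
proof (induction b arbitrary: s a c)
  case Nil
  then show ?case
    unfolding copy_all_def by (intro run_Loop_exitI) (auto simp: fun_eq_iff)
next
  case (Cons x b)
  let ?s1 = "s(i := tq k (a @ [x]) b, j := tq l (c @ [x]) [])"
  have "run f (copy1 i j) s 3 ?s1"
    using Cons.prems by (rule run_copy1)
  moreover have "run f (copy_all i j) ?s1 (4 * length b + 1)
      (s(i := tq k (a @ x # b) [], j := tq l (c @ x # b) []))"
    by (rule run_eqI, rule Cons.IH[of _ "a @ [x]" "c @ [x]"]) (use Cons.prems in \<open>auto simp: fun_eq_iff\<close>)
  ultimately show ?case
    unfolding copy_all_def by (rule run_LoopI[rotated]) (use Cons.prems in simp_all)
qed

text \<open>Used on a source block with nothing to its left: a blank left behind there vanishes from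
  the canonical tape because \<open>scons None [] = []\<close>, so erasing while moving right leaves
  the tape as if it began at the head.\<close>

definition move_all :: "nat \<Rightarrow> nat \<Rightarrow> com" where
  "move_all i j = Loop (nonblank i) (Act j (\<lambda>sc. sc i) Move_Right ;; Act i (\<lambda>_. None) Move_Right)"

lemma run_move_all:
  assumes "s i = tp [] b" "s j = tq l c []" "i \<noteq> j"
  shows "run f (move_all i j) s (4 * length b + 1) (s(i := tp [] [], j := tq l (c @ b) []))"
  using assms
proof (induction b arbitrary: s c)
  case Nil
  then show ?case
    unfolding move_all_def by (intro run_Loop_exitI) (auto simp: fun_eq_iff)
next
  case (Cons x b)
  let ?s1 = "s(i := tp [] b, j := tq l (c @ [x]) [])"
  have "run f (Act j (\<lambda>sc. sc i) Move_Right ;; Act i (\<lambda>_. None) Move_Right) s 3 ?s1"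
  proof (rule run_SeqI)
    show "run f (Act j (\<lambda>sc. sc i) Move_Right) s 1 (s(j := tq l (c @ [x]) []))"
      using Cons.prems by (intro run_ActI) simp
    show "run f (Act i (\<lambda>_. None) Move_Right) (s(j := tq l (c @ [x]) [])) 1 ?s1"
      using Cons.prems by (intro run_ActI) (simp add: fun_upd_twist)
  qed simp
  moreover have "run f (move_all i j) ?s1 (4 * length b + 1) (s(i := tp [] [], j := tq l (c @ x # b) []))"
    by (rule run_eqI, rule Cons.IH[of _ "c @ [x]"]) (use Cons.prems in \<open>auto simp: fun_eq_iff\<close>)
  ultimately show ?case
    unfolding move_all_def by (rule run_LoopI[rotated]) (use Cons.prems in simp_all)
qed

definition discard :: "nat \<Rightarrow> com" where
  "discard i = Loop (nonblank i) (Act i (\<lambda>_. None) Move_Right)"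

lemma run_discard:
  "s i = tp [] b \<Longrightarrow> run f (discard i) s (2 * length b + 1) (s(i := tp [] []))"
proof (induction b arbitrary: s)
  case Nil
  then show ?case
    unfolding discard_def by (intro run_Loop_exitI) (auto simp: fun_eq_iff)
next
  case (Cons x b)
  have "run f (Act i (\<lambda>_. None) Move_Right) s 1 (s(i := tp [] b))"
    using Cons.prems by (intro run_ActI) simp
  moreover have "run f (discard i) (s(i := tp [] b)) (2 * length b + 1) (s(i := tp [] []))"
    by (rule run_eqI, rule Cons.IH[of _]) (use Cons.prems in \<open>auto simp: fun_eq_iff\<close>)
  ultimately show ?case
    unfolding discard_def by (rule run_LoopI[rotated]) (use Cons.prems in simp_all)
qed

definition rewind :: "nat \<Rightarrow> com" where
  "rewind i = left i ;; Loop (nonblank i) (left i) ;; right i"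

text \<open>The conditions on \<open>l\<close> say that it is empty or a separating blank with
  further contents behind it; the leftward scan stops at that blank and preserves what lies beyond.
  The initial step to the left is needed because the head usually stands on the blank after the
  block.\<close>

lemma run_rewind:
  assumes "s i = tq l a b" and l: "hd0 l = None" "scons None (tl l) = l"
  shows "run f (rewind i) s (2 * length a + 6) (s(i := tq l [] (a @ b)))"
proof -
  \<comment> \<open>The tape with its head on the blank just before the block.\<close>
  let ?e = "\<lambda>b. (tl l, scons None (map Some b))"
  have left0: "nact (scanned (tq l [] b), Move_Left) (tq l [] b) = ?e b" for b
    using l by (cases b) (auto simp: tq_def)
  have loop: "run f (Loop (nonblank i) (left i)) s (2 * length a + 1) (s(i := ?e (a @ b)))"
    if "s i = nact (scanned (tq l a b), Move_Left) (tq l a b)" for s a b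
    using that
  proof (induction a arbitrary: s b rule: rev_induct)
    case Nil
    then have "s i = ?e b" using left0 by simp
    then show ?case
      by (intro run_Loop_exitI) (auto simp: fun_eq_iff scanned_eq)
  next
    case (snoc x a)
    then have si: "s i = tq l a (x # b)" by simp
    let ?s1 = "s(i := nact (scanned (s i), Move_Left) (s i))"
    have "run f (left i) s 1 ?s1" by (rule run_ActI) simp
    moreover have "run f (Loop (nonblank i) (left i)) ?s1 (2 * length a + 1)
        (s(i := ?e ((a @ [x]) @ b)))"
      by (rule run_eqI, rule snoc.IH[of _ "x # b"]) (auto simp: si)
    ultimately show ?case
      by (rule run_LoopI[rotated]) (use si in simp_all)
  qed
  let ?s1 = "s(i := nact (scanned (tq l a b), Move_Left) (tq l a b))"
  let ?s2 = "s(i := ?e (a @ b))"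
  have 1: "run f (left i) s 1 ?s1"
    using assms(1) by (intro run_ActI) simp
  have 2: "run f (Loop (nonblank i) (left i)) ?s1 (2 * length a + 1) ?s2"
    using loop[of ?s1 a b] by simp
  have 3: "run f (right i) ?s2 1 (s(i := tq l [] (a @ b)))"
    using l by (intro run_ActI) (simp add: scanned_eq tq_def)
  show ?thesis
    unfolding rewind_def by (rule run_SeqI[OF 1 run_Seq[OF 2 3]]) simp
qed

lemma run_rewind_tp:
  "s i = tp a b \<Longrightarrow> run f (rewind i) s (2 * length a + 6) (s(i := tp [] (a @ b)))"
  by (rule run_rewind) auto

subsection \<open>Marks\<close>

text \<open>A loop counter as the position of a mark, so that row and column indices are compared by
  scanning a cell. The value \<open>u = n\<close> is the word without a mark, the end of the
  loop.\<close>

definition onehot :: "nat \<Rightarrow> nat \<Rightarrow> bool list" where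
  "onehot u n = map (\<lambda>j. j = u) [0..<n]"

text \<open>The test for a blank makes this a no-op behind the last cell, so advancing from the last
  position yields \<open>onehot n n\<close>, and \<open>n = 0\<close> needs no special
  treatment.\<close>

definition mark :: "nat \<Rightarrow> com" where
  "mark i = Cond (nonblank i) (Act i (\<lambda>_. Some True) Stay) Skip"

lemma length_onehot [simp]: "length (onehot u n) = n"
  by (simp add: onehot_def)

lemma run_mark:
  assumes "s i = tq l a b"
  shows "run f (mark i) s 2 (s(i := tq l a (if b = [] then [] else True # tl b)))"
proof -
  have "run f (if scan s i \<noteq> None then Act i (\<lambda>_. Some True) Stay else Skip) s 1
    (s(i := tq l a (if b = [] then [] else True # tl b)))"
  proof (cases b)
    case Nil
    then have "s(i := tq l a (if b = [] then [] else True # tl b)) = s"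
      using assms by auto
    then show ?thesis using run_Skip[of f s] assms Nil by simp
  next
    case (Cons x b')
    have "run f (Act i (\<lambda>_. Some True) Stay) s 1 (s(i := tq l a (True # b')))"
      using assms Cons by (intro run_ActI) simp
    then show ?thesis using assms Cons by simp
  qed
  then show ?thesis
    unfolding mark_def by (intro run_weaken[OF run_Cond]) auto
qed

lemma onehot_split:
  "u < n \<Longrightarrow> onehot u n = replicate u False @ True # replicate (n - Suc u) False"
  by (rule nth_equalityI) (auto simp: onehot_def nth_append nth_Cons' )

lemma onehot_none: "onehot n n = replicate n False"
  by (rule nth_equalityI) (auto simp: onehot_def)

lemma run_mark_onehot:
  assumes "s i = tp [] (onehot n n)"
  shows "run f (mark i) s 2 (s(i := tp [] (onehot 0 n)))"
proof -
  have "(if onehot n n = [] then [] else True # tl (onehot n n)) = onehot 0 n"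
    by (cases n) (auto simp: onehot_none onehot_split[of 0])
  then show ?thesis using run_mark[of s i, OF assms, of f] by simp
qed

definition advance :: "nat \<Rightarrow> com" where
  "advance i = Loop (sees i False) (right i) ;; emit i False ;; mark i ;; rewind i"

lemma run_advance:
  assumes "s i = tp [] (onehot u n)" "u < n"
  shows "run f (advance i) s (5 * n + 20) (s(i := tp [] (onehot (Suc u) n)))"
proof -
  have loop: "run f (Loop (sees i False) (right i)) s (2 * k + 1)
      (s(i := tp (a @ replicate k False) (True # b)))"
    if "s i = tp a (replicate k False @ True # b)" for s a b k
    using that
  proof (induction k arbitrary: s a)
    case 0
    then show ?case
      by (intro run_Loop_exitI) (auto simp: fun_eq_iff)
  next
    case (Suc k)
    let ?s1 = "s(i := tp (a @ [False]) (replicate k False @ True # b))"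
    have "run f (right i) s 1 ?s1"
      using Suc.prems by (intro run_right) simp
    moreover have "run f (Loop (sees i False) (right i)) ?s1 (2 * k + 1)
        (s(i := tp (a @ replicate (Suc k) False) (True # b)))"
      by (rule run_eqI, rule Suc.IH[of _ "a @ [False]"]) (auto simp: replicate_append_same)
    ultimately show ?case
      by (rule run_LoopI[rotated]) (use Suc.prems in simp_all)
  qed
  let ?r = "replicate (n - Suc u) False"
  let ?r' = "if ?r = [] then [] else True # tl ?r"
  let ?s1 = "s(i := tp (replicate u False) (True # ?r))"
  let ?s2 = "s(i := tp (replicate u False @ [False]) ?r)"
  let ?s3 = "s(i := tp (replicate u False @ [False]) ?r')"
  have 1: "run f (Loop (sees i False) (right i)) s (2 * u + 1) ?s1"
    using loop[of s "[]" u ?r] assms by (simp add: onehot_split)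
  have 2: "run f (emit i False) ?s1 1 ?s2"
    by (rule run_ActI) simp
  have 3: "run f (mark i) ?s2 2 ?s3"
    using run_mark[of ?s2 i "[]" "replicate u False @ [False]" ?r f] by simp
  have eq: "(replicate u False @ [False]) @ ?r' = onehot (Suc u) n"
  proof (cases "Suc u = n")
    case True
    then show ?thesis by (auto simp: onehot_none replicate_append_same)
  next
    case False
    with assms(2) have "Suc u < n" by simp
    moreover then obtain m where "n - Suc u = Suc m" by (metis Suc_diff_Suc)
    ultimately show ?thesis by (simp add: onehot_split replicate_append_same)
  qed
  have 4: "run f (rewind i) ?s3 (2 * (u + 1) + 6) (s(i := tp [] (onehot (Suc u) n)))"
    using run_rewind_tp[of ?s3 i "replicate u False @ [False]" ?r' f] unfolding eq by simp
  show ?thesis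
    unfolding advance_def
    by (rule run_SeqI[OF 1 run_Seq[OF 2 run_Seq[OF 3 4]]])
      (use assms(2) in simp)
qed

section \<open>The reducing program\<close>

subsection \<open>The common part of all queries\<close>

definition items :: "rat option list \<Rightarrow> bool list" where
  "items ws = concat (map (\<lambda>w. True # entry w) ws)"

lemma items_simps [simp]:
  "items [] = []"
  "items (w # ws) = True # entry w @ items ws"
  "items (vs @ ws) = items vs @ items ws"
  by (auto simp: items_def)

lemma enc_list_concat: "enc_list e xs = concat (map (\<lambda>x. True # e x) xs) @ [False]"
  by (induction xs) auto

lemma enc_list_entry: "enc_list entry ws = items ws @ [False]"
  by (simp add: items_def enc_list_concat)

lemma length_entry_pos: "1 \<le> length (entry w)"
  by (cases w) auto

lemma length_items: "length ws \<le> length (items ws)"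
  by (induction ws) auto

text \<open>Zero is the fraction 0/1: an empty list of digits followed by the single digit of
  1.\<close>

lemma enc_rat_zero: "enc_rat 0 = [False, True, True, False]"
  by (simp add: enc_rat_def enc_nat_def bin.simps[of "Suc 0"] bin.simps[of 0] enc_bool_def
      rat_zero_code)

definition copy_item :: com where
  "copy_item = copy1 0 4 ;; copy_entry 0 4"

lemma run_copy_item:
  assumes "s 0 = tp a (True # entry w @ b)" "s 4 = tp c []"
  shows "run f copy_item s (6 * length (entry w) + 4)
    (s(0 := tp (a @ True # entry w) b, 4 := tp (c @ True # entry w) []))"
proof -
  let ?s1 = "s(0 := tp (a @ [True]) (entry w @ b), 4 := tp (c @ [True]) [])"
  let ?s2 = "s(0 := tp (a @ True # entry w) b, 4 := tp (c @ True # entry w) [])"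
  have 1: "run f (copy1 0 4) s 3 ?s1"
    using assms by (intro run_copy1) auto
  have 2: "run f (copy_entry 0 4) ?s1 (6 * length (entry w)) ?s2"
    by (rule run_eqI, rule run_copy_entry[where a = "a @ [True]" and c = "c @ [True]"]) auto
  show ?thesis
    unfolding copy_item_def by (rule run_SeqI[OF 1 2]) simp
qed

lemma run_copy_items_counted:
  assumes "s 0 = tp a (items ws @ b)" "s 4 = tp c []" "s 7 = tp d (replicate (length ws) True)"
  shows "run f (Loop (nonblank 7) (copy_item ;; right 7)) s (8 * length (items ws) + 1)
    (s(0 := tp (a @ items ws) b, 4 := tp (c @ items ws) [], 7 := tp (d @ replicate (length ws) True) []))"
  using assms
proof (induction ws arbitrary: s a c d)
  case Nil
  then show ?case
    by (intro run_Loop_exitI) (auto simp: fun_eq_iff)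
next
  case (Cons w ws)
  let ?s1 = "s(0 := tp (a @ True # entry w) (items ws @ b), 4 := tp (c @ True # entry w) [])"
  let ?s2 = "?s1(7 := tp (d @ [True]) (replicate (length ws) True))"
  have 1: "run f copy_item s (6 * length (entry w) + 4) ?s1"
    using Cons.prems by (intro run_copy_item) auto
  have 2: "run f (right 7) ?s1 1 ?s2"
    using Cons.prems by (intro run_right) auto
  have 3: "run f (Loop (nonblank 7) (copy_item ;; right 7)) ?s2 (8 * length (items ws) + 1)
    (s(0 := tp (a @ items (w # ws)) b, 4 := tp (c @ items (w # ws)) [],
       7 := tp (d @ replicate (length (w # ws)) True) []))"
    by (rule run_eqI, rule Cons.IH[of _ "a @ True # entry w" "c @ True # entry w" "d @ [True]"])
      (auto simp: fun_eq_iff)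
  show ?case
    by (rule run_LoopI[OF _ run_Seq[OF 1 2] 3])
      (use Cons.prems length_entry_pos[of w] in auto)
qed

lemma run_copy_items:
  assumes "s 0 = tp a (items ws @ False # b)" "s 4 = tp c []"
  shows "run f (Loop (sees 0 True) copy_item) s (8 * length (items ws) + 1)
    (s(0 := tp (a @ items ws) (False # b), 4 := tp (c @ items ws) []))"
  using assms
proof (induction ws arbitrary: s a c)
  case Nil
  then show ?case
    by (intro run_Loop_exitI) (auto simp: fun_eq_iff)
next
  case (Cons w ws)
  let ?s1 = "s(0 := tp (a @ True # entry w) (items ws @ False # b), 4 := tp (c @ True # entry w) [])"
  have 1: "run f copy_item s (6 * length (entry w) + 4) ?s1"
    using Cons.prems by (intro run_copy_item) auto
  have 2: "run f (Loop (sees 0 True) copy_item) ?s1 (8 * length (items ws) + 1)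
    (s(0 := tp (a @ items (w # ws)) (False # b), 4 := tp (c @ items (w # ws)) []))"
    by (rule run_eqI, rule Cons.IH[of _ "a @ True # entry w" "c @ True # entry w"])
      (auto simp: fun_eq_iff)
  show ?case
    by (rule run_LoopI[OF _ 1 2]) (use Cons.prems in auto)
qed

text \<open>Tape 7 contains the row number in unary.\<close>

definition diag_row :: com where
  "diag_row =
     Loop (nonblank 7) (copy_item ;; right 7) ;;
     copy1 0 4 ;; right 0 ;; emits 4 (entry (Some 0)) ;;
     emit 7 True ;; rewind 7 ;;
     Loop (sees 0 True) copy_item ;; copy1 0 4"

text \<open>After as many entries as the row number says, the head is at the absent diagonal entry.
  Its tag \<open>False\<close> is skipped and the code of weight 0 is written instead, as directed
  instances demand. The counter leaves one longer and rewound, ready for the next row.\<close>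

lemma run_diag_row:
  assumes "s 0 = tp a (enc_list entry (vs @ None # ws) @ b)" "s 4 = tp c []"
    and "s 7 = tp [] (replicate (length vs) True)"
  shows "run f diag_row s (20 * length (enc_list entry (vs @ None # ws)) + 40)
    (s(0 := tp (a @ enc_list entry (vs @ None # ws)) b,
       4 := tp (c @ enc_list entry (vs @ Some 0 # ws)) [],
       7 := tp [] (replicate (Suc (length vs)) True)))"
proof -
  let ?v = "items vs" and ?w = "items ws" and ?u = "replicate (length vs) True"
  let ?z = "entry (Some 0)"
  let ?s1 = "s(0 := tp (a @ ?v) (True # False # ?w @ False # b), 4 := tp (c @ ?v) [], 7 := tp ?u [])"
  let ?s2 = "?s1(0 := tp (a @ ?v @ [True]) (False # ?w @ False # b), 4 := tp (c @ ?v @ [True]) [])"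
  let ?s3 = "?s2(0 := tp (a @ ?v @ [True, False]) (?w @ False # b))"
  let ?s4 = "?s3(4 := tp (c @ ?v @ True # ?z) [])"
  let ?s5 = "?s4(7 := tp (?u @ [True]) [])"
  let ?s6 = "?s5(7 := tp [] (?u @ [True]))"
  let ?s7 = "?s6(0 := tp (a @ ?v @ [True, False] @ ?w) (False # b),
      4 := tp (c @ ?v @ True # ?z @ ?w) [])"
  let ?s8 = "?s7(0 := tp (a @ ?v @ [True, False] @ ?w @ [False]) b,
      4 := tp (c @ ?v @ True # ?z @ ?w @ [False]) [])"
  have 1: "run f (Loop (nonblank 7) (copy_item ;; right 7)) s (8 * length ?v + 1) ?s1"
    by (rule run_eqI, rule run_copy_items_counted[where d = "[]"])
      (auto simp: assms enc_list_entry)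
  have 2: "run f (copy1 0 4) ?s1 3 ?s2"
    by (rule run_eqI, rule run_copy1) auto
  have 3: "run f (right 0) ?s2 1 ?s3"
    by (rule run_eqI, rule run_right) auto
  have 4: "run f (emits 4 ?z) ?s3 (2 * length ?z + 1) ?s4"
    by (rule run_eqI, rule run_emits[where a = "c @ ?v @ [True]"]) auto
  have 5: "run f (emit 7 True) ?s4 1 ?s5"
    by (rule run_eqI, rule run_emit) auto
  have 6: "run f (rewind 7) ?s5 (2 * length (?u @ [True]) + 6) ?s6"
    by (rule run_eqI, rule run_rewind_tp) auto
  have 7: "run f (Loop (sees 0 True) copy_item) ?s6 (8 * length ?w + 1) ?s7"
    by (rule run_eqI, rule run_copy_items[where a = "a @ ?v @ [True, False]" and c = "c @ ?v @ True # ?z"])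
      auto
  have 8: "run f (copy1 0 4) ?s7 3 ?s8"
    by (rule run_eqI, rule run_copy1) auto
  have "run f diag_row s (20 * length (enc_list entry (vs @ None # ws)) + 40) ?s8"
    unfolding diag_row_def
    by (rule run_SeqI[OF 1 run_Seq[OF 2 run_Seq[OF 3 run_Seq[OF 4 run_Seq[OF 5 run_Seq[OF 6
       run_Seq[OF 7 8]]]]]]])
      (use length_items[of vs] in \<open>simp add: enc_list_entry enc_rat_zero\<close>)
  then show ?thesis
    by (rule run_eqI) (auto simp: fun_eq_iff enc_list_entry replicate_append_same)
qed

definition zero_diag :: "(nat \<Rightarrow> nat \<Rightarrow> rat option) \<Rightarrow> nat \<Rightarrow> nat \<Rightarrow> rat option" where
  "zero_diag A i j = (if i = j then Some 0 else A i j)"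

definition in_rows :: "nat \<Rightarrow> (nat \<Rightarrow> nat \<Rightarrow> rat option) \<Rightarrow> nat \<Rightarrow> bool list" where
  "in_rows n A k = concat (map (\<lambda>i. True # enc_list entry (map (A i) [0..<n])) [k..<n])"

text \<open>The leading \<open>None\<close> is column 0: no edge enters the new root.\<close>

definition out_rows :: "nat \<Rightarrow> (nat \<Rightarrow> nat \<Rightarrow> rat option) \<Rightarrow> nat \<Rightarrow> bool list" where
  "out_rows n A k =
     concat (map (\<lambda>i. True # enc_list entry (None # map (zero_diag A i) [0..<n])) [k..<n])"

lemma rows_step:
  assumes "k < n"
  shows "in_rows n A k = True # enc_list entry (map (A k) [0..<n]) @ in_rows n A (Suc k)"
    and "out_rows n A k =
      True # enc_list entry (None # map (zero_diag A k) [0..<n]) @ out_rows n A (Suc k)"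
  using assms by (simp_all add: in_rows_def out_rows_def upt_conv_Cons)

lemma rows_end [simp]: "in_rows n A n = []" "out_rows n A n = []"
  by (simp_all add: in_rows_def out_rows_def)

lemma row_split:
  assumes "k < n" "A k k = None"
  shows "map (A k) [0..<n] = map (A k) [0..<k] @ None # map (A k) [Suc k..<n]"
    and "map (zero_diag A k) [0..<n] = map (A k) [0..<k] @ Some 0 # map (A k) [Suc k..<n]"
proof -
  have "[0..<n] = [0..<k] @ k # [Suc k..<n]"
    using upt_add_eq_append[of 0 k "n - k"] assms(1) by (simp add: upt_conv_Cons)
  then show "map (A k) [0..<n] = map (A k) [0..<k] @ None # map (A k) [Suc k..<n]"
    "map (zero_diag A k) [0..<n] = map (A k) [0..<k] @ Some 0 # map (A k) [Suc k..<n]"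
    using assms(2) by (auto simp: zero_diag_def)
qed

text \<open>The three emitted bits are the tag of a new row, the tag of its first entry, and the
  absent entry in column 0.\<close>

definition diag_rows :: com where
  "diag_rows = Loop (sees 0 True) (right 0 ;; emits 4 [True, True, False] ;; diag_row)"

lemma run_diag_rows:
  assumes "k \<le> n" "\<And>i. i < n \<Longrightarrow> A i i = None"
    and "s 0 = tp a (in_rows n A k @ False # b)" "s 4 = tp c []" "s 7 = tp [] (replicate k True)"
  shows "run f diag_rows s (60 * length (in_rows n A k) + 1)
    (s(0 := tp (a @ in_rows n A k) (False # b), 4 := tp (c @ out_rows n A k) [],
       7 := tp [] (replicate n True)))"
  using assms(1,3-)
proof (induction k arbitrary: s a c rule: inc_induct)
  case base
  then show ?case
    unfolding diag_rows_def by (intro run_Loop_exitI) (auto simp: fun_eq_iff)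
next
  case (step k)
  let ?i = "enc_list entry (map (A k) [0..<n])" and ?r = "in_rows n A (Suc k)"
  let ?o = "enc_list entry (map (zero_diag A k) [0..<n])"
  note split = row_split[of k n A, OF \<open>k < n\<close> assms(2)[OF \<open>k < n\<close>]]
  note prems = step.prems[unfolded rows_step[OF \<open>k < n\<close>]]
  let ?s1 = "s(0 := tp (a @ [True]) (?i @ ?r @ False # b))"
  let ?s2 = "?s1(4 := tp (c @ [True, True, False]) [])"
  let ?s3 = "?s2(0 := tp (a @ True # ?i) (?r @ False # b), 4 := tp (c @ True # True # False # ?o) [],
      7 := tp [] (replicate (Suc k) True))"
  let ?s4 = "s(0 := tp (a @ in_rows n A k) (False # b), 4 := tp (c @ out_rows n A k) [],
       7 := tp [] (replicate n True))"
  have 1: "run f (right 0) s 1 ?s1"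
    using prems by (intro run_right) auto
  have 2: "run f (emits 4 [True, True, False]) ?s1 (2 * length [True, True, False] + 1) ?s2"
    using prems by (intro run_emits) auto
  have 3: "run f diag_row ?s2 (20 * length ?i + 40) ?s3"
    unfolding split
    by (rule run_eqI, rule run_diag_row[where a = "a @ [True]" and c = "c @ [True, True, False]"])
      (use prems in \<open>auto simp: split\<close>)
  have 4: "run f diag_rows ?s3 (60 * length ?r + 1) ?s4"
    by (rule run_eqI, rule step.IH[of _ "a @ True # ?i" "c @ True # True # False # ?o"])
      (auto simp: fun_eq_iff rows_step[OF \<open>k < n\<close>])
  show ?case
    unfolding diag_rows_def
    by (rule run_LoopI[OF _ run_Seq[OF 1 run_Seq[OF 2 3]] 4[unfolded diag_rows_def]])
      (use prems in \<open>auto simp: rows_step[OF \<open>k < n\<close>]\<close>)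
qed

text \<open>The set of terminals is coded with one bit per vertex, so this pass also produces two
  unmarked words of length \<open>n\<close>, from which the row and column counters are
  made.\<close>

definition copy_subset :: com where
  "copy_subset = Loop (sees 0 True) (copy1 0 4 ;; copy1 0 4 ;; emit 5 False ;; emit 6 False)"

lemma run_copy_subset:
  assumes "s 0 = tp a (bits bs @ False # b)" "s 4 = tp c []" "s 5 = tp d []" "s 6 = tp e []"
  shows "run f copy_subset s (12 * length bs + 1)
    (s(0 := tp (a @ bits bs) (False # b), 4 := tp (c @ bits bs) [],
       5 := tp (d @ replicate (length bs) False) [], 6 := tp (e @ replicate (length bs) False) []))"
  using assms
proof (induction bs arbitrary: s a c d e)
  case Nil
  then show ?case
    unfolding copy_subset_def by (intro run_Loop_exitI) (auto simp: fun_eq_iff)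
next
  case (Cons x bs)
  let ?s1 = "s(0 := tp (a @ [True]) (x # bits bs @ False # b), 4 := tp (c @ [True]) [])"
  let ?s2 = "?s1(0 := tp (a @ [True, x]) (bits bs @ False # b), 4 := tp (c @ [True, x]) [])"
  let ?s3 = "?s2(5 := tp (d @ [False]) [])"
  let ?s4 = "?s3(6 := tp (e @ [False]) [])"
  have 1: "run f (copy1 0 4) s 3 ?s1"
    by (rule run_eqI, rule run_copy1) (use Cons.prems in auto)
  have 2: "run f (copy1 0 4) ?s1 3 ?s2"
    by (rule run_eqI, rule run_copy1) auto
  have 3: "run f (emit 5 False) ?s2 1 ?s3"
    by (rule run_emit) (use Cons.prems in auto)
  have 4: "run f (emit 6 False) ?s3 1 ?s4"
    by (rule run_emit) (use Cons.prems in auto)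
  have 5: "run f copy_subset ?s4 (12 * length bs + 1)
    (s(0 := tp (a @ bits (x # bs)) (False # b), 4 := tp (c @ bits (x # bs)) [],
       5 := tp (d @ replicate (length (x # bs)) False) [],
       6 := tp (e @ replicate (length (x # bs)) False) []))"
    by (rule run_eqI, rule Cons.IH[of _ "a @ [True, x]" "c @ [True, x]" "d @ [False]" "e @ [False]"])
      (auto simp: fun_eq_iff)
  show ?case
    unfolding copy_subset_def
    by (rule run_LoopI[OF _ run_Seq[OF 1 run_Seq[OF 2 run_Seq[OF 3 4]]] 5[unfolded copy_subset_def]])
      (use Cons.prems in auto)
qed

section \<open>Incrementing a binary number\<close>

fun add_carry :: "bool \<Rightarrow> bool list \<Rightarrow> bool list" where
  "add_carry c [] = (if c then [True] else [])"
| "add_carry c (x # bs) = (x \<noteq> c) # add_carry (x \<and> c) bs"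

lemma add_carry_False [simp]: "add_carry False bs = bs"
  by (induction bs) auto

text \<open>\<open>bin\<close> lists the least significant digit first, so the carry travels in
  reading direction and one pass over the input suffices.\<close>

lemma bin_Suc: "bin (Suc n) = add_carry True (bin n)"
proof (induction n rule: less_induct)
  case (less n)
  show ?case
  proof (cases "n = 0")
    case True
    then show ?thesis by (simp add: bin.simps[of "Suc 0"] bin.simps[of 0])
  next
    case False
    show ?thesis
    proof (cases "even n")
      case True
      then have "bin (Suc n) = True # bin (n div 2)"
        by (subst bin.simps) simp
      moreover have "bin n = False # bin (n div 2)"
        using True False by (subst bin.simps) simp
      ultimately show ?thesis by simp
    next
      case odd: False
      then have "bin (Suc n) = False # bin (Suc (n div 2))"
        by (subst bin.simps) simp
      moreover have "bin n = True # bin (n div 2)"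
        using odd False by (subst bin.simps) simp
      moreover have "bin (Suc (n div 2)) = add_carry True (bin (n div 2))"
        using False by (intro less.IH) simp
      ultimately show ?thesis by simp
    qed
  qed
qed

definition increment :: com where
  "increment =
     Loop (sees 0 True)
       (right 0 ;; emit 4 True ;;
        Act 4 (\<lambda>sc. Some (sc 0 \<noteq> sc 3)) Move_Right ;;
        Act 3 (\<lambda>sc. Some (sc 0 = Some True \<and> sc 3 = Some True)) Stay ;; right 0) ;;
     Cond (sees 3 True) (emits 4 [True, True]) Skip"

lemma run_increment:
  assumes "s 0 = tp a (bits bs @ False # b)" "s 3 = tp [] [cy]" "s 4 = tp c []"
  shows "\<exists>cy'. run f increment s (10 * length bs + 10)
    (s(0 := tp (a @ bits bs) (False # b), 3 := tp [] [cy'], 4 := tp (c @ bits (add_carry cy bs)) []))"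
proof -
  let ?body = "right 0 ;; emit 4 True ;;
        Act 4 (\<lambda>sc. Some (sc 0 \<noteq> sc 3)) Move_Right ;;
        Act 3 (\<lambda>sc. Some (sc 0 = Some True \<and> sc 3 = Some True)) Stay ;; right 0"
  \<comment> \<open>The carry that remains decides whether one more digit is appended after the
    loop. Since it depends on the digits, it is found together with the output \<open>d\<close> in
    the same induction.\<close>
  have "\<exists>cy' d. d @ (if cy' then [True, True] else []) = bits (add_carry cy bs) \<and>
    run f (Loop (sees 0 True) ?body) s (10 * length bs + 1)
    (s(0 := tp (a @ bits bs) (False # b), 3 := tp [] [cy'], 4 := tp (c @ d) []))"
    using assms
  proof (induction bs arbitrary: s a c cy)
    case Nil
    then show ?case
      by (intro exI[of _ cy] exI[of _ "[]"] conjI run_Loop_exitI) (auto simp: fun_eq_iff)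
  next
    case (Cons x bs)
    let ?s1 = "s(0 := tp (a @ [True]) (x # bits bs @ False # b))"
    let ?s2 = "?s1(4 := tp (c @ [True]) [])"
    let ?s3 = "?s2(4 := tp (c @ [True, x \<noteq> cy]) [])"
    let ?s4 = "?s3(3 := tp [] [x \<and> cy])"
    let ?s5 = "?s4(0 := tp (a @ [True, x]) (bits bs @ False # b))"
    have 1: "run f (right 0) s 1 ?s1"
      by (rule run_right) (use Cons.prems in auto)
    have 2: "run f (emit 4 True) ?s1 1 ?s2"
      by (rule run_emit) (use Cons.prems in auto)
    have 3: "run f (Act 4 (\<lambda>sc. Some (sc 0 \<noteq> sc 3)) Move_Right) ?s2 1 ?s3"
      by (rule run_ActI) (use Cons.prems in auto)
    have 4: "run f (Act 3 (\<lambda>sc. Some (sc 0 = Some True \<and> sc 3 = Some True)) Stay) ?s3 1 ?s4"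
      by (rule run_ActI) (use Cons.prems in auto)
    have 5: "run f (right 0) ?s4 1 ?s5"
      by (rule run_eqI, rule run_right) auto
    have "\<exists>cy' d. d @ (if cy' then [True, True] else []) = bits (add_carry (x \<and> cy) bs) \<and>
      run f (Loop (sees 0 True) ?body) ?s5 (10 * length bs + 1)
      (?s5(0 := tp ((a @ [True, x]) @ bits bs) (False # b), 3 := tp [] [cy'],
           4 := tp ((c @ [True, x \<noteq> cy]) @ d) []))"
      by (rule Cons.IH) (use Cons.prems in auto)
    then obtain cy' d where d: "d @ (if cy' then [True, True] else []) = bits (add_carry (x \<and> cy) bs)"
      and 6: "run f (Loop (sees 0 True) ?body) ?s5 (10 * length bs + 1)
      (?s5(0 := tp ((a @ [True, x]) @ bits bs) (False # b), 3 := tp [] [cy'],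
           4 := tp ((c @ [True, x \<noteq> cy]) @ d) []))"
      by (elim exE conjE) (rule that)
    have "run f (Loop (sees 0 True) ?body) s (10 * length (x # bs) + 1)
      (?s5(0 := tp ((a @ [True, x]) @ bits bs) (False # b), 3 := tp [] [cy'],
           4 := tp ((c @ [True, x \<noteq> cy]) @ d) []))"
      by (rule run_LoopI[OF _ run_Seq[OF 1 run_Seq[OF 2 run_Seq[OF 3 run_Seq[OF 4 5]]]] 6]) (use Cons.prems in auto)
    then have "run f (Loop (sees 0 True) ?body) s (10 * length (x # bs) + 1)
      (s(0 := tp (a @ bits (x # bs)) (False # b), 3 := tp [] [cy'],
           4 := tp (c @ True # (x \<noteq> cy) # d) []))"
      by (rule run_eqI) (auto simp: fun_eq_iff)
    moreover have "(True # (x \<noteq> cy) # d) @ (if cy' then [True, True] else []) =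
        bits (add_carry cy (x # bs))"
      using d by simp
    ultimately show ?case by (intro exI conjI)
  qed
  then obtain cy' d where d: "d @ (if cy' then [True, True] else []) = bits (add_carry cy bs)"
    and 1: "run f (Loop (sees 0 True) ?body) s (10 * length bs + 1)
    (s(0 := tp (a @ bits bs) (False # b), 3 := tp [] [cy'], 4 := tp (c @ d) []))" (is "run _ _ _ _ ?s1")
    by (elim exE conjE) (rule that)
  let ?s2 = "?s1(4 := tp (c @ d @ (if cy' then [True, True] else [])) [])"
  have 2: "run f (Cond (sees 3 True) (emits 4 [True, True]) Skip) ?s1 6 ?s2"
  proof (cases cy')
    case True
    have "run f (emits 4 [True, True]) ?s1 (2 * length [True, True] + 1) ?s2"
      by (rule run_eqI, rule run_emits[where a = "c @ d"]) (auto simp: True)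
    with True show ?thesis by (intro run_CondI) auto
  next
    case False
    have "run f Skip ?s1 1 ?s2"
      by (rule run_eqI, rule run_Skip) (auto simp: False)
    with False show ?thesis by (intro run_CondI) auto
  qed
  have "run f increment s (10 * length bs + 10) ?s2"
    unfolding increment_def by (rule run_SeqI[OF 1 2]) simp
  moreover have "?s2 = s(0 := tp (a @ bits bs) (False # b), 3 := tp [] [cy'],
      4 := tp (c @ bits (add_carry cy bs)) [])"
    unfolding d by (auto simp: fun_eq_iff)
  ultimately show ?thesis
    by (intro exI[of _ cy']) simp
qed

text \<open>Everything after row 0 of a query, independent of \<open>u\<close> and \<open>v\<close>
  and therefore written once. The constants are: end of the matrix; the item
  \<open>True, False\<close> stating that the new root is no terminal; end of the subset; and
  \<open>enc_nat 0\<close>, the root.\<close>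

definition suffix :: "nat \<Rightarrow> (nat \<Rightarrow> nat \<Rightarrow> rat option) \<Rightarrow> bool list \<Rightarrow> nat \<Rightarrow> bool list" where
  "suffix n A bs D =
     out_rows n A 0 @ [False, True, False] @ bits bs @ [False, False] @ enc_nat (Suc (D div 2))"

text \<open>The first digit of \<open>D\<close> is its parity, stored on tape 8, and the other
  digits are those of \<open>D div 2\<close>. So halving is merely skipping a digit, and an
  increment with initial carry \<open>True\<close> gives the depth bound.\<close>

definition write_suffix :: com where
  "write_suffix =
     diag_rows ;; copy1 0 4 ;; emits 4 [True, False] ;; copy_subset ;; copy1 0 4 ;; emit 4 False ;;
     right 0 ;; Act 8 (\<lambda>sc. sc 0) Stay ;; right 0 ;;
     Act 3 (\<lambda>_. Some True) Stay ;; increment ;; emit 4 False"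

lemma run_write_suffix:
  assumes diag: "\<And>i. i < n \<Longrightarrow> A i i = None"
    and s: "s 0 = tp [] (in_rows n A 0 @ False # bits bs @ False # True # p # bits (bin m) @ [False])"
      "s 3 = tp [] []" "s 4 = tp [] []" "s 5 = tp [] []" "s 6 = tp [] []" "s 7 = tp [] []"
      "s 8 = tp [] []"
    and L: "length (in_rows n A 0) + length bs + length (bin m) \<le> L"
  shows "\<exists>s' cy. run f write_suffix s (60 * L + 100) s' \<and>
    s' 0 = tp (in_rows n A 0 @ False # bits bs @ False # True # p # bits (bin m)) [False] \<and>
    s' 1 = s 1 \<and> s' 2 = s 2 \<and> s' 3 = tp [] [cy] \<and>
    s' 4 = tp (out_rows n A 0 @ [False, True, False] @ bits bs @ [False, False] @ enc_nat (Suc m)) [] \<and>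
    s' 5 = tp (replicate (length bs) False) [] \<and> s' 6 = tp (replicate (length bs) False) [] \<and>
    s' 7 = tp [] (replicate n True) \<and> s' 8 = tp [] [p] \<and> s' 9 = s 9"
proof -
  let ?i = "in_rows n A 0" and ?o = "out_rows n A 0" and ?m = "bits (bin m)"
  let ?F = "replicate (length bs) False"
  let ?s1 = "s(0 := tp ?i (False # bits bs @ False # True # p # ?m @ [False]), 4 := tp ?o [],
      7 := tp [] (replicate n True))"
  let ?s2 = "?s1(0 := tp (?i @ [False]) (bits bs @ False # True # p # ?m @ [False]),
      4 := tp (?o @ [False]) [])"
  let ?s3 = "?s2(4 := tp (?o @ [False, True, False]) [])"
  let ?s4 = "?s3(0 := tp (?i @ False # bits bs) (False # True # p # ?m @ [False]),
      4 := tp (?o @ [False, True, False] @ bits bs) [], 5 := tp ?F [], 6 := tp ?F [])"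
  let ?s5 = "?s4(0 := tp (?i @ False # bits bs @ [False]) (True # p # ?m @ [False]),
      4 := tp (?o @ [False, True, False] @ bits bs @ [False]) [])"
  let ?s6 = "?s5(4 := tp (?o @ [False, True, False] @ bits bs @ [False, False]) [])"
  let ?s7 = "?s6(0 := tp (?i @ False # bits bs @ [False, True]) (p # ?m @ [False]))"
  let ?s8 = "?s7(8 := tp [] [p])"
  let ?s9 = "?s8(0 := tp (?i @ False # bits bs @ [False, True, p]) (?m @ [False]))"
  let ?s10 = "?s9(3 := tp [] [True])"
  let ?c = "?o @ [False, True, False] @ bits bs @ [False, False]"
  have 1: "run f diag_rows s (60 * length ?i + 1) ?s1"
    by (rule run_eqI, rule run_diag_rows[where a = "[]" and c = "[]" and k = 0]) (auto simp: s diag)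
  have 2: "run f (copy1 0 4) ?s1 3 ?s2"
    by (rule run_eqI, rule run_copy1) auto
  have 3: "run f (emits 4 [True, False]) ?s2 (2 * length [True, False] + 1) ?s3"
    by (rule run_eqI, rule run_emits) auto
  have 4: "run f copy_subset ?s3 (12 * length bs + 1) ?s4"
    by (rule run_eqI, rule run_copy_subset[where a = "?i @ [False]" and c = "?o @ [False, True, False]"
        and d = "[]" and e = "[]"]) (auto simp: s)
  have 5: "run f (copy1 0 4) ?s4 3 ?s5"
    by (rule run_eqI, rule run_copy1) auto
  have 6: "run f (emit 4 False) ?s5 1 ?s6"
    by (rule run_eqI, rule run_emit) auto
  have 7: "run f (right 0) ?s6 1 ?s7"
    by (rule run_eqI, rule run_right) auto
  have 8: "run f (Act 8 (\<lambda>sc. sc 0) Stay) ?s7 1 ?s8"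
    by (rule run_ActI) (auto simp: s)
  have 9: "run f (right 0) ?s8 1 ?s9"
    by (rule run_eqI, rule run_right) auto
  have 10: "run f (Act 3 (\<lambda>_. Some True) Stay) ?s9 1 ?s10"
    by (rule run_ActI) (auto simp: s)
  have "\<exists>cy. run f increment ?s10 (10 * length (bin m) + 10)
    (?s10(0 := tp ((?i @ False # bits bs @ [False, True, p]) @ ?m) (False # []), 3 := tp [] [cy],
       4 := tp (?c @ bits (add_carry True (bin m))) []))"
    by (rule run_increment) auto
  then obtain cy where 11: "run f increment ?s10 (10 * length (bin m) + 10)
    (?s10(0 := tp ((?i @ False # bits bs @ [False, True, p]) @ ?m) (False # []), 3 := tp [] [cy],
       4 := tp (?c @ bits (add_carry True (bin m))) []))" (is "run _ _ _ _ ?s11")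
    by (elim exE) (rule that)
  let ?s12 = "?s11(4 := tp (?c @ enc_nat (Suc m)) [])"
  have 12: "run f (emit 4 False) ?s11 1 ?s12"
    by (rule run_eqI, rule run_emit) (auto simp: enc_nat_def enc_list_bool bin_Suc)
  have "run f write_suffix s (60 * L + 100) ?s12"
    unfolding write_suffix_def
    by (rule run_SeqI[OF 1 run_Seq[OF 2 run_Seq[OF 3 run_Seq[OF 4 run_Seq[OF 5 run_Seq[OF 6
       run_Seq[OF 7 run_Seq[OF 8 run_Seq[OF 9 run_Seq[OF 10 run_Seq[OF 11 12]]]]]]]]]]])
      (use L in simp)
  then show ?thesis by (intro exI[of _ ?s12] exI[of _ cy]) simp
qed

text \<open>The invariant of the main loops: \<open>u\<close> and \<open>v\<close> are the current row and column, marked on the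
  tapes 5 and 6; tape 4 contains the common part of all queries, tape 8 the parity of the diameter
  bound and tape 9 the minimum of the answers obtained so far.\<close>

definition ready :: "nat \<Rightarrow> bool list \<Rightarrow> bool \<Rightarrow> bool list \<Rightarrow> bool list \<Rightarrow> nat \<Rightarrow> nat \<Rightarrow> rat option \<Rightarrow>
    state \<Rightarrow> bool" where
  "ready n S p a b u v w s \<longleftrightarrow>
     s 0 = tp a b \<and> s 1 = tp [] [] \<and> s 2 = tp [] [] \<and> s 3 = tp [] [True] \<and> s 4 = tp [] S \<and>
     s 5 = tp [] (onehot u n) \<and> s 6 = tp [] (onehot v n) \<and> s 7 = tp [] [] \<and> s 8 = tp [] [p] \<and>
     s 9 = tp [] (entry w)"

definition prepare :: com where
  "prepare =
     write_suffix ;; Act 3 (\<lambda>_. Some True) Stay ;; discard 7 ;; rewind 0 ;; rewind 4 ;;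
     rewind 5 ;; mark 5 ;; rewind 6 ;; emit 9 False ;; rewind 9"

lemma initial_tp: "initial x i = tp [] (if i = 0 then x else [])"
  by (simp add: initial_def blank_tape_tp tape_of_tp)

text \<open>The running minimum starts as FAIL, the neutral element. The column counter starts at
  \<open>n\<close>, without a mark, which is also how each finished row leaves it.\<close>

lemma run_prepare:
  assumes diag: "\<And>i. i < n \<Longrightarrow> A i i = None"
    and x: "x = in_rows n A 0 @ False # bits bs @ False # True # odd D # bits (bin (D div 2)) @ [False]"
    and len: "length bs = n"
    and N: "length x \<le> N" "length (suffix n A bs D) \<le> N"
  shows "\<exists>s. run f prepare (initial x) (100 * N + 200) s \<and> ready n (suffix n A bs D) (odd D) [] x 0 n None s"
proof -
  let ?S = "suffix n A bs D" and ?F = "replicate n False" and ?O = "onehot 0 n"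
  let ?a = "in_rows n A 0 @ False # bits bs @ False # True # odd D # bits (bin (D div 2))"
  have "\<exists>s' cy. run f write_suffix (initial x) (60 * N + 100) s' \<and>
    s' 0 = tp ?a [False] \<and> s' 1 = initial x 1 \<and> s' 2 = initial x 2 \<and> s' 3 = tp [] [cy] \<and>
    s' 4 = tp (out_rows n A 0 @ [False, True, False] @ bits bs @ [False, False] @
      enc_nat (Suc (D div 2))) [] \<and>
    s' 5 = tp (replicate (length bs) False) [] \<and> s' 6 = tp (replicate (length bs) False) [] \<and>
    s' 7 = tp [] (replicate n True) \<and> s' 8 = tp [] [odd D] \<and> s' 9 = initial x 9"
    by (rule run_write_suffix) (use diag x N in \<open>auto simp: initial_tp length_bits\<close>)
  then obtain s1 cy where 1: "run f write_suffix (initial x) (60 * N + 100) s1"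
    and s1: "s1 0 = tp ?a [False]" "s1 1 = tp [] []" "s1 2 = tp [] []" "s1 3 = tp [] [cy]"
      "s1 4 = tp ?S []" "s1 5 = tp ?F []" "s1 6 = tp ?F []" "s1 7 = tp [] (replicate n True)"
      "s1 8 = tp [] [odd D]" "s1 9 = tp [] []"
    by (elim exE conjE) (rule that, assumption, simp_all add: initial_tp suffix_def len)
  let ?s2 = "s1(3 := tp [] [True])"
  let ?s3 = "?s2(7 := tp [] [])"
  let ?s4 = "?s3(0 := tp [] x)"
  let ?s5 = "?s4(4 := tp [] ?S)"
  let ?s6 = "?s5(5 := tp [] (onehot n n))"
  let ?s7 = "?s6(5 := tp [] ?O)"
  let ?s8 = "?s7(6 := tp [] (onehot n n))"
  let ?s9 = "?s8(9 := tp [False] [])"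
  let ?s10 = "?s9(9 := tp [] [False])"
  have 2: "run f (Act 3 (\<lambda>_. Some True) Stay) s1 1 ?s2"
    by (rule run_ActI) (auto simp: s1)
  have 3: "run f (discard 7) ?s2 (2 * length (replicate n True) + 1) ?s3"
    by (rule run_discard) (auto simp: s1)
  have 4: "run f (rewind 0) ?s3 (2 * length ?a + 6) ?s4"
    by (rule run_eqI, rule run_rewind_tp[where b = "[False]"]) (auto simp: x s1)
  have 5: "run f (rewind 4) ?s4 (2 * length ?S + 6) ?s5"
    by (rule run_eqI, rule run_rewind_tp[where b = "[]"]) (auto simp: s1)
  have 6: "run f (rewind 5) ?s5 (2 * length ?F + 6) ?s6"
    by (rule run_eqI, rule run_rewind_tp[where b = "[]"]) (auto simp: s1 onehot_none)
  have 7: "run f (mark 5) ?s6 2 ?s7"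
    by (rule run_eqI, rule run_mark_onehot) auto
  have 8: "run f (rewind 6) ?s7 (2 * length ?F + 6) ?s8"
    by (rule run_eqI, rule run_rewind_tp[where b = "[]"]) (auto simp: s1 onehot_none)
  have 9: "run f (emit 9 False) ?s8 1 ?s9"
    by (rule run_eqI, rule run_emit[where a = "[]"]) (auto simp: s1)
  have 10: "run f (rewind 9) ?s9 (2 * length [False] + 6) ?s10"
    by (rule run_eqI, rule run_rewind_tp[where b = "[]"]) auto
  have n: "length ?a \<le> N" "2 * n \<le> N"
    using N(1) len by (auto simp: x length_bits)
  have "run f prepare (initial x) (100 * N + 200) ?s10"
    unfolding prepare_def
    by (rule run_SeqI[OF 1 run_Seq[OF 2 run_Seq[OF 3 run_Seq[OF 4 run_Seq[OF 5 run_Seq[OF 6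
       run_Seq[OF 7 run_Seq[OF 8 run_Seq[OF 9 10]]]]]]]]])
      (use n N in \<open>simp del: length_append\<close>)
  moreover have "ready n ?S (odd D) [] x 0 n None ?s10"
    by (simp add: ready_def s1 del: One_nat_def)
  ultimately show ?thesis by (intro exI conjI)
qed

subsection \<open>Asking for the best tree with a given centre\<close>

text \<open>The case \<open>j = u\<close> takes precedence: for \<open>u = v\<close> the centre is a
  vertex and nothing is charged. The flag \<open>p\<close>, the parity of the bound, admits a second
  child only for odd \<open>D\<close>.\<close>

definition row0 :: "nat \<Rightarrow> nat \<Rightarrow> bool \<Rightarrow> rat option \<Rightarrow> nat \<Rightarrow> rat option" where
  "row0 u v p w j = (if j = u then Some 0 else if j = v \<and> p then w else None)"

definition write_row0 :: com where
  "write_row0 = Loop (nonblank 5)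
     (emit 1 True ;;
      Cond (sees 5 True) (emits 1 (entry (Some 0)))
       (Cond (\<lambda>sc. sc 6 = Some True \<and> sc 8 = Some True) (move_all 7 1) (emit 1 False)) ;;
      right 5 ;; right 6)"

lemma onehot_step:
  assumes "j < n"
  shows "drop j (onehot u n) = (j = u) # drop (Suc j) (onehot u n)"
    and "take (Suc j) (onehot u n) = take j (onehot u n) @ [j = u]"
  using assms Cons_nth_drop_Suc[of j "onehot u n"]
  by (simp_all add: onehot_def take_Suc_conv_app_nth)

text \<open>Tape 7 holds the weight of \<open>{u, v}\<close> until column \<open>v\<close> consumes
  it. This happens at most once, so the entry can be moved instead of copied; if
  \<open>u = v\<close> or the bound is even, it stays and is discarded later.\<close>

lemma run_write_row0:
  assumes "j \<le> n"
    and "s 1 = tp c []" "s 5 = tp (take j (onehot u n)) (drop j (onehot u n))"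
      "s 6 = tp (take j (onehot v n)) (drop j (onehot v n))"
      "s 7 = tp [] (if v < j \<and> v \<noteq> u \<and> p then [] else entry w)" "s 8 = tp [] [p]"
  shows "run f write_row0 s ((n - j) * (4 * length (entry w) + 30) + 1)
    (s(1 := tp (c @ items (map (row0 u v p w) [j..<n])) [], 5 := tp (onehot u n) [],
       6 := tp (onehot v n) [], 7 := tp [] (if v < n \<and> v \<noteq> u \<and> p then [] else entry w)))"
  using assms
proof (induction j arbitrary: s c rule: inc_induct)
  case base
  then show ?case
    unfolding write_row0_def by (intro run_Loop_exitI) (auto simp: fun_eq_iff)
next
  case (step j)
  let ?U = "onehot u n" and ?V = "onehot v n" and ?w = "row0 u v p w j"
  let ?r = "\<lambda>j. if v < j \<and> v \<noteq> u \<and> p then [] else entry w"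
  let ?C = "Cond (sees 5 True) (emits 1 (entry (Some 0)))
       (Cond (\<lambda>sc. sc 6 = Some True \<and> sc 8 = Some True) (move_all 7 1) (emit 1 False))"
  note prems = step.prems[unfolded onehot_step[OF \<open>j < n\<close>]]
  let ?s1 = "s(1 := tp (c @ [True]) [])"
  let ?s2 = "?s1(1 := tp (c @ True # entry ?w) [], 7 := tp [] (?r (Suc j)))"
  let ?s3 = "?s2(5 := tp (take (Suc j) ?U) (drop (Suc j) ?U))"
  let ?s4 = "?s3(6 := tp (take (Suc j) ?V) (drop (Suc j) ?V))"
  have 1: "run f (emit 1 True) s 1 ?s1"
    by (rule run_emit) (use prems in auto)
  have 2: "run f ?C ?s1 (4 * length (entry w) + 15) ?s2"
  proof (cases "j = u")
    case True
    have "run f (emits 1 (entry (Some 0))) ?s1 (2 * length (entry (Some 0)) + 1) ?s2"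
      by (rule run_eqI, rule run_emits[where a = "c @ [True]"])
        (use prems True in \<open>auto simp: fun_eq_iff row0_def\<close>)
    with True show ?thesis
      by (intro run_CondI) (use prems in \<open>auto simp: enc_rat_zero\<close>)
  next
    case ju: False
    have "run f (Cond (\<lambda>sc. sc 6 = Some True \<and> sc 8 = Some True) (move_all 7 1) (emit 1 False))
        ?s1 (4 * length (entry w) + 2) ?s2"
    proof (cases "j = v \<and> p")
      case True
      have "run f (move_all 7 1) ?s1 (4 * length (entry w) + 1) ?s2"
        by (rule run_eqI, rule run_move_all[where c = "c @ [True]" and b = "entry w"])
          (use prems True ju in \<open>auto simp: fun_eq_iff row0_def\<close>)
      with True show ?thesis
        by (intro run_CondI) (use prems in auto)
    next
      case False
      have "run f (emit 1 False) ?s1 1 ?s2"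
        by (rule run_eqI, rule run_emit[where a = "c @ [True]"])
          (use prems False ju in \<open>auto simp: fun_eq_iff row0_def less_Suc_eq\<close>)
      with False show ?thesis
        by (intro run_CondI) (use prems length_entry_pos[of w] in auto)
    qed
    with ju show ?thesis
      by (intro run_CondI) (use prems in auto)
  qed
  have 3: "run f (right 5) ?s2 1 ?s3"
    by (rule run_eqI, rule run_right) (use prems onehot_step[OF \<open>j < n\<close>, of u] in auto)
  have 4: "run f (right 6) ?s3 1 ?s4"
    by (rule run_eqI, rule run_right) (use prems onehot_step[OF \<open>j < n\<close>, of v] in auto)
  have 5: "run f write_row0 ?s4 ((n - Suc j) * (4 * length (entry w) + 30) + 1)
    (s(1 := tp (c @ items (map (row0 u v p w) [j..<n])) [], 5 := tp ?U [],
       6 := tp ?V [], 7 := tp [] (?r n)))"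
    by (rule run_eqI, rule step.IH[of _ "c @ True # entry ?w"])
      (use prems \<open>j < n\<close> in \<open>auto simp: fun_eq_iff upt_conv_Cons\<close>)
  have nj: "n - j = Suc (n - Suc j)"
    using \<open>j < n\<close> by simp
  show ?case
    unfolding write_row0_def
    by (rule run_LoopI[OF _ run_Seq[OF 1 run_Seq[OF 2 run_Seq[OF 3 4]]] 5[unfolded write_row0_def]])
      (use prems in \<open>auto simp: nj\<close>)
qed

definition graph_query :: "nat \<Rightarrow> bool list \<Rightarrow> bool \<Rightarrow> nat \<Rightarrow> nat \<Rightarrow> rat option \<Rightarrow> bool list" where
  "graph_query n S p u v w =
     [True, True] @ entry (Some 0) @ items (map (row0 u v p w) [0..<n]) @ False # S"

definition ask_graph :: com where
  "ask_graph =
     right 0 ;; copy_entry 0 7 ;; rewind 7 ;; emits 1 ([True, True] @ entry (Some 0)) ;;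
     write_row0 ;; emit 1 False ;; discard 7 ;; rewind 5 ;; rewind 6 ;; copy_all 4 1 ;; rewind 4 ;;
     rewind 1 ;; Query False"

lemma run_Query_tp:
  assumes "s 1 = tp [] x" "s 3 = tp [] [c]"
  shows "run f (Query l) s 1 (s(1 := tp [] [], 2 := tp [] (f x), 3 := tp [] [l]))"
  by (rule run_eqI, rule run_Query)
    (auto simp: assms(1)[unfolded One_nat_def] assms(2) blank_tape_tp tape_of_tp word_of_tq)

lemma length_items_row0:
  "length (items (map (row0 u v p w) js)) \<le> length js * (length (entry w) + 6)"
proof (induction js)
  case (Cons j js)
  have "length (entry (row0 u v p w j)) \<le> length (entry w) + 5"
    by (simp add: row0_def enc_rat_zero)
  with Cons show ?case by simp
qed simp

lemma run_ask_graph: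
  assumes s: "ready n S p a (True # entry w @ b) u v x s"
    and f: "f (graph_query n S p u v w) = y"
    and N: "n \<le> N" "length S \<le> N" "length (entry w) \<le> N"
  shows "\<exists>s'. run f ask_graph s (200 * (N + 1) ^ 2) s' \<and>
     s' 0 = tp (a @ True # entry w) b \<and> s' 1 = tp [] [] \<and> s' 2 = tp [] y \<and> s' 3 = tp [] [False] \<and>
     s' 4 = tp [] S \<and> s' 5 = tp [] (onehot u n) \<and> s' 6 = tp [] (onehot v n) \<and> s' 7 = tp [] [] \<and>
     s' 8 = tp [] [p] \<and> s' 9 = tp [] (entry x)"
proof -
  let ?U = "onehot u n" and ?V = "onehot v n" and ?e = "length (entry w)"
  let ?r = "if v < n \<and> v \<noteq> u \<and> p then [] else entry w"
  let ?c = "[True, True] @ entry (Some 0)" and ?i = "items (map (row0 u v p w) [0..<n])"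
  let ?q = "graph_query n S p u v w"
  note s = s[unfolded ready_def]
  let ?s1 = "s(0 := tp (a @ [True]) (entry w @ b))"
  let ?s2 = "?s1(0 := tp (a @ True # entry w) b, 7 := tp (entry w) [])"
  let ?s3 = "?s2(7 := tp [] (entry w))"
  let ?s4 = "?s3(1 := tp ?c [])"
  let ?s5 = "?s4(1 := tp (?c @ ?i) [], 5 := tp ?U [], 6 := tp ?V [], 7 := tp [] ?r)"
  let ?s6 = "?s5(1 := tp (?c @ ?i @ [False]) [])"
  let ?s7 = "?s6(7 := tp [] [])"
  let ?s8 = "?s7(5 := tp [] ?U)"
  let ?s9 = "?s8(6 := tp [] ?V)"
  let ?s10 = "?s9(4 := tp S [], 1 := tp ?q [])"
  let ?s11 = "?s10(4 := tp [] S)"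
  let ?s12 = "?s11(1 := tp [] ?q)"
  let ?s13 = "?s12(1 := tp [] [], 2 := tp [] (f ?q), 3 := tp [] [False])"
  have 1: "run f (right 0) s 1 ?s1"
    by (rule run_right) (use s in simp)
  have 2: "run f (copy_entry 0 7) ?s1 (6 * ?e) ?s2"
    by (rule run_eqI, rule run_copy_entry[where a = "a @ [True]" and c = "[]"]) (use s in auto)
  have 3: "run f (rewind 7) ?s2 (2 * ?e + 6) ?s3"
    by (rule run_eqI, rule run_rewind_tp[where b = "[]"]) auto
  have 4: "run f (emits 1 ?c) ?s3 (2 * length ?c + 1) ?s4"
    by (rule run_eqI, rule run_emits[where a = "[]"]) (use s in auto)
  have 5: "run f write_row0 ?s4 ((n - 0) * (4 * ?e + 30) + 1) ?s5"
    by (rule run_write_row0) (use s in auto)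
  have 6: "run f (emit 1 False) ?s5 1 ?s6"
    by (rule run_eqI, rule run_emit) auto
  have 7: "run f (discard 7) ?s6 (2 * length ?r + 1) ?s7"
    by (rule run_discard) auto
  have 8: "run f (rewind 5) ?s7 (2 * length ?U + 6) ?s8"
    by (rule run_eqI, rule run_rewind_tp[where b = "[]"]) auto
  have 9: "run f (rewind 6) ?s8 (2 * length ?V + 6) ?s9"
    by (rule run_eqI, rule run_rewind_tp[where b = "[]"]) auto
  have 10: "run f (copy_all 4 1) ?s9 (4 * length S + 1) ?s10"
    by (rule run_eqI, rule run_copy_all[where a = "[]" and c = "?c @ ?i @ [False]"])
      (use s in \<open>auto simp: graph_query_def\<close>)
  have 11: "run f (rewind 4) ?s10 (2 * length S + 6) ?s11"
    by (rule run_eqI, rule run_rewind_tp[where b = "[]"]) auto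
  have 12: "run f (rewind 1) ?s11 (2 * length ?q + 6) ?s12"
    by (rule run_eqI, rule run_rewind_tp[where b = "[]"]) auto
  have 13: "run f (Query False) ?s12 1 ?s13"
    by (rule run_eqI, rule run_Query_tp) (use s in auto)
  \<comment> \<open>Every entry of the row is counted as if it were about as long as
    \<open>w\<close>; this crude estimate makes the bound quadratic in \<open>N\<close>.\<close>
  have "length ?i \<le> n * (?e + 6)"
    using length_items_row0[of u v p w "[0..<n]"] by simp
  then have q: "length ?q \<le> n * ?e + 6 * n + length S + 8"
    by (simp add: graph_query_def enc_rat_zero algebra_simps)
  have r: "length ?r \<le> ?e" by simp
  have ne: "n * ?e \<le> N * N"
    using N by (simp add: mult_le_mono)
  have "run f ask_graph s (200 * (N + 1) ^ 2) ?s13"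
    unfolding ask_graph_def
    by (rule run_SeqI[OF 1 run_Seq[OF 2 run_Seq[OF 3 run_Seq[OF 4 run_Seq[OF 5 run_Seq[OF 6
       run_Seq[OF 7 run_Seq[OF 8 run_Seq[OF 9 run_Seq[OF 10 run_Seq[OF 11 run_Seq[OF 12 13]]]]]]]]]]]])
      (use N q r ne in \<open>simp add: enc_rat_zero power2_eq_square algebra_simps\<close>)
  then show ?thesis
    by (intro exI[of _ ?s13]) (use s f in auto)
qed

section \<open>Minimum of two answers by an oracle call\<close>

definition min_pre :: "bool list" where
  "min_pre = [True, True] @ entry (Some 0) @ [True]"

definition min_post :: "bool list" where
  "min_post =
     [False, True] @ enc_list entry [None, Some 0, None] @ [True] @ enc_list entry [None, Some 0, Some 0] @
     [False] @ enc_subset 3 {1} @ enc_nat 0 @ enc_nat 2"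

text \<open>\<open>min_pre\<close> ends with the tag of entry (0, 1), and the \<open>True\<close> in
  the middle is the tag of entry (0, 2). All that surrounds the two answers is constant, so they are
  pasted in without being decoded.\<close>

definition min_query :: "rat option \<Rightarrow> rat option \<Rightarrow> bool list" where
  "min_query x y = min_pre @ entry x @ True # entry y @ min_post"

lemma length_min_pre: "length min_pre = 8"
  by (simp add: min_pre_def enc_rat_zero)

lemma length_min_post: "length min_post = 43"
  by (simp add: min_post_def enc_rat_zero enc_list_concat enc_subset_def enc_bool_def
      enc_nat_def bin.simps[of 0] bin.simps[of 2] bin.simps[of "Suc 0"] numeral_3_eq_3)

definition ask_min :: com where
  "ask_min =
     emits 1 min_pre ;; move_all 9 1 ;; emit 1 True ;; move_all 2 1 ;; emits 1 min_post ;;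
     rewind 1 ;; Query True ;; move_all 2 9 ;; rewind 9"

lemma run_ask_min:
  assumes s: "s 0 = tp a b" "s 1 = tp [] []" "s 2 = tp [] (entry y)" "s 3 = tp [] [c]"
      "s 4 = tp [] S" "s 5 = tp [] (onehot u n)" "s 6 = tp [] (onehot v n)" "s 7 = tp [] []"
      "s 8 = tp [] [p]" "s 9 = tp [] (entry x)"
    and f: "f (min_query x y) = entry z"
    and N: "length (entry x) \<le> N" "length (entry y) \<le> N" "length (entry z) \<le> N"
  shows "\<exists>s'. run f ask_min s (20 * N + 300) s' \<and> ready n S p a b u v z s'"
proof -
  let ?x = "entry x" and ?y = "entry y" and ?z = "entry z" and ?q = "min_query x y"
  note s = s[unfolded One_nat_def]
  let ?s1 = "s(1 := tp min_pre [])"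
  let ?s2 = "?s1(9 := tp [] [], 1 := tp (min_pre @ ?x) [])"
  let ?s3 = "?s2(1 := tp (min_pre @ ?x @ [True]) [])"
  let ?s4 = "?s3(2 := tp [] [], 1 := tp (min_pre @ ?x @ True # ?y) [])"
  let ?s5 = "?s4(1 := tp ?q [])"
  let ?s6 = "?s5(1 := tp [] ?q)"
  let ?s7 = "?s6(1 := tp [] [], 2 := tp [] (f ?q), 3 := tp [] [True])"
  let ?s8 = "?s7(2 := tp [] [], 9 := tp ?z [])"
  let ?s9 = "?s8(9 := tp [] ?z)"
  have 1: "run f (emits 1 min_pre) s (2 * length min_pre + 1) ?s1"
    by (rule run_eqI, rule run_emits[where a = "[]"]) (auto simp: s)
  have 2: "run f (move_all 9 1) ?s1 (4 * length ?x + 1) ?s2"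
    by (rule run_move_all) (auto simp: s)
  have 3: "run f (emit 1 True) ?s2 1 ?s3"
    by (rule run_eqI, rule run_emit) auto
  have 4: "run f (move_all 2 1) ?s3 (4 * length ?y + 1) ?s4"
    by (rule run_eqI, rule run_move_all) (auto simp: s)
  have 5: "run f (emits 1 min_post) ?s4 (2 * length min_post + 1) ?s5"
    by (rule run_eqI, rule run_emits) (auto simp: min_query_def)
  have 6: "run f (rewind 1) ?s5 (2 * length ?q + 6) ?s6"
    by (rule run_eqI, rule run_rewind_tp[where b = "[]"]) auto
  have 7: "run f (Query True) ?s6 1 ?s7"
    by (rule run_eqI, rule run_Query_tp) (auto simp: s)
  have 8: "run f (move_all 2 9) ?s7 (4 * length ?z + 1) ?s8"
    by (rule run_eqI, rule run_move_all[where c = "[]"]) (auto simp: s f)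
  have 9: "run f (rewind 9) ?s8 (2 * length ?z + 6) ?s9"
    by (rule run_eqI, rule run_rewind_tp[where b = "[]"]) auto
  have "run f ask_min s (20 * N + 300) ?s9"
    unfolding ask_min_def
    by (rule run_SeqI[OF 1 run_Seq[OF 2 run_Seq[OF 3 run_Seq[OF 4 run_Seq[OF 5 run_Seq[OF 6
       run_Seq[OF 7 run_Seq[OF 8 9]]]]]]]])
      (use N in \<open>simp add: min_query_def length_min_pre length_min_post\<close>)
  then show ?thesis
    by (intro exI[of _ ?s9]) (use s in \<open>auto simp: ready_def\<close>)
qed

section \<open>The loops over all pairs of vertices\<close>

definition omin :: "rat option \<Rightarrow> rat option \<Rightarrow> rat option" where
  "omin x y = (case x of None \<Rightarrow> y | Some a \<Rightarrow> (case y of None \<Rightarrow> x | Some b \<Rightarrow> Some (min a b)))"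

text \<open>A minimum is one of its arguments, so iterating it produces no longer words than the
  answers themselves.\<close>

lemma omin_cases: "omin x y = x \<or> omin x y = y"
  by (auto simp: omin_def min_def split: option.split)

definition entry_step :: com where
  "entry_step = ask_graph ;; ask_min ;; advance 6"

text \<open>A row begins with an unmarked column tape, so marking its first cell resets the column
  to 0.\<close>

definition row_step :: com where
  "row_step = right 0 ;; mark 6 ;; Loop (sees 0 True) entry_step ;; right 0 ;; advance 5"

definition finish :: com where
  "finish = Loop (nonblank 0) (right 0) ;; right 0 ;; move_all 9 0 ;; rewind 0"

definition reduction :: com where
  "reduction = prepare ;; Loop (sees 0 True) row_step ;; finish"

text \<open>The input is not erased. The head goes past it, leaves one blank as a separator and
  writes the result behind; rewinding stops at the separator, so the word at the head is the result
  alone. For an empty input the separator would not survive on a canonical tape.\<close>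

lemma run_finish:
  assumes "s 0 = tp a b" "s 9 = tp [] (entry w)" "a @ b \<noteq> []" "length (a @ b) \<le> N" "length (entry w) \<le> N"
  shows "\<exists>s'. run f finish s (20 * N + 20) s' \<and> word_of (s' 0) = entry w"
proof -
  have loop: "run f (Loop (nonblank 0) (right 0)) s (2 * length b + 1) (s(0 := tp (a @ b) []))"
    if "s 0 = tp a b" for s a b
    using that
  proof (induction b arbitrary: s a)
    case Nil
    then show ?case by (intro run_Loop_exitI) (auto simp: fun_eq_iff)
  next
    case (Cons x b)
    let ?s1 = "s(0 := tp (a @ [x]) b)"
    have 1: "run f (right 0) s 1 ?s1"
      by (rule run_right) (use Cons.prems in auto)
    have 2: "run f (Loop (nonblank 0) (right 0)) ?s1 (2 * length b + 1) (s(0 := tp (a @ x # b) []))"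
      by (rule run_eqI, rule Cons.IH[of _ "a @ [x]"]) auto
    show ?case
      by (rule run_LoopI[OF _ 1 2]) (use Cons.prems in auto)
  qed
  let ?l = "None # map Some (rev (a @ b))"
  let ?s1 = "s(0 := tp (a @ b) [])"
  let ?s2 = "?s1(0 := tq ?l [] [])"
  let ?s3 = "?s2(9 := tp [] [], 0 := tq ?l (entry w) [])"
  let ?s4 = "?s3(0 := tq ?l [] (entry w))"
  have 1: "run f (Loop (nonblank 0) (right 0)) s (2 * length b + 1) ?s1"
    using assms(1) by (rule loop)
  have 2: "run f (right 0) ?s1 1 ?s2"
    by (rule run_ActI) (use assms(3) in \<open>auto simp: tq_def scons_def\<close>)
  have 3: "run f (move_all 9 0) ?s2 (4 * length (entry w) + 1) ?s3"
    by (rule run_eqI, rule run_move_all[where c = "[]"]) (auto simp: assms)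
  have 4: "run f (rewind 0) ?s3 (2 * length (entry w) + 6) ?s4"
    by (rule run_eqI, rule run_rewind[where b = "[]"]) (use assms(3) in \<open>auto simp: scons_def\<close>)
  have "run f finish s (20 * N + 20) ?s4"
    unfolding finish_def
    by (rule run_SeqI[OF 1 run_Seq[OF 2 run_Seq[OF 3 4]]])
      (use assms in simp)
  then show ?thesis
    by (intro exI[of _ ?s4]) (simp add: word_of_tq)
qed

text \<open>The loops are verified for any oracle that answers just these queries. \<open>R\<close>
  contains the possible answers, bounded in length and such that minima on \<open>R\<close> are
  computed correctly; it is closed under \<open>omin\<close>, so the running minimum never leaves
  it.\<close>

context
  fixes f :: "bool list \<Rightarrow> bool list" and n N D :: nat and A ans :: "nat \<Rightarrow> nat \<Rightarrow> rat option"
    and S :: "bool list" and p :: bool and R :: "rat option set"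
  assumes graph: "\<And>u v. u < n \<Longrightarrow> v < n \<Longrightarrow> f (graph_query n S p u v (A u v)) = entry (ans u v)"
    and ans: "\<And>u v. u < n \<Longrightarrow> v < n \<Longrightarrow> ans u v \<in> R"
    and minq: "\<And>x y. x \<in> R \<Longrightarrow> y \<in> R \<Longrightarrow> f (min_query x y) = entry (omin x y)"
    and R: "\<And>x. x \<in> R \<Longrightarrow> length (entry x) \<le> N"
    and N: "n \<le> N" "length S \<le> N" "\<And>u v. u < n \<Longrightarrow> v < n \<Longrightarrow> length (entry (A u v)) \<le> N"
begin

lemma omin_in: "x \<in> R \<Longrightarrow> y \<in> R \<Longrightarrow> omin x y \<in> R"
  using omin_cases[of x y] by auto

lemma run_entry_step:
  assumes s: "ready n S p a (True # entry (A u v) @ b) u v x s" and uv: "u < n" "v < n" and x: "x \<in> R"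
  shows "\<exists>s'. run f entry_step s (600 * (N + 1) ^ 2) s' \<and>
    ready n S p (a @ True # entry (A u v)) b u (Suc v) (omin x (ans u v)) s'"
proof -
  obtain s1 where s1: "run f ask_graph s (200 * (N + 1) ^ 2) s1"
    "s1 0 = tp (a @ True # entry (A u v)) b" "s1 1 = tp [] []" "s1 2 = tp [] (entry (ans u v))"
    "s1 3 = tp [] [False]" "s1 4 = tp [] S" "s1 5 = tp [] (onehot u n)" "s1 6 = tp [] (onehot v n)"
    "s1 7 = tp [] []" "s1 8 = tp [] [p]" "s1 9 = tp [] (entry x)"
    using run_ask_graph[where f = f, OF s graph[OF uv] N(1,2) N(3)[OF uv]] by (elim exE conjE) (rule that)
  obtain s2 where s2: "run f ask_min s1 (20 * N + 300) s2"
    "ready n S p (a @ True # entry (A u v)) b u v (omin x (ans u v)) s2"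
    using run_ask_min[where f = f, OF s1(2-) minq[OF x ans[OF uv]] R[OF x] R[OF ans[OF uv]] R[OF omin_in[OF x ans[OF uv]]]]
    by (elim exE conjE) (rule that)
  let ?s3 = "s2(6 := tp [] (onehot (Suc v) n))"
  have 3: "run f (advance 6) s2 (5 * n + 20) ?s3"
    by (rule run_advance) (use s2(2) uv in \<open>auto simp: ready_def\<close>)
  have "run f entry_step s (600 * (N + 1) ^ 2) ?s3"
    unfolding entry_step_def
    by (rule run_SeqI[OF s1(1) run_Seq[OF s2(1) 3]])
      (use N(1) in \<open>simp add: power2_eq_square algebra_simps\<close>)
  moreover have "ready n S p (a @ True # entry (A u v)) b u (Suc v) (omin x (ans u v)) ?s3"
    using s2(2) by (auto simp: ready_def)
  ultimately show ?thesis by (intro exI conjI)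
qed

text \<open>601 is the 600 of one entry plus room for the loop test, since
  \<open>1 \<le> (N + 1) ^ 2\<close>.\<close>

lemma run_entries:
  assumes "v \<le> n" "u < n" "x \<in> R" "ready n S p a (items (map (A u) [v..<n]) @ False # b) u v x s"
  shows "\<exists>s'. run f (Loop (sees 0 True) entry_step) s ((n - v) * (601 * (N + 1) ^ 2) + 1) s' \<and>
    ready n S p (a @ items (map (A u) [v..<n])) (False # b) u n
      (foldl (\<lambda>x v. omin x (ans u v)) x [v..<n]) s' \<and>
    foldl (\<lambda>x v. omin x (ans u v)) x [v..<n] \<in> R"
  using assms(1,3,4)
proof (induction v arbitrary: s a x rule: inc_induct)
  case base
  have "run f (Loop (sees 0 True) entry_step) s 1 s"
    by (rule run_Loop_exitI) (use base in \<open>auto simp: ready_def\<close>)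
  then show ?case
    using base by (intro exI[of _ s]) auto
next
  case (step v)
  let ?x = "omin x (ans u v)" and ?a = "a @ True # entry (A u v)"
  have "ready n S p a (True # entry (A u v) @ items (map (A u) [Suc v..<n]) @ False # b) u v x s"
    using step.prems(2) \<open>v < n\<close> by (simp add: upt_conv_Cons)
  from run_entry_step[OF this \<open>u < n\<close> \<open>v < n\<close> step.prems(1)]
  obtain s1 where 1: "run f entry_step s (600 * (N + 1) ^ 2) s1"
    and r1: "ready n S p ?a (items (map (A u) [Suc v..<n]) @ False # b) u (Suc v) ?x s1"
    by (elim exE conjE) (rule that)
  have "?x \<in> R"
    using omin_in[OF step.prems(1) ans[OF \<open>u < n\<close> \<open>v < n\<close>]] .
  from step.IH[OF this r1] obtain s2 where
    2: "run f (Loop (sees 0 True) entry_step) s1 ((n - Suc v) * (601 * (N + 1) ^ 2) + 1) s2"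
    and r2: "ready n S p (?a @ items (map (A u) [Suc v..<n])) (False # b) u n
      (foldl (\<lambda>x v. omin x (ans u v)) ?x [Suc v..<n]) s2"
      "foldl (\<lambda>x v. omin x (ans u v)) ?x [Suc v..<n] \<in> R"
    by (elim exE conjE) (rule that)
  have nv: "n - v = Suc (n - Suc v)"
    using \<open>v < n\<close> by simp
  have "run f (Loop (sees 0 True) entry_step) s ((n - v) * (601 * (N + 1) ^ 2) + 1) s2"
    by (rule run_LoopI[OF _ 1 2])
      (use step.prems(2) \<open>v < n\<close> in \<open>auto simp: ready_def nv upt_conv_Cons\<close>)
  then show ?case
    using r2 \<open>v < n\<close> by (intro exI[of _ s2]) (auto simp: upt_conv_Cons)
qed

definition best_from :: "nat \<Rightarrow> rat option \<Rightarrow> rat option" where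
  "best_from u x = foldl (\<lambda>x u. foldl (\<lambda>x v. omin x (ans u v)) x [0..<n]) x [u..<n]"

lemma run_rows:
  assumes "u \<le> n" "x \<in> R" "ready n S p a (in_rows n A u @ False # b) u n x s"
  shows "\<exists>s'. run f (Loop (sees 0 True) row_step) s ((n - u) * (n * (601 * (N + 1) ^ 2) + 5 * n + 40) + 1) s' \<and>
    ready n S p (a @ in_rows n A u) (False # b) n n (best_from u x) s' \<and> best_from u x \<in> R"
  using assms
proof (induction u arbitrary: s a x rule: inc_induct)
  case base
  have "run f (Loop (sees 0 True) row_step) s 1 s"
    by (rule run_Loop_exitI) (use base in \<open>auto simp: ready_def\<close>)
  then show ?case
    using base by (intro exI[of _ s]) (auto simp: best_from_def)
next
  case (step u)
  let ?r = "items (map (A u) [0..<n])" and ?R = "in_rows n A (Suc u)"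
  let ?x = "foldl (\<lambda>x v. omin x (ans u v)) x [0..<n]"
  note r = rows_step(1)[OF \<open>u < n\<close>, unfolded enc_list_entry]
  have r0: "ready n S p a (True # ?r @ False # ?R @ False # b) u n x s"
    using step.prems(2) unfolding r by simp
  let ?s1 = "s(0 := tp (a @ [True]) (?r @ False # ?R @ False # b))"
  let ?s2 = "?s1(6 := tp [] (onehot 0 n))"
  have 1: "run f (right 0) s 1 ?s1"
    by (rule run_right) (use r0 in \<open>auto simp: ready_def\<close>)
  have 2: "run f (mark 6) ?s1 2 ?s2"
    by (rule run_mark_onehot) (use r0 in \<open>auto simp: ready_def\<close>)
  have "ready n S p (a @ [True]) (?r @ False # ?R @ False # b) u 0 x ?s2"
    using r0 by (auto simp: ready_def)
  from run_entries[OF le0 \<open>u < n\<close> step.prems(1) this] obtain s3 where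
    3: "run f (Loop (sees 0 True) entry_step) ?s2 ((n - 0) * (601 * (N + 1) ^ 2) + 1) s3"
    and r3: "ready n S p ((a @ [True]) @ ?r) (False # ?R @ False # b) u n ?x s3" and xR: "?x \<in> R"
    by (elim exE conjE) (rule that)
  let ?s4 = "s3(0 := tp (a @ True # ?r @ [False]) (?R @ False # b))"
  let ?s5 = "?s4(5 := tp [] (onehot (Suc u) n))"
  have 4: "run f (right 0) s3 1 ?s4"
    by (rule run_eqI, rule run_right) (use r3 in \<open>auto simp: ready_def\<close>)
  have 5: "run f (advance 5) ?s4 (5 * n + 20) ?s5"
    by (rule run_advance) (use r3 \<open>u < n\<close> in \<open>auto simp: ready_def\<close>)
  have "ready n S p (a @ True # ?r @ [False]) (?R @ False # b) (Suc u) n ?x ?s5"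
    using r3 by (auto simp: ready_def)
  from step.IH[OF xR this] obtain s6 where
    6: "run f (Loop (sees 0 True) row_step) ?s5
      ((n - Suc u) * (n * (601 * (N + 1) ^ 2) + 5 * n + 40) + 1) s6"
    and r6: "ready n S p ((a @ True # ?r @ [False]) @ ?R) (False # b) n n (best_from (Suc u) ?x) s6"
      "best_from (Suc u) ?x \<in> R"
    by (elim exE conjE) (rule that)
  have nu: "n - u = Suc (n - Suc u)"
    using \<open>u < n\<close> by simp
  have step_time: "run f row_step s (n * (601 * (N + 1) ^ 2) + 5 * n + 30) ?s5"
    unfolding row_step_def
    by (rule run_SeqI[OF 1 run_Seq[OF 2 run_Seq[OF 3 run_Seq[OF 4 5]]]]) simp
  have "run f (Loop (sees 0 True) row_step) s ((n - u) * (n * (601 * (N + 1) ^ 2) + 5 * n + 40) + 1) s6"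
    by (rule run_LoopI[OF _ step_time 6]) (use r0 in \<open>auto simp: ready_def nu\<close>)
  moreover have "best_from u x = best_from (Suc u) ?x"
    using \<open>u < n\<close> by (simp add: best_from_def upt_conv_Cons)
  ultimately show ?case
    using r6 by (intro exI[of _ s6]) (simp add: r)
qed

lemma run_reduction:
  assumes None: "None \<in> R" and diag: "\<And>i. i < n \<Longrightarrow> A i i = None"
    and x: "x = in_rows n A 0 @ False # bits bs @ False # True # odd D # bits (bin (D div 2)) @ [False]"
    and len: "length bs = n" and S: "S = suffix n A bs D" and p: "p = odd D" and NX: "length x \<le> N"
  shows "\<exists>s. run f reduction (initial x) (2000 * (N + 1) ^ 4) s \<and>
    word_of (s 0) = entry (foldl (\<lambda>x u. foldl (\<lambda>x v. omin x (ans u v)) x [0..<n]) None [0..<n])"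
proof -
  let ?b = "bits bs @ False # True # odd D # bits (bin (D div 2)) @ [False]"
  have "\<exists>s. run f prepare (initial x) (100 * N + 200) s \<and> ready n S p [] x 0 n None s"
    unfolding S p
    by (rule run_prepare) (use diag x len NX N(2) S in auto)
  then obtain s1 where 1: "run f prepare (initial x) (100 * N + 200) s1"
    and r: "ready n S p [] x 0 n None s1"
    by (elim exE conjE) (rule that)
  have r1: "ready n S p [] (in_rows n A 0 @ False # ?b) 0 n None s1"
    using r unfolding x .
  obtain s2 where 2: "run f (Loop (sees 0 True) row_step) s1
      ((n - 0) * (n * (601 * (N + 1) ^ 2) + 5 * n + 40) + 1) s2"
    and r2: "ready n S p ([] @ in_rows n A 0) (False # ?b) n n (best_from 0 None) s2"
      "best_from 0 None \<in> R"
    using run_rows[OF le0 None r1] by (elim exE conjE) (rule that)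
  have "\<exists>s'. run f finish s2 (20 * N + 20) s' \<and> word_of (s' 0) = entry (best_from 0 None)"
    by (rule run_finish[where a = "in_rows n A 0" and b = "False # ?b"])
      (use r2 R NX x in \<open>auto simp: ready_def\<close>)
  then obtain s3 where 3: "run f finish s2 (20 * N + 20) s3" "word_of (s3 0) = entry (best_from 0 None)"
    by (elim exE conjE) (rule that)
  have "(n - 0) * (n * (601 * (N + 1) ^ 2) + 5 * n + 40) \<le>
      (N + 1) * ((N + 1) * (601 * (N + 1) ^ 2) + 5 * (N + 1) + 40)"
    using N(1) by (intro mult_le_mono add_le_mono) auto
  also have "\<dots> = 601 * (N + 1) ^ 4 + 5 * (N + 1) ^ 2 + 40 * (N + 1)"
    by (simp add: algebra_simps power2_eq_square power4_eq_xxxx)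
  finally have t: "(n - 0) * (n * (601 * (N + 1) ^ 2) + 5 * n + 40) \<le>
    601 * (N + 1) ^ 4 + 5 * (N + 1) ^ 2 + 40 * (N + 1)" .
  have "(N + 1) ^ 1 \<le> (N + 1) ^ 4" "(N + 1) ^ 2 \<le> (N + 1) ^ 4"
    by (intro power_increasing; simp)+
  then have P: "N + 1 \<le> (N + 1) ^ 4" "(N + 1) ^ 2 \<le> (N + 1) ^ 4"
    by (simp_all only: power_one_right)
  \<comment> \<open>The powers become variables, so that the rest is linear: apart from the loop
    bound \<open>X\<close>, the time is \<open>120 * N + 223\<close>, which is at most
    \<open>223 * (N + 1)\<close>.\<close>
  have "100 * N + 200 + (X + 1 + (20 * N + 20) + 1) + 1 \<le> 2000 * q"
    if "X \<le> 601 * q + 5 * r + 40 * (N + 1)" "N + 1 \<le> q" "r \<le> q" for X q r :: nat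
  proof -
    have "X \<le> 601 * q + 5 * q + 40 * q"
      using that(1) mult_le_mono2[OF that(2), of 40] mult_le_mono2[OF that(3), of 5] by linarith
    moreover have "223 * (N + 1) \<le> 223 * q"
      using that(2) by (intro mult_le_mono2)
    ultimately show ?thesis by simp
  qed
  note bound = this[OF t P]
  have "run f reduction (initial x) (2000 * (N + 1) ^ 4) s3"
    unfolding reduction_def
    by (rule run_SeqI[OF 1 run_Seq[OF 2 3(1)] bound])
  then show ?thesis
    using 3(2) by (intro exI[of _ s3]) (simp add: best_from_def)
qed

end

section \<open>Directed trees as parent functions\<close>

lemma diwalk_Nil [simp]: "\<not> diwalk F u [] v"
  by (simp add: diwalk_def)

lemma diwalk_single [simp]: "diwalk F u [x] v \<longleftrightarrow> x = u \<and> x = v"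
  by (auto simp: diwalk_def)

lemma diwalk_snoc:
  "diwalk F u (xs @ [x]) v \<longleftrightarrow>
     v = x \<and> (if xs = [] then u = x else diwalk F u xs (last xs) \<and> (last xs, x) \<in> F)"
  by (auto simp: diwalk_def successively_append_iff)

text \<open>A rooted tree as a parent function \<open>p\<close> with depth \<open>h\<close>. The
  equation for the depth replaces both reachability and acyclicity, and edges correspond to vertices
  other than the root, which turns weights into sums over vertices.\<close>

definition arbo :: "'a set \<Rightarrow> ('a \<times> 'a) set \<Rightarrow> 'a \<Rightarrow> ('a \<Rightarrow> 'a) \<Rightarrow> ('a \<Rightarrow> nat) \<Rightarrow> bool" where
  "arbo U F r p h \<longleftrightarrow>
     finite U \<and> r \<in> U \<and> h r = 0 \<and> (\<forall>x \<in> U - {r}. p x \<in> U \<and> h x = Suc (h (p x))) \<and>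
     F = (\<lambda>x. (p x, x)) ` (U - {r})"

lemma arbo_parent:
  assumes "arbo U F r p h" "x \<in> U" "x \<noteq> r"
  shows "p x \<in> U" "h x = Suc (h (p x))" "(p x, x) \<in> F"
  using assms unfolding arbo_def by blast+

lemma arbo_walk_length:
  assumes "arbo U F r p h" "diwalk F r xs v"
  shows "length xs = Suc (h v)"
  using assms(2)
proof (induction xs arbitrary: v rule: rev_induct)
  case (snoc x xs)
  show ?case
  proof (cases "xs = []")
    case True
    then show ?thesis using snoc.prems assms(1) by (auto simp: diwalk_snoc arbo_def)
  next
    case False
    then have "diwalk F r xs (last xs)" "(last xs, x) \<in> F" "v = x"
      using snoc.prems by (auto simp: diwalk_snoc)
    then show ?thesis using snoc.IH[of "last xs"] assms(1) by (auto simp: arbo_def)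
  qed
qed simp

text \<open>The depth of the end fixes the length of a walk, and its last edge can only come from
  the parent; so two walks are compared from the back.\<close>

lemma arbo_walk_unique:
  assumes "arbo U F r p h" "diwalk F r xs v" "diwalk F r ys v"
  shows "xs = ys"
  using assms(2,3)
proof (induction xs arbitrary: ys v rule: rev_induct)
  case (snoc x xs)
  have len: "length ys = length (xs @ [x])"
    using arbo_walk_length[OF assms(1) snoc.prems(1)] arbo_walk_length[OF assms(1) snoc.prems(2)] by simp
  then obtain zs z where ys: "ys = zs @ [z]"
    by (cases ys rule: rev_cases) auto
  show ?case
  proof (cases "xs = []")
    case True
    then show ?thesis using snoc.prems len by (auto simp: ys diwalk_snoc)
  next
    case False
    then have ne: "zs \<noteq> []" using len ys by auto
    have "z = x" "last zs = p x" "last xs = p x"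
      using snoc.prems False ne assms(1) by (auto simp: ys diwalk_snoc arbo_def)
    moreover from this have "xs = zs"
      using snoc.prems False ne by (intro snoc.IH[of "p x"]) (auto simp: ys diwalk_snoc)
    ultimately show ?thesis by (simp add: ys)
  qed
qed simp

lemma arbo_walk_exists:
  assumes "arbo U F r p h" "v \<in> U"
  shows "\<exists>xs. diwalk F r xs v"
  using assms(2)
proof (induction "h v" arbitrary: v)
  case 0
  then have "v = r" using assms(1) by (auto simp: arbo_def)
  then show ?case by (intro exI[of _ "[r]"]) (simp add: diwalk_def)
next
  case (Suc n)
  have "v \<noteq> r" using Suc.hyps(2) assms(1) unfolding arbo_def by force
  then have v: "p v \<in> U" "h (p v) = n" "(p v, v) \<in> F"
    using arbo_parent[OF assms(1) Suc.prems] Suc.hyps(2) by simp_all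
  then obtain xs where "diwalk F r xs (p v)"
    using Suc.hyps(1)[of "p v"] by auto
  moreover from this have "xs \<noteq> []" "last xs = p v" by (auto simp: diwalk_def)
  ultimately show ?case
    using v by (intro exI[of _ "xs @ [v]"]) (simp add: diwalk_snoc)
qed

lemma arbo_ditree:
  assumes "arbo U F r p h"
  shows "ditree U F r"
proof -
  have "\<exists>!xs. diwalk F r xs v" if "v \<in> U" for v
    using arbo_walk_exists[OF assms that] arbo_walk_unique[OF assms] by blast
  then show ?thesis
    using assms by (auto simp: ditree_def arbo_def)
qed

lemma arbo_edge_height:
  assumes "arbo U F r p h" "(x, y) \<in> F"
  shows "x \<in> U" "y \<in> U" "h y = Suc (h x)"
  using assms by (auto simp: arbo_def)

text \<open>A vertex of maximal depth has no child, hence is a leaf; so restricting the maximum to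
  leaves changes nothing.\<close>

lemma arbo_didiameter:
  assumes a: "arbo U F r p h"
  shows "didiameter U F r = Max (h ` U)"
proof -
  have fin: "finite U" and "r \<in> U" using a by (auto simp: arbo_def)
  let ?L = "{length xs - 1 | xs v. dileaf U F v \<and> diwalk F r xs v}"
  have "Max (h ` U) \<in> h ` U"
    using fin \<open>r \<in> U\<close> by (intro Max_in) auto
  then obtain v where v: "v \<in> U" "h v = Max (h ` U)" by auto
  have "dileaf U F v"
  proof -
    have False if "(v, w) \<in> F" for w
    proof -
      have "h w \<le> Max (h ` U)"
        using arbo_edge_height(2)[OF a that] fin Max_ge[of "h ` U" "h w"] by blast
      moreover have "h w = Suc (h v)"
        using arbo_edge_height[OF a that] by simp
      ultimately show False using v(2) by simp
    qed
    then show ?thesis using v(1) by (auto simp: dileaf_def)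
  qed
  moreover obtain xs where "diwalk F r xs v"
    using arbo_walk_exists[OF a v(1)] by blast
  ultimately have mem: "Max (h ` U) \<in> ?L"
    using arbo_walk_length[OF a, of xs v] v(2)
    by (intro CollectI exI[of _ xs] exI[of _ v]) simp
  have sub: "?L \<subseteq> h ` U"
    using arbo_walk_length[OF a] by (auto simp: dileaf_def)
  show ?thesis
    unfolding didiameter_def
  proof (rule Max_eqI)
    show "finite ?L" using sub fin by (meson finite_imageI finite_subset)
    show "y \<le> Max (h ` U)" if "y \<in> ?L" for y
      using that sub fin by (meson Max_ge finite_imageI subsetD)
  qed (rule mem)
qed

text \<open>The parent is the last but one vertex on the unique walk from the root and the depth is
  the length of that walk. An edge \<open>(x, y)\<close> extends the walk to \<open>x\<close> to a
  walk to \<open>y\<close>, which by uniqueness is the walk to \<open>y\<close>; so every edge comes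
  from the parent.\<close>

lemma ditree_arbo:
  assumes "ditree U F r"
  shows "\<exists>p h. arbo U F r p h"
proof -
  have U: "finite U" "r \<in> U" "F \<subseteq> U \<times> U" and ex1: "\<And>v. v \<in> U \<Longrightarrow> \<exists>!xs. diwalk F r xs v"
    using assms by (auto simp: ditree_def)
  define w where "w v = (THE xs. diwalk F r xs v)" for v
  have w: "diwalk F r (w v) v" if "v \<in> U" for v
    unfolding w_def using ex1[OF that] by (rule theI')
  have weq: "w v = xs" if "diwalk F r xs v" "v \<in> U" for v xs
    using ex1[OF that(2)] w[OF that(2)] that(1) by blast
  have wr: "w r = [r]"
    using U(2) by (intro weq) (auto simp: diwalk_def)
  have we: "w y = w x @ [y]" if "(x, y) \<in> F" for x y
  proof (rule weq)
    show "y \<in> U" using that U(3) by auto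
    have "x \<in> U" using that U(3) by auto
    then have "diwalk F r (w x) x" by (rule w)
    moreover from this have "w x \<noteq> []" "last (w x) = x" by (auto simp: diwalk_def)
    ultimately show "diwalk F r (w x @ [y]) y" using that by (simp add: diwalk_snoc)
  qed
  define p where "p v = last (butlast (w v))" for v
  define h where "h v = length (w v) - 1" for v
  have parent: "(p v, v) \<in> F" if v: "v \<in> U" "v \<noteq> r" for v
  proof -
    have d: "diwalk F r (w v) v" by (rule w[OF v(1)])
    then obtain xs x where xs: "w v = xs @ [x]"
      by (cases "w v" rule: rev_cases) auto
    with d v(2) have "xs \<noteq> []" "x = v" "(last xs, v) \<in> F"
      by (auto simp: diwalk_snoc split: if_splits)
    then show ?thesis by (simp add: p_def xs)
  qed
  have peq: "p y = x" "y \<noteq> r" "h y = Suc (h x)" if "(x, y) \<in> F" for x y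
  proof -
    have "x \<in> U" using that U(3) by auto
    from w[OF this] have "w x \<noteq> []" "last (w x) = x" by (auto simp: diwalk_def)
    then show "p y = x" "h y = Suc (h x)"
      using we[OF that] by (auto simp: p_def h_def neq_Nil_conv)
    show "y \<noteq> r" using we[OF that] wr \<open>w x \<noteq> []\<close> by auto
  qed
  have "F = (\<lambda>x. (p x, x)) ` (U - {r})"
    using parent peq U(3) by (auto simp: image_iff)
  moreover have "h r = 0" by (simp add: h_def wr)
  moreover have "p x \<in> U \<and> h x = Suc (h (p x))" if "x \<in> U - {r}" for x
    using parent[of x] peq(3)[of "p x" x] that U(3) by auto
  ultimately show ?thesis
    using U unfolding arbo_def by blast
qed

lemma arbo_sum:
  assumes "arbo U F r p h"
  shows "(\<Sum>e\<in>F. g e) = (\<Sum>x\<in>U - {r}. g (p x, x))"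
proof -
  have "F = (\<lambda>x. (p x, x)) ` (U - {r})" "inj_on (\<lambda>x. (p x, x)) (U - {r})"
    using assms by (auto simp: arbo_def inj_on_def)
  then show ?thesis by (simp add: sum.reindex)
qed

section \<open>Undirected trees\<close>

lemma path_Nil [simp]: "\<not> path F a [] b"
  by (simp add: path_def)

lemma path_Cons:
  "path F a (x # xs) b \<longleftrightarrow>
     x = a \<and> (if xs = [] then b = a else a \<notin> set xs \<and> {a, hd xs} \<in> F \<and> path F (hd xs) xs b)"
  by (cases xs) (auto simp: path_def)

lemma path_rev: "path F a xs b \<Longrightarrow> path F b (rev xs) a"
  by (auto simp: path_def successively_rev hd_rev last_rev insert_commute)

lemma path_prefix:
  assumes "path F a (ys @ c # zs) b"
  shows "path F a (ys @ [c]) c"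
  using assms successively_append_iff[of "\<lambda>x y. {x, y} \<in> F" "ys @ [c]" zs]
  by (cases ys) (simp_all add: path_def)

text \<open>If the next vertex already lies on the path, the path is cut there; so vertices stay
  distinct.\<close>

lemma rtrancl_path:
  assumes "(a, b) \<in> {(x, y). {x, y} \<in> F}\<^sup>*"
  shows "\<exists>xs. path F a xs b"
  using assms
proof (induction rule: rtrancl_induct)
  case base
  show ?case by (intro exI[of _ "[a]"]) (simp add: path_def)
next
  case (step b c)
  then obtain xs where xs: "path F a xs b" by blast
  show ?case
  proof (cases "c \<in> set xs")
    case True
    then obtain ys zs where "xs = ys @ c # zs" by (auto dest: split_list)
    with xs show ?thesis by (blast dest: path_prefix)
  next
    case False
    then have "path F a (xs @ [c]) c"
      using xs step.hyps(2) by (auto simp: path_def successively_append_iff)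
    then show ?thesis by blast
  qed
qed

lemma path_subset:
  assumes "path F a xs b" "a \<in> U" "\<forall>e\<in>F. e \<subseteq> U"
  shows "set xs \<subseteq> U"
  using assms(1,2)
proof (induction xs arbitrary: a)
  case (Cons x xs)
  show ?case
  proof (cases "xs = []")
    case False
    then have "{a, hd xs} \<in> F" "path F (hd xs) xs b" "x = a"
      using Cons.prems by (auto simp: path_Cons)
    moreover from this have "set xs \<subseteq> U"
      using assms(3) by (intro Cons.IH[of "hd xs"]) auto
    ultimately show ?thesis using Cons.prems(2) by simp
  qed (use Cons.prems in \<open>auto simp: path_Cons\<close>)
qed simp

lemma cycle_rotate:
  assumes "cycle F (ys @ zs)"
  shows "cycle F (zs @ ys)"
proof (cases "ys = [] \<or> zs = []")
  case True
  then show ?thesis using assms by auto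
next
  case False
  then show ?thesis
    using assms by (auto simp: cycle_def successively_append_iff)
qed

lemma successively_edge_mono:
  assumes "successively (\<lambda>x y. {x, y} \<in> F) xs" "\<And>e. e \<in> F \<Longrightarrow> e \<subseteq> set xs \<Longrightarrow> e \<in> G"
  shows "successively (\<lambda>x y. {x, y} \<in> G) xs"
  using assms
proof (induction xs rule: induct_list012)
  case (3 x y zs)
  then show ?case by (auto simp: subset_insertI2)
qed auto

lemma tree_edgeE:
  assumes "tree U F" "e \<in> F" "x \<in> e"
  obtains y where "e = {x, y}" "y \<noteq> x" "y \<in> U" "x \<in> U"
proof -
  have "card e = 2" "e \<subseteq> U" using assms by (auto simp: tree_def)
  then obtain a b where "e = {a, b}" "a \<noteq> b" by (auto simp: card_2_iff)
  with assms(3) \<open>e \<subseteq> U\<close> that show thesis by (cases "x = a") (auto simp: insert_commute)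
qed

lemma tree_finite_edges: "tree U F \<Longrightarrow> finite F"
  by (rule finite_subset[of _ "Pow U"]) (auto simp: tree_def)

lemma not_leafD:
  assumes "tree U F" "x \<in> U" "\<not> leaf U F x"
  obtains e e' where "e \<in> F" "e' \<in> F" "e \<noteq> e'" "x \<in> e" "x \<in> e'"
proof -
  have "finite {e \<in> F. x \<in> e}" using tree_finite_edges[OF assms(1)] by simp
  with assms(2,3) have "\<not> (\<forall>e\<in>{e \<in> F. x \<in> e}. \<forall>e'\<in>{e \<in> F. x \<in> e}. e = e')"
    by (simp add: leaf_def card_le_Suc0_iff_eq)
  with that show thesis by blast
qed

lemma leafD:
  assumes "tree U F" "leaf U F x" "e \<in> F" "e' \<in> F" "x \<in> e" "x \<in> e'"
  shows "e = e'"
proof -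
  have "finite {e \<in> F. x \<in> e}" using tree_finite_edges[OF assms(1)] by simp
  with assms(2) have "\<forall>e\<in>{e \<in> F. x \<in> e}. \<forall>e'\<in>{e \<in> F. x \<in> e}. e = e'"
    by (simp add: leaf_def card_le_Suc0_iff_eq)
  with assms(3-) show ?thesis by blast
qed

text \<open>A vertex that is not a leaf has an edge besides the one the path uses. Its other end
  cannot lie on the path, as that would close a cycle.\<close>

lemma path_extend:
  assumes t: "tree U F" and xs: "path F a xs b" and a: "a \<in> U" "\<not> leaf U F a"
  obtains c where "c \<in> U" "path F c (c # xs) b"
proof -
  obtain ys where ys: "xs = a # ys" using xs by (cases xs) (auto simp: path_Cons)
  obtain e e' where e: "e \<in> F" "e' \<in> F" "e \<noteq> e'" "a \<in> e" "a \<in> e'"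
    using not_leafD[OF t a] by blast
  obtain d where d: "d \<in> F" "a \<in> d" "ys \<noteq> [] \<longrightarrow> d \<noteq> {a, hd ys}"
    using e by metis
  obtain c where c: "d = {a, c}" "c \<noteq> a" "c \<in> U"
    using tree_edgeE[OF t d(1,2)] by metis
  have "c \<notin> set ys"
  proof
    assume "c \<in> set ys"
    then obtain us vs where us: "ys = us @ c # vs" by (auto dest: split_list)
    \<comment> \<open>The new edge differs from the first edge of the path, so the cycle has at
      least three vertices.\<close>
    then have "us \<noteq> []" using d(3) c by (cases us) auto
    moreover have "path F a ((a # us) @ [c]) c"
      using xs by (intro path_prefix[of _ _ _ _ vs b]) (simp add: ys us)
    ultimately have "cycle F (a # us @ [c])"
      using d(1) c by (cases us) (auto simp: path_def cycle_def insert_commute)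
    then show False using t by (auto simp: tree_def)
  qed
  then have "path F c (c # xs) b"
    using xs d(1) c ys by (auto simp: path_Cons insert_commute)
  with that c(3) show thesis by blast
qed

text \<open>A longest path cannot be extended at either end, so both ends are leaves.\<close>

lemma tree_longest_path:
  assumes t: "tree U F"
  shows "\<exists>a b xs. leaf U F a \<and> leaf U F b \<and> path F a xs b \<and>
    (\<forall>c\<in>U. \<forall>ys d. path F c ys d \<longrightarrow> length ys \<le> length xs)"
proof -
  let ?P = "\<lambda>xs. \<exists>a b. a \<in> U \<and> path F a xs b"
  have edges: "\<forall>e\<in>F. e \<subseteq> U" and fin: "finite U" using t by (auto simp: tree_def)
  obtain r where "r \<in> U" using t by (auto simp: tree_def)
  then have "?P [r]" by (intro exI[of _ r]) (simp add: path_def)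
  moreover have "\<forall>xs. ?P xs \<longrightarrow> length xs < Suc (card U)"
  proof (intro allI impI)
    fix xs assume "?P xs"
    then obtain a b where "a \<in> U" "path F a xs b" by blast
    then have "set xs \<subseteq> U" "distinct xs"
      using path_subset[of F a xs b U] edges by (simp_all add: path_def)
    then show "length xs < Suc (card U)"
      using card_mono[OF fin, of "set xs"] distinct_card[of xs] by linarith
  qed
  ultimately obtain xs where xs: "?P xs" and max: "\<And>ys. ?P ys \<Longrightarrow> length ys \<le> length xs"
    using ex_has_greatest_nat[of ?P "[r]" length "Suc (card U)"] by blast
  from xs obtain a b where ab: "a \<in> U" "path F a xs b" by blast
  have "b \<in> U"
    using path_subset[OF ab(2,1) edges] ab(2) last_in_set[of xs] by (auto simp: path_def)
  have end_leaf: "leaf U F x" if "x \<in> U" "path F x zs y" "length zs = length xs" for x y zs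
  proof (rule ccontr)
    assume "\<not> leaf U F x"
    from path_extend[OF t that(2,1) this] obtain c where "c \<in> U" "path F c (c # zs) y" .
    then show False using max[of "c # zs"] that(3) by auto
  qed
  have "leaf U F a" using end_leaf[OF ab] by simp
  moreover have "leaf U F b" using end_leaf[OF \<open>b \<in> U\<close> path_rev[OF ab(2)]] by simp
  ultimately show ?thesis
    using ab(2) max by (intro exI[of _ a] exI[of _ b] exI[of _ xs]) blast
qed

text \<open>Some longest path joins two leaves, so the diameter bounds all paths and leaves need not
  be mentioned any more. \<open>Suc D\<close> counts vertices instead of edges.\<close>

lemma diameter_le_iff:
  assumes t: "tree U F"
  shows "diameter U F \<le> D \<longleftrightarrow> (\<forall>a\<in>U. \<forall>xs b. path F a xs b \<longrightarrow> length xs \<le> Suc D)"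
proof -
  obtain a b xs where ab: "leaf U F a" "leaf U F b" "path F a xs b"
    and max: "\<And>c d ys. c \<in> U \<Longrightarrow> path F c ys d \<Longrightarrow> length ys \<le> length xs"
    using tree_longest_path[OF t] by blast
  have a: "a \<in> U" using ab(1) by (simp add: leaf_def)
  let ?L = "{length xs - 1 | xs u v. leaf U F u \<and> leaf U F v \<and> path F u xs v}"
  have le: "l \<le> length xs - 1" if "l \<in> ?L" for l
    using that max by (auto simp: leaf_def diff_le_mono)
  then have "finite ?L" by (meson finite_nat_set_iff_bounded_le)
  then have "diameter U F = length xs - 1"
    unfolding diameter_def using le ab by (intro Max_eqI) auto
  moreover have "xs \<noteq> []" using ab(3) by auto
  ultimately show ?thesis
    using ab(3) a max by (cases xs) fastforce+
qed

section \<open>Centres\<close>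

text \<open>\<open>h\<close> is the distance from the centre, which is the vertex \<open>u = v\<close> or the edge \<open>{u, v}\<close>; \<open>p x\<close> is
  the neighbour of \<open>x\<close> that is closer to the centre.\<close>

definition centred ::
  "'a set \<Rightarrow> 'a set set \<Rightarrow> 'a \<Rightarrow> 'a \<Rightarrow> ('a \<Rightarrow> 'a) \<Rightarrow> ('a \<Rightarrow> nat) \<Rightarrow> nat \<Rightarrow> bool" where
  "centred U F u v p h k \<longleftrightarrow>
     finite U \<and> u \<in> U \<and> v \<in> U \<and> h u = 0 \<and> h v = 0 \<and> (\<forall>x\<in>U. h x \<le> k) \<and>
     (\<forall>x\<in>U - {u, v}. p x \<in> U \<and> h x = Suc (h (p x))) \<and>
     F = (\<lambda>x. {x, p x}) ` (U - {u, v}) \<union> (if u = v then {} else {{u, v}})"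

lemma centredD:
  assumes "centred U F u v p h k"
  shows "finite U" "u \<in> U" "v \<in> U" "h u = 0" "h v = 0" "x \<in> U \<Longrightarrow> h x \<le> k"
    and "F = (\<lambda>x. {x, p x}) ` (U - {u, v}) \<union> (if u = v then {} else {{u, v}})"
proof -
  note A = assms[unfolded centred_def]
  from A show "finite U" by (elim conjE)
  from A show "u \<in> U" by (elim conjE)
  from A show "v \<in> U" by (elim conjE)
  from A show "h u = 0" by (elim conjE)
  from A show "h v = 0" by (elim conjE)
  from A show "F = (\<lambda>x. {x, p x}) ` (U - {u, v}) \<union> (if u = v then {} else {{u, v}})"
    by (elim conjE)
  show "h x \<le> k" if "x \<in> U"
    using A that by (elim conjE) (rule bspec)
qed

lemma centred_edge:
  assumes "centred U F u v p h k" "{x, y} \<in> F"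
  shows "x \<in> U - {u, v} \<and> y = p x \<or> y \<in> U - {u, v} \<and> x = p y \<or> u \<noteq> v \<and> {x, y} = {u, v}"
proof (cases "u \<noteq> v \<and> {x, y} = {u, v}")
  case False
  then obtain z where z: "z \<in> U - {u, v}" "{x, y} = {z, p z}"
    using assms(2)[unfolded centredD(7)[OF assms(1)]] by (cases "u = v") (simp_all, blast+)
  then have "x = z \<and> y = p z \<or> x = p z \<and> y = z"
    by (simp only: doubleton_eq_iff)
  then show ?thesis
  proof
    assume "x = z \<and> y = p z"
    with z(1) have "x \<in> U - {u, v} \<and> y = p x" by (simp only: simp_thms)
    then show ?thesis ..
  next
    assume "x = p z \<and> y = z"
    with z(1) have "y \<in> U - {u, v} \<and> x = p y" by (simp only: simp_thms)
    then show ?thesis by (intro disjI2 disjI1)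
  qed
qed (intro disjI2)

lemma centred_parent:
  assumes "centred U F u v p h k" "x \<in> U - {u, v}"
  shows "p x \<in> U" "h x = Suc (h (p x))"
proof -
  have "\<forall>x\<in>U - {u, v}. p x \<in> U \<and> h x = Suc (h (p x))"
    using assms(1)[unfolded centred_def] by (elim conjE)
  note * = bspec[OF this assms(2)]
  show "p x \<in> U" by (rule conjunct1[OF *])
  show "h x = Suc (h (p x))" by (rule conjunct2[OF *])
qed

text \<open>A path that has made one step away from the centre cannot turn back: the only edge
  towards the centre leads to the vertex just left. So the height grows by one with every further
  edge.\<close>

lemma centred_descend:
  assumes c: "centred U F u v p h k"
    and "distinct (y # x # xs)" "successively (\<lambda>x y. {x, y} \<in> F) (y # x # xs)"
    and "x \<in> U - {u, v}" "y = p x"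
  shows "h (last (x # xs)) = h x + length xs"
  using assms(2-)
proof (induction xs arbitrary: x y)
  case (Cons z zs)
  have "{x, z} \<in> F" using Cons.prems by simp
  then have z: "z \<in> U - {u, v}" "x = p z"
    using centred_edge[OF c, of x z] Cons.prems by (auto simp: doubleton_eq_iff)
  then have "h (last (z # zs)) = h z + length zs"
    using Cons.prems by (intro Cons.IH[of x]) auto
  then show ?case using centred_parent(2)[OF c z(1)] z(2) by simp
qed simp

text \<open>A path climbs towards the centre, crosses the central edge at most once and then only
  descends.\<close>

lemma centred_path_length:
  assumes c: "centred U F u v p h k"
    and "xs \<noteq> []" "distinct xs" "successively (\<lambda>x y. {x, y} \<in> F) xs"
  shows "length xs - 1 \<le> h (hd xs) + h (last xs) + (if u = v then 0 else 1)"
  using assms(2-)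
proof (induction xs rule: induct_list012)
  case (3 x y zs)
  note IH = 3(2) and dist = 3(4) and succ = 3(5)
  have xy: "{x, y} \<in> F" using succ by simp
  consider "x \<in> U - {u, v}" "y = p x" | "y \<in> U - {u, v}" "x = p y" | "u \<noteq> v" "{x, y} = {u, v}"
    using centred_edge[OF c xy] by blast
  then show ?case
  proof cases
    case 1
    have "length (y # zs) - 1 \<le> h (hd (y # zs)) + h (last (y # zs)) + (if u = v then 0 else 1)"
      using dist succ by (intro IH) auto
    moreover have "h x = Suc (h y)"
      using centred_parent(2)[OF c 1(1)] 1(2) by simp
    ultimately show ?thesis by simp
  next
    case 2
    then have "h (last (y # zs)) = h y + length zs"
      using dist succ by (intro centred_descend[OF c, of x]) auto
    then show ?thesis using centred_parent(2)[OF c 2(1)] by simp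
  next
    case central: 3
    show ?thesis
    proof (cases zs)
      case Nil
      then show ?thesis using central(1) by simp
    next
      case (Cons z zs')
      have "{y, z} \<in> F" using succ Cons by simp
      from centred_edge[OF c this] have z: "z \<in> U - {u, v}" "y = p z"
        using central dist Cons by (auto simp: doubleton_eq_iff)
      then have "h (last (z # zs')) = h z + length zs'"
        using dist succ Cons by (intro centred_descend[OF c, of y]) auto
      then show ?thesis using central(1) centred_parent(2)[OF c z(1)] Cons by simp
    qed
  qed
qed auto

text \<open>At a vertex of maximal height on a cycle both neighbours are no higher. There is only
  one such neighbour, the parent or the other end of the central edge, so the two would
  coincide.\<close>

lemma centred_acyclic:
  assumes c: "centred U F u v p h k"
  shows "\<not> cycle F xs"
proof
  assume cyc: "cycle F xs"
  then have "xs \<noteq> []" by (auto simp: cycle_def)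
  then have "Max (h ` set xs) \<in> h ` set xs" by (intro Max_in) auto
  then obtain m where m: "m \<in> set xs" "h m = Max (h ` set xs)" by auto
  obtain as bs where "xs = as @ m # bs" using m(1) by (auto dest: split_list)
  with cyc have cyc': "cycle F (m # bs @ as)" and set: "set (m # bs @ as) = set xs"
    using cycle_rotate[of F as "m # bs"] by auto
  have "2 \<le> length (bs @ as)" using cyc' by (simp add: cycle_def)
  then obtain y ws where ws: "bs @ as = y # ws" "1 \<le> length ws"
    by (cases "bs @ as") simp_all
  then have "ws \<noteq> []" by auto
  note cyc' = cyc'[unfolded ws(1)] and set = set[unfolded ws(1)]
  let ?z = "last ws"
  have d: "distinct (m # y # ws)" and e: "{m, y} \<in> F" "{?z, m} \<in> F"
    using cyc' \<open>ws \<noteq> []\<close> by (simp_all add: cycle_def)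
  have z: "?z \<in> set ws" using \<open>ws \<noteq> []\<close> by simp
  then have ne: "y \<noteq> ?z" using d by auto
  have "y \<in> set xs" "?z \<in> set xs" using set z by auto
  then have h: "h y \<le> h m" "h ?z \<le> h m" using m(2) by simp_all
  have up: "w = (if m \<in> U - {u, v} then p m else if m = u then v else u)"
    if "{m, w} \<in> F" "h w \<le> h m" for w
    using centred_edge[OF c that(1)]
  proof (elim disjE)
    assume "w \<in> U - {u, v} \<and> m = p w"
    then have "h w = Suc (h m)" using centred_parent(2)[OF c, of w] by (simp only: simp_thms)
    then show ?thesis using that(2) by simp
  next
    assume "u \<noteq> v \<and> {m, w} = {u, v}"
    then show ?thesis by (auto simp: doubleton_eq_iff)
  qed simp
  have "y = ?z"
    using up[OF e(1) h(1)] up[OF _ h(2)] e(2) by (simp only: insert_commute)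
  with ne show False ..
qed

lemma centred_tree:
  assumes c: "centred U F u v p h k"
  shows "tree U F"
proof -
  let ?R = "{(x, y). {x, y} \<in> F}"
  have sym: "sym (?R\<^sup>*)"
    by (intro sym_rtrancl) (auto simp: sym_def insert_commute)
  have root: "(u, x) \<in> ?R\<^sup>*" if "x \<in> U" for x
    using that
  proof (induction "h x" arbitrary: x)
    case 0
    then have "x \<in> {u, v}" using centred_parent(2)[OF c, of x] by auto
    moreover have "u \<noteq> v \<Longrightarrow> {u, v} \<in> F" using centredD(7)[OF c] by simp
    ultimately show ?case by auto
  next
    case (Suc n)
    have x: "x \<in> U - {u, v}"
      using centredD(4,5)[OF c] Suc.hyps(2) Suc.prems by force
    moreover have "{x, p x} \<in> F" using centredD(7)[OF c] x by blast
    ultimately have "p x \<in> U" "h (p x) = n" "{p x, x} \<in> F"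
      using centred_parent[OF c x] Suc.hyps(2) by (simp_all add: insert_commute)
    then show ?case
      using Suc.hyps(1)[of "p x"] by (auto intro: rtrancl_into_rtrancl)
  qed
  have "\<exists>xs. path F x xs y" if "x \<in> U" "y \<in> U" for x y
    using root[OF that(1)] root[OF that(2)] sym
    by (intro rtrancl_path) (meson rtrancl_trans symD)
  moreover have "e \<subseteq> U \<and> card e = 2" if eF: "e \<in> F" for e
  proof -
    have "\<exists>x y. e = {x, y} \<and> x \<noteq> y \<and> x \<in> U \<and> y \<in> U"
    proof (cases "u \<noteq> v \<and> e = {u, v}")
      case True
      then show ?thesis using centredD(2,3)[OF c] by blast
    next
      case False
      then obtain x where x: "x \<in> U - {u, v}" "e = {x, p x}"
        using eF[unfolded centredD(7)[OF c]] by (cases "u = v") (simp_all, blast+)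
      moreover have "x \<noteq> p x" using centred_parent(2)[OF c x(1)] by (metis n_not_Suc_n)
      ultimately show ?thesis using centred_parent(1)[OF c x(1)] by blast
    qed
    then show ?thesis by (auto simp: card_2_iff)
  qed
  ultimately show ?thesis
    using centredD(1,2)[OF c] centred_acyclic[OF c] unfolding tree_def by blast
qed

lemma centred_diameter:
  assumes c: "centred U F u v p h k" and "2 * k + (if u = v then 0 else 1) \<le> D"
  shows "diameter U F \<le> D"
  unfolding diameter_le_iff[OF centred_tree[OF c]]
proof (intro ballI allI impI)
  fix a xs b assume a: "a \<in> U" and xs: "path F a xs b"
  have "set xs \<subseteq> U"
    using centred_tree[OF c] by (intro path_subset[OF xs a]) (auto simp: tree_def)
  then have "b \<in> U" using xs by (auto simp: path_def)
  then have "h a \<le> k" "h b \<le> k" using a centredD(6)[OF c] by blast+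
  moreover have "length xs - 1 \<le> h a + h b + (if u = v then 0 else 1)"
    using centred_path_length[OF c, of xs] xs by (auto simp: path_def)
  ultimately show "length xs \<le> Suc D" using assms(2) by linarith
qed

text \<open>Apart from the central edge, an edge determines its end that is farther from the centre;
  two vertices that were each other's parents would contradict the heights.\<close>

lemma centred_sum:
  assumes c: "centred U F u v p h k"
  shows "(\<Sum>e\<in>F. g e) = (if u = v then 0 else g {u, v}) + (\<Sum>x\<in>U - {u, v}. g {x, p x})"
proof -
  let ?G = "(\<lambda>x. {x, p x}) ` (U - {u, v})"
  have F: "F = ?G \<union> (if u = v then {} else {{u, v}})" and fin: "finite U"
    using centredD(1,7)[OF c] by blast+
  have inj: "inj_on (\<lambda>x. {x, p x}) (U - {u, v})"
  proof (rule inj_onI)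
    fix x y assume xy: "x \<in> U - {u, v}" "y \<in> U - {u, v}" "{x, p x} = {y, p y}"
    show "x = y"
    proof (rule ccontr)
      assume "x \<noteq> y"
      then have "x = p y" "y = p x" using xy(3) by (auto simp: doubleton_eq_iff)
      then show False
        using centred_parent(2)[OF c xy(1)] centred_parent(2)[OF c xy(2)] by simp
    qed
  qed
  have "{u, v} \<notin> ?G" by auto
  then have "(\<Sum>e\<in>F. g e) = (if u = v then 0 else g {u, v}) + (\<Sum>e\<in>?G. g e)"
    using fin by (subst F) simp
  then show ?thesis by (simp add: sum.reindex[OF inj])
qed

section \<open>Removing the leaves of a tree\<close>

lemma tree_path: "tree U F \<Longrightarrow> a \<in> U \<Longrightarrow> b \<in> U \<Longrightarrow> \<exists>xs. path F a xs b"
  unfolding tree_def by blast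

text \<open>Any two vertices are adjacent, so a third vertex would give a triangle. This is the base
  case of the search for a centre.\<close>

lemma small_tree:
  assumes t: "tree U F" and short: "\<And>a xs b. a \<in> U \<Longrightarrow> path F a xs b \<Longrightarrow> length xs \<le> 2"
  shows "(\<exists>x. U = {x} \<and> F = {}) \<or> (\<exists>x y. x \<noteq> y \<and> U = {x, y} \<and> F = {{x, y}})"
proof -
  have card: "e \<subseteq> U \<and> card e = 2" if "e \<in> F" for e using t that by (auto simp: tree_def)
  have adj: "{x, y} \<in> F" if xy: "x \<in> U" "y \<in> U" "x \<noteq> y" for x y
  proof -
    obtain xs where xs: "path F x xs y" using tree_path[OF t xy(1,2)] by blast
    moreover have "length xs \<le> 2" using short[OF xy(1) xs] .
    ultimately show ?thesis
      using xy(3) by (cases xs rule: remdups_adj.cases) (auto simp: path_Cons)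
  qed
  obtain x where x: "x \<in> U" using t by (auto simp: tree_def)
  show ?thesis
  proof (cases "U = {x}")
    case True
    have "e \<notin> F" for e
    proof
      assume "e \<in> F"
      then have "e \<subseteq> {x}" "card e = 2" using card True by auto
      then show False using card_mono[of "{x}" e] by simp
    qed
    then show ?thesis using True by blast
  next
    case False
    then obtain y where y: "y \<in> U" "y \<noteq> x" using x by blast
    have U: "U = {x, y}"
    proof (rule ccontr)
      assume "U \<noteq> {x, y}"
      then obtain z where z: "z \<in> U" "z \<noteq> x" "z \<noteq> y" using x y by blast
      then have "cycle F [x, y, z]"
        using adj[OF x y(1)] adj[OF y(1) z(1)] adj[OF z(1) x] y by (auto simp: cycle_def)
      then show False using t by (auto simp: tree_def)
    qed
    have "e = {x, y}" if "e \<in> F" for e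
      using card[OF that] y(2) unfolding U by (intro card_subset_eq) auto
    then have "F = {{x, y}}" using adj[OF x y(1)] y(2) by blast
    then show ?thesis using U y(2) by blast
  qed
qed

lemma inner_vertex_not_leaf:
  assumes t: "tree U F" and p: "path F a (ys @ x # zs) b" and ne: "ys \<noteq> []" "zs \<noteq> []"
  shows "\<not> leaf U F x"
proof
  assume l: "leaf U F x"
  have s: "successively (\<lambda>x y. {x, y} \<in> F) (ys @ x # zs)" and d: "distinct (ys @ x # zs)"
    using p by (auto simp: path_def)
  have e: "{last ys, x} \<in> F" "{x, hd zs} \<in> F"
    using s ne by (auto simp: successively_append_iff successively_Cons)
  have "{last ys, x} = {x, hd zs}"
    using leafD[OF t l e] by simp
  then have "last ys = hd zs" by (auto simp: doubleton_eq_iff)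
  then show False using d ne last_in_set[of ys] hd_in_set[of zs] by auto
qed

definition inner_vertices :: "'a set \<Rightarrow> 'a set set \<Rightarrow> 'a set" where
  "inner_vertices U F = {x \<in> U. \<not> leaf U F x}"

text \<open>A leaf can only be an end of a path, so deleting all leaves does not disconnect the
  remaining vertices.\<close>

lemma path_inner_vertices:
  assumes t: "tree U F" and p: "path F a xs b" and "a \<in> inner_vertices U F" "b \<in> inner_vertices U F"
  shows "set xs \<subseteq> inner_vertices U F"
proof
  fix x assume x: "x \<in> set xs"
  then obtain ys zs where xs: "xs = ys @ x # zs" by (auto dest: split_list)
  have "a \<in> U" using assms(3) by (simp add: inner_vertices_def)
  then have "set xs \<subseteq> U" using path_subset[OF p, of U] t by (simp add: tree_def)
  then have "x \<in> U" using x by blast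
  consider "ys = []" | "zs = []" | "ys \<noteq> []" "zs \<noteq> []" by blast
  then show "x \<in> inner_vertices U F"
  proof cases
    case 1
    then show ?thesis using p assms(3) by (simp add: xs path_def)
  next
    case 2
    then show ?thesis using p assms(4) by (simp add: xs path_def)
  next
    case 3
    then have "\<not> leaf U F x" using inner_vertex_not_leaf[OF t p[unfolded xs]] by blast
    then show ?thesis using \<open>x \<in> U\<close> by (simp add: inner_vertices_def)
  qed
qed

lemma tree_inner_vertices:
  assumes t: "tree U F" and ne: "inner_vertices U F \<noteq> {}"
  shows "tree (inner_vertices U F) {e \<in> F. e \<subseteq> inner_vertices U F}"
proof -
  let ?U = "inner_vertices U F" and ?F = "{e \<in> F. e \<subseteq> inner_vertices U F}"
  have "\<exists>xs. path ?F a xs b" if ab: "a \<in> ?U" "b \<in> ?U" for a b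
  proof -
    obtain xs where xs: "path F a xs b"
      using tree_path[OF t, of a b] ab by (auto simp: inner_vertices_def)
    have "set xs \<subseteq> ?U" by (rule path_inner_vertices[OF t xs ab])
    then have sub: "e \<in> ?F" if "e \<in> F" "e \<subseteq> set xs" for e using that by blast
    have "successively (\<lambda>x y. {x, y} \<in> F) xs" using xs by (simp add: path_def)
    then have "successively (\<lambda>x y. {x, y} \<in> ?F) xs"
      by (rule successively_edge_mono) (rule sub)
    then have "path ?F a xs b" using xs unfolding path_def by blast
    then show ?thesis ..
  qed
  moreover have "\<not> cycle ?F xs" for xs
  proof
    assume c: "cycle ?F xs"
    then have "successively (\<lambda>x y. {x, y} \<in> ?F) xs" unfolding cycle_def by blast
    then have "successively (\<lambda>x y. {x, y} \<in> F) xs" by (rule successively_edge_mono) blast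
    with c have "cycle F xs" unfolding cycle_def by blast
    then show False using t by (auto simp: tree_def)
  qed
  moreover have "finite ?U" using t by (auto simp: tree_def inner_vertices_def)
  moreover have "\<forall>e\<in>?F. e \<subseteq> ?U \<and> card e = 2" using t by (auto simp: tree_def)
  ultimately show ?thesis using ne unfolding tree_def by blast
qed

text \<open>The path from the leaf to \<open>z\<close> starts with its only edge, and the second
  vertex either is \<open>z\<close> or lies inside the path; in both cases it is no leaf.\<close>

lemma leaf_neighbour:
  assumes t: "tree U F" and z: "z \<in> inner_vertices U F" and x: "leaf U F x"
  shows "\<exists>y. y \<in> inner_vertices U F \<and> {x, y} \<in> F \<and> (\<forall>e\<in>F. x \<in> e \<longrightarrow> e = {x, y})"
proof -
  have xU: "x \<in> U" and zU: "z \<in> U" and zl: "\<not> leaf U F z"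
    using x z by (auto simp: leaf_def inner_vertices_def)
  obtain xs where xs: "path F x xs z" using tree_path[OF t xU zU] by blast
  have "x \<noteq> z" using x zl by blast
  obtain ys where ys: "xs = x # ys" using xs by (cases xs) (auto simp: path_Cons)
  then have "ys \<noteq> []" using xs \<open>x \<noteq> z\<close> by (auto simp: path_Cons)
  then obtain y zs where yz: "ys = y # zs" by (cases ys) auto
  have e: "{x, y} \<in> F" using xs by (auto simp: ys yz path_Cons)
  then have yU: "y \<in> U" using t by (auto simp: tree_def)
  have "\<not> leaf U F y"
  proof (cases "zs = []")
    case True
    then have "y = z" using xs by (auto simp: ys yz path_Cons)
    then show ?thesis using zl by simp
  next
    case False
    then show ?thesis
      using inner_vertex_not_leaf[OF t, of x "[x]" y zs z] xs by (simp add: ys yz)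
  qed
  then have "y \<in> inner_vertices U F" using yU by (simp add: inner_vertices_def)
  moreover have "\<forall>e'\<in>F. x \<in> e' \<longrightarrow> e' = {x, y}"
    using leafD[OF t x _ e] by blast
  ultimately show ?thesis using e by (intro exI[of _ y] conjI)
qed

lemma centred_single: "centred {x} {} x x p (\<lambda>_. 0) k"
  by (simp add: centred_def)

text \<open>Removing all leaves shortens the longest paths by two edges and keeps the centre.\<close>

lemma tree_centred:
  assumes "tree U F" "\<And>a xs b. a \<in> U \<Longrightarrow> path F a xs b \<Longrightarrow> length xs \<le> Suc D"
  shows "\<exists>u v p h. centred U F u v p h (D div 2) \<and> (u \<noteq> v \<longrightarrow> odd D)"
  using assms
proof (induction D arbitrary: U F rule: less_induct)
  case (less D)
  note t = less.prems(1) and bound = less.prems(2)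
  let ?I = "inner_vertices U F" and ?F = "{e \<in> F. e \<subseteq> inner_vertices U F}"
  show ?case
  proof (cases "D < 2 \<or> ?I = {}")
    case True
    have short: "length xs \<le> 2" if a: "a \<in> U" "path F a xs b" for a xs b
    proof (cases "D < 2")
      case True
      then show ?thesis using bound[OF a] by simp
    next
      case False
      then have I: "?I = {}" using \<open>D < 2 \<or> ?I = {}\<close> by simp
      show ?thesis
      proof (rule ccontr)
        assume "\<not> length xs \<le> 2"
        then obtain x y zs where xs: "xs = x # y # zs" "zs \<noteq> []"
          by (cases xs rule: remdups_adj.cases) auto
        then have "\<not> leaf U F y"
          using inner_vertex_not_leaf[OF t, of a "[x]" y zs b] a by simp
        moreover have "y \<in> U"
          using path_subset[OF a(2,1)] t xs by (auto simp: tree_def)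
        ultimately show False using I by (auto simp: inner_vertices_def)
      qed
    qed
    have "(\<exists>x. U = {x} \<and> F = {}) \<or> (\<exists>x y. x \<noteq> y \<and> U = {x, y} \<and> F = {{x, y}})"
      by (rule small_tree[OF t]) (rule short)
    then show ?thesis
    proof (elim disjE exE conjE)
      fix x assume "U = {x}" "F = {}"
      then have "centred U F x x id (\<lambda>_. 0) (D div 2)" by (simp add: centred_single)
      then show ?thesis by blast
    next
      fix x y assume xy: "x \<noteq> y" "U = {x, y}" "F = {{x, y}}"
      show ?thesis
      \<comment> \<open>For \<open>D = 1\<close> the edge has to be the centre. Otherwise
        \<open>D\<close> may be even, which forbids a central edge, and \<open>x\<close> is taken as
        centre with \<open>y\<close> at height 1.\<close>
      proof (cases "D < 2")
        case True
        have "path F x [x, y] y" using xy by (simp add: path_def)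
        then have "Suc 0 \<le> D" using bound[of x "[x, y]" y] xy by simp
        then have "D = 1" using True by simp
        moreover have "centred U F x y id (\<lambda>_. 0) (D div 2)"
          using xy by (simp add: centred_def)
        ultimately show ?thesis using xy(1) by (metis odd_one)
      next
        case False
        have "U - {x, x} = {y}" using xy by auto
        then have "centred U F x x (\<lambda>_. x) (\<lambda>z. if z = x then 0 else 1) (D div 2)"
          using xy False by (auto simp: centred_def insert_commute)
        then show ?thesis by blast
      qed
    qed
  next
    case False
    then have D: "2 \<le> D" and I: "?I \<noteq> {}" by auto
    then obtain z where z: "z \<in> ?I" by blast
    have t': "tree ?I ?F" by (rule tree_inner_vertices[OF t I])
    \<comment> \<open>A path between inner vertices extends by one edge at each end in the full
      tree, so its bound drops by two.\<close>
    have "length xs \<le> Suc (D - 2)" if a: "a \<in> ?I" "path ?F a xs b" for a xs b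
    proof -
      have "b \<in> ?I"
        using path_subset[OF a(2,1)] a(2) last_in_set[of xs] by (auto simp: path_def)
      then have ab: "a \<in> U" "\<not> leaf U F a" "b \<in> U" "\<not> leaf U F b"
        using a(1) by (auto simp: inner_vertices_def)
      have "successively (\<lambda>x y. {x, y} \<in> ?F) xs" using a(2) unfolding path_def by blast
      then have "successively (\<lambda>x y. {x, y} \<in> F) xs" by (rule successively_edge_mono) blast
      then have xs: "path F a xs b" using a(2) unfolding path_def by blast
      obtain c where c: "c \<in> U" "path F c (c # xs) b"
        using path_extend[OF t xs ab(1,2)] by blast
      obtain d where d: "d \<in> U" "path F d (d # rev (c # xs)) c"
        using path_extend[OF t path_rev[OF c(2)] ab(3,4)] by blast
      show ?thesis using bound[OF d] D by simp
    qed
    moreover have "D - 2 < D" using D by simp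
    ultimately have "\<exists>u v p h. centred ?I ?F u v p h ((D - 2) div 2) \<and> (u \<noteq> v \<longrightarrow> odd (D - 2))"
      using less.IH[of "D - 2" ?I ?F] t' by blast
    then obtain u v p h where c: "centred ?I ?F u v p h ((D - 2) div 2)"
      and odd: "u \<noteq> v \<longrightarrow> odd (D - 2)" by blast
    have "\<forall>x. leaf U F x \<longrightarrow> (\<exists>y. y \<in> ?I \<and> {x, y} \<in> F \<and> (\<forall>e\<in>F. x \<in> e \<longrightarrow> e = {x, y}))"
      using leaf_neighbour[OF t z] by blast
    then obtain q where q: "\<And>x. leaf U F x \<Longrightarrow> q x \<in> ?I" "\<And>x. leaf U F x \<Longrightarrow> {x, q x} \<in> F"
      "\<And>x e. leaf U F x \<Longrightarrow> e \<in> F \<Longrightarrow> x \<in> e \<Longrightarrow> e = {x, q x}"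
      by metis
    \<comment> \<open>A removed leaf hangs one level below its only neighbour; this uses up the
      additional level of \<open>D div 2\<close>.\<close>
    define p' where "p' x = (if x \<in> ?I then p x else q x)" for x
    define h' where "h' x = (if x \<in> ?I then h x else Suc (h (q x)))" for x
    have IU: "?I \<subseteq> U" and L: "\<And>x. x \<in> U \<Longrightarrow> x \<notin> ?I \<Longrightarrow> leaf U F x"
      by (auto simp: inner_vertices_def)
    note cD = centredD[OF c]
    have k: "D div 2 = Suc ((D - 2) div 2)" using D by simp
    have F: "F = (\<lambda>x. {x, p' x}) ` (U - {u, v}) \<union> (if u = v then {} else {{u, v}})"
    proof -
      have "?F = (\<lambda>x. {x, p' x}) ` (?I - {u, v}) \<union> (if u = v then {} else {{u, v}})"
        by (subst cD(7)) (simp add: p'_def)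
      moreover have "F = ?F \<union> (\<lambda>x. {x, p' x}) ` (U - ?I)"
      proof (intro equalityI subsetI)
        fix e assume e: "e \<in> F"
        show "e \<in> ?F \<union> (\<lambda>x. {x, p' x}) ` (U - ?I)"
        proof (cases "e \<subseteq> ?I")
          case True
          then show ?thesis using e by simp
        next
          case False
          then obtain x where x: "x \<in> e" "x \<notin> ?I" by blast
          have "x \<in> U" using e x(1) t by (auto simp: tree_def)
          then have "e = {x, p' x}" using q(3)[OF L[OF _ x(2)] e x(1)] x(2) by (simp add: p'_def)
          then show ?thesis using x(2) \<open>x \<in> U\<close> by blast
        qed
      next
        fix e assume "e \<in> ?F \<union> (\<lambda>x. {x, p' x}) ` (U - ?I)"
        then show "e \<in> F"
        proof
          assume "e \<in> (\<lambda>x. {x, p' x}) ` (U - ?I)"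
          then obtain x where x: "x \<in> U" "x \<notin> ?I" "e = {x, p' x}" by blast
          then show ?thesis using q(2)[OF L[OF x(1,2)]] by (simp add: p'_def)
        qed simp
      qed
      moreover have "U - {u, v} = (?I - {u, v}) \<union> (U - ?I)" using IU cD(2,3) by blast
      ultimately show ?thesis by (simp only: image_Un Un_ac)
    qed
    have par: "p' x \<in> U \<and> h' x = Suc (h' (p' x))" if x: "x \<in> U - {u, v}" for x
    proof (cases "x \<in> ?I")
      case True
      then have "x \<in> ?I - {u, v}" using x by blast
      from centred_parent[OF c this] show ?thesis
        using True IU by (simp add: p'_def h'_def subset_iff)
    next
      case False
      then have "q x \<in> ?I" using q(1) L x by blast
      then show ?thesis using False IU by (simp add: p'_def h'_def subset_iff)
    qed
    have le: "h' x \<le> D div 2" if "x \<in> U" for x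
      using cD(6)[of x] cD(6)[of "q x"] q(1)[of x] L[OF that] by (auto simp: h'_def k)
    have "centred U F u v p' h' (D div 2)"
      unfolding centred_def
    proof (intro conjI ballI)
      show "finite U" using t by (simp add: tree_def)
      show "u \<in> U" "v \<in> U" using cD(2,3) IU by blast+
      show "h' u = 0" "h' v = 0" using cD(2-5) by (simp_all add: h'_def)
      show "h' x \<le> D div 2" if "x \<in> U" for x using le[OF that] .
      show "p' x \<in> U" if "x \<in> U - {u, v}" for x by (rule conjunct1[OF par[OF that]])
      show "h' x = Suc (h' (p' x))" if "x \<in> U - {u, v}" for x by (rule conjunct2[OF par[OF that]])
    qed (rule F)
    \<comment> \<open>Two edges are removed from the bound, so its parity is the same.\<close>
    moreover have "u \<noteq> v \<longrightarrow> odd D" using odd D by (auto simp: even_diff_nat)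
    ultimately show ?thesis by blast
  qed
qed

section \<open>Correctness of the reduction\<close>

subsection \<open>The graph with a new root\<close>

text \<open>Column 0 is absent, so no tree can pass through the root. Both uses of
  \<open>- 1\<close> act on positive numbers and undo the shift of the vertices.\<close>

definition query_weights :: "nat \<Rightarrow> (nat set \<rightharpoonup> rat) \<Rightarrow> bool \<Rightarrow> nat \<Rightarrow> nat \<Rightarrow> (nat \<times> nat \<rightharpoonup> rat)" where
  "query_weights n E p u v = (\<lambda>(i, j).
     if i \<le> n \<and> j \<le> n then
       if i = j then Some 0 else if j = 0 then None
       else if i = 0 then row0 u v p (E {u, v}) (j - 1) else E {i - 1, j - 1}
     else None)"

lemma query_weights_root: "x < n \<Longrightarrow> query_weights n E p u v (0, Suc x) = row0 u v p (E {u, v}) x"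
  by (simp add: query_weights_def)

lemma query_weights_edge:
  "x < n \<Longrightarrow> y < n \<Longrightarrow> x \<noteq> y \<Longrightarrow> query_weights n E p u v (Suc x, Suc y) = E {x, y}"
  by (simp add: query_weights_def)

lemma query_instance:
  assumes "dcst_instance {..<n} E T D"
  shows "ddcst_instance {..<Suc n} (query_weights n E p u v) (Suc ` T) 0 (Suc d)"
proof -
  have nonneg: "0 \<le> c" if "E e = Some c" for e c
    using dcst_instance_nonneg[OF assms that] .
  have "0 \<le> c" if "query_weights n E p u v e = Some c" for e c
    using that nonneg by (auto simp: query_weights_def row0_def split: if_splits prod.splits)
  then have "\<forall>c\<in>ran (query_weights n E p u v). 0 \<le> c"
    by (auto simp: ran_def)
  moreover have "T \<subseteq> {..<n}" using assms by (simp add: dcst_instance_def)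
  moreover have "dom (query_weights n E p u v) \<subseteq> {..<Suc n} \<times> {..<Suc n}"
    by (auto simp: query_weights_def split: if_splits)
  moreover have "query_weights n E p u v (i, i) = Some 0" if "i \<in> {..<Suc n}" for i
    using that by (simp add: query_weights_def)
  ultimately show ?thesis by (auto simp: ddcst_instance_def)
qed

lemma dcst_weightsI:
  assumes "U \<subseteq> V" "F \<subseteq> dom E" "tree U F" "T \<subseteq> U" "diameter U F \<le> D"
  shows "(\<Sum>e\<in>F. the (E e)) \<in> dcst_weights V E T D"
  using assms unfolding dcst_weights_def by blast

lemma ddcst_weightsI:
  assumes "U \<subseteq> V" "F \<subseteq> dom E" "ditree U F r" "T \<subseteq> U" "didiameter U F r \<le> D"
  shows "(\<Sum>e\<in>F. the (E e)) \<in> ddcst_weights V E T r D"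
  using assms unfolding ddcst_weights_def by blast

lemma ddcst_weights_arboE:
  assumes "w \<in> ddcst_weights V E T r D"
  obtains U p h where "finite U" "U \<subseteq> V" "r \<in> U" "T \<subseteq> U" "h r = 0"
    "\<And>x. x \<in> U \<Longrightarrow> x \<noteq> r \<Longrightarrow> p x \<in> U" "\<And>x. x \<in> U \<Longrightarrow> x \<noteq> r \<Longrightarrow> h x = Suc (h (p x))"
    "\<And>x. x \<in> U \<Longrightarrow> x \<noteq> r \<Longrightarrow> E (p x, x) \<noteq> None" "\<And>x. x \<in> U \<Longrightarrow> h x \<le> D"
    "w = (\<Sum>x\<in>U - {r}. the (E (p x, x)))"
proof -
  obtain U F where w: "w = (\<Sum>e\<in>F. the (E e))" and UF: "U \<subseteq> V" "F \<subseteq> dom E" "ditree U F r" "T \<subseteq> U"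
    and d: "didiameter U F r \<le> D"
    using assms unfolding ddcst_weights_def by blast
  obtain p h where a: "arbo U F r p h" using ditree_arbo[OF UF(3)] by blast
  have fin: "finite U" and r: "r \<in> U" "h r = 0" using a unfolding arbo_def by blast+
  have "h x \<le> D" if "x \<in> U" for x
    using d Max_ge[of "h ` U" "h x"] fin that unfolding arbo_didiameter[OF a] by (meson finite_imageI imageI le_trans)
  moreover have "E (p x, x) \<noteq> None" if "x \<in> U" "x \<noteq> r" for x
    using arbo_parent(3)[OF a that] UF(2) by blast
  moreover have "w = (\<Sum>x\<in>U - {r}. the (E (p x, x)))"
    unfolding w by (rule arbo_sum[OF a])
  ultimately show thesis
    using that[of U h p] fin r UF(1,4) arbo_parent(1,2)[OF a] by blast
qed

lemma ddcst_weights_arboI: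
  assumes a: "arbo U F r p h" and "U \<subseteq> V" "T \<subseteq> U"
    and E: "\<And>x. x \<in> U \<Longrightarrow> x \<noteq> r \<Longrightarrow> E (p x, x) \<noteq> None" and h: "\<And>x. x \<in> U \<Longrightarrow> h x \<le> D"
  shows "(\<Sum>x\<in>U - {r}. the (E (p x, x))) \<in> ddcst_weights V E T r D"
proof -
  have U: "finite U" "r \<in> U"
    using a unfolding arbo_def by blast+
  have F: "F = (\<lambda>x. (p x, x)) ` (U - {r})"
    using a unfolding arbo_def by (elim conjE)
  have "F \<subseteq> dom E" using E unfolding F by blast
  moreover have "didiameter U F r \<le> D"
    unfolding arbo_didiameter[OF a] using U h by (intro Max.boundedI) auto
  ultimately show ?thesis
    using ddcst_weightsI[OF assms(2) _ arbo_ditree[OF a] assms(3)] by (simp only: arbo_sum[OF a])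
qed

text \<open>The children of the new root are the ends of the centre.\<close>

lemma query_sound:
  assumes inst: "dcst_instance {..<n} E T D" and uv: "u < n" "v < n"
    and w: "w \<in> ddcst_weights {..<Suc n} (query_weights n E (odd D) u v) (Suc ` T) 0 (Suc (D div 2))"
  shows "\<exists>w'\<in>dcst_weights {..<n} E T D. w' \<le> w"
proof -
  let ?Q = "query_weights n E (odd D) u v" and ?k = "D div 2"
  obtain U p h where U: "finite U" "U \<subseteq> {..<Suc n}" "0 \<in> U" "Suc ` T \<subseteq> U" "h 0 = 0"
    and p: "\<And>x. x \<in> U \<Longrightarrow> x \<noteq> 0 \<Longrightarrow> p x \<in> U"
    and h: "\<And>x. x \<in> U \<Longrightarrow> x \<noteq> 0 \<Longrightarrow> h x = Suc (h (p x))"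
    and Q: "\<And>x. x \<in> U \<Longrightarrow> x \<noteq> 0 \<Longrightarrow> ?Q (p x, x) \<noteq> None"
    and hk: "\<And>x. x \<in> U \<Longrightarrow> h x \<le> Suc ?k"
    and sum: "w = (\<Sum>x\<in>U - {0}. the (?Q (p x, x)))"
    by (rule ddcst_weights_arboE[OF w]) (rule that)
  define U1 where "U1 = {x. Suc x \<in> U}"
  define f where "f x = the (?Q (p (Suc x), Suc x))" for x
  have U1: "U - {0} = Suc ` U1"
    unfolding U1_def by (auto simp: image_iff) (metis not0_implies_Suc)
  have "finite (Suc ` U1)" using U(1) by (simp flip: U1)
  then have fin1: "finite U1" by (rule finite_imageD) simp
  have w1: "w = (\<Sum>x\<in>U1. f x)"
    unfolding sum U1 f_def by (simp add: sum.reindex)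
  have n1: "x < n" if "x \<in> U1" for x
    using that U(2) unfolding U1_def by (auto dest: subsetD)
  have T1: "T \<subseteq> U1" using U(4) unfolding U1_def by blast
  have f0: "0 \<le> f x" if "x \<in> U1" for x
  proof -
    have "?Q (p (Suc x), Suc x) \<noteq> None" using Q[of "Suc x"] that by (simp add: U1_def)
    then show ?thesis
      using ddcst_instance_nonneg[OF query_instance[OF inst]] unfolding f_def by fastforce
  qed
  define R where "R = {x \<in> U1. p (Suc x) = 0}"
  have Ruv: "x = u \<or> x = v \<and> odd D \<and> E {u, v} \<noteq> None \<and> f x = the (E {u, v})" if "x \<in> R" for x
  proof -
    have x: "x \<in> U1" "p (Suc x) = 0" using that by (simp_all add: R_def)
    have "row0 u v (odd D) (E {u, v}) x \<noteq> None"
      using Q[of "Suc x"] x by (simp add: U1_def query_weights_root n1)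
    moreover have "f x = the (row0 u v (odd D) (E {u, v}) x)"
      using x n1[of x] by (simp add: f_def query_weights_root)
    ultimately show ?thesis by (auto simp: row0_def split: if_splits)
  qed
  show ?thesis
  proof (cases "U1 = {}")
    case True
    \<comment> \<open>The directed tree may be the root alone, but an undirected tree needs a
      vertex: the single vertex \<open>u\<close> has weight 0 as well.\<close>
    then have "T = {}" "w = 0" using T1 w1 by auto
    have c: "centred {u} {} u u id (\<lambda>_. 0) 0" by (rule centred_single)
    have "(\<Sum>e\<in>{}. the (E e)) \<in> dcst_weights {..<n} E T D"
      using uv \<open>T = {}\<close> centred_tree[OF c] centred_diameter[OF c, of D]
      by (intro dcst_weightsI) auto
    then show ?thesis using \<open>w = 0\<close> by auto
  next
    case False
    then obtain x0 where "x0 \<in> U1" by blast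
    then obtain m where m: "m \<in> U1" "\<And>y. y \<in> U1 \<Longrightarrow> h (Suc m) \<le> h (Suc y)"
      using ex_has_least_nat[of "\<lambda>x. x \<in> U1" x0 "\<lambda>x. h (Suc x)"] by blast
    \<comment> \<open>The root has a child: a vertex of least depth, since any other parent would be
      less deep.\<close>
    have "m \<in> R"
    proof (rule ccontr)
      assume "m \<notin> R"
      then obtain y where y: "p (Suc m) = Suc y" using m(1) by (auto simp: R_def gr0_conv_Suc)
      then have "y \<in> U1" "h (Suc m) = Suc (h (Suc y))"
        using p[of "Suc m"] h[of "Suc m"] m(1) by (auto simp: U1_def)
      then show False using m(2)[of y] by simp
    qed
    \<comment> \<open>If only one of \<open>u\<close> and \<open>v\<close> is a child of the root,
      then \<open>a = b\<close> is that child and the centre is a vertex; otherwise it is the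
      edge.\<close>
    define a where "a = (if u \<in> R then u else v)"
    define b where "b = (if v \<in> R then v else u)"
    have "m = u \<or> m = v" using Ruv[OF \<open>m \<in> R\<close>] by blast
    then have Rab: "R = {a, b}" and ab: "a \<noteq> b \<Longrightarrow> a = u \<and> b = v"
      using Ruv \<open>m \<in> R\<close> unfolding a_def b_def by auto
    from Rab have "a \<in> R" "b \<in> R" by simp_all
    then have abU: "a \<in> U1" "b \<in> U1" "p (Suc a) = 0" "p (Suc b) = 0"
      unfolding R_def by simp_all
    define p1 where "p1 x = p (Suc x) - 1" for x
    \<comment> \<open>The edge from the root does not count.\<close>
    define h1 where "h1 x = h (Suc x) - 1" for x
    define F1 where "F1 = (\<lambda>x. {x, p1 x}) ` (U1 - {a, b}) \<union> (if a = b then {} else {{a, b}})"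
    have par: "p (Suc x) = Suc (p1 x)" "p1 x \<in> U1" "h1 x = Suc (h1 (p1 x))" if x: "x \<in> U1 - {a, b}" for x
    proof -
      have "x \<in> U1" "x \<notin> R" using x Rab by blast+
      then have xU: "Suc x \<in> U" and "p (Suc x) \<noteq> 0" by (simp_all add: R_def U1_def)
      then show S: "p (Suc x) = Suc (p1 x)" by (simp add: p1_def)
      then show P: "p1 x \<in> U1" using p[OF xU] by (simp add: U1_def)
      have "h (Suc x) = Suc (h (Suc (p1 x)))" using h[OF xU] S by simp
      moreover have "h (Suc (p1 x)) = Suc (h (p (Suc (p1 x))))"
        using h[of "Suc (p1 x)"] P by (simp add: U1_def)
      ultimately show "h1 x = Suc (h1 (p1 x))" by (simp add: h1_def)
    qed
    have c: "centred U1 F1 a b p1 h1 ?k"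
      unfolding centred_def
    proof (intro conjI ballI)
      show "finite U1" by (rule fin1)
      show "a \<in> U1" "b \<in> U1" by (rule abU)+
      show "h1 a = 0" "h1 b = 0"
        using h[of "Suc a"] h[of "Suc b"] abU U(5) by (auto simp: h1_def U1_def)
      show "h1 x \<le> ?k" if "x \<in> U1" for x
        using hk[of "Suc x"] that by (simp add: h1_def U1_def)
      show "p1 x \<in> U1" if "x \<in> U1 - {a, b}" for x by (rule par(2)[OF that])
      show "h1 x = Suc (h1 (p1 x))" if "x \<in> U1 - {a, b}" for x by (rule par(3)[OF that])
    qed (rule F1_def)
    have edge: "?Q (p (Suc x), Suc x) = E {x, p1 x}" if x: "x \<in> U1 - {a, b}" for x
    proof -
      have "x \<noteq> p1 x" using par(3)[OF x] by (metis n_not_Suc_n)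
      then have "?Q (Suc (p1 x), Suc x) = E {p1 x, x}"
        using n1[OF par(2)[OF x]] n1[of x] x by (intro query_weights_edge) auto
      then show ?thesis using par(1)[OF x] by (simp add: insert_commute)
    qed
    have central: "odd D \<and> E {a, b} \<noteq> None \<and> f b = the (E {a, b})" if "a \<noteq> b"
      using Ruv[of b] Rab ab[OF that] that by auto
    have dom: "F1 \<subseteq> dom E"
    proof
      fix e assume "e \<in> F1"
      then consider x where "x \<in> U1 - {a, b}" "e = {x, p1 x}" | "a \<noteq> b" "e = {a, b}"
        unfolding F1_def by (cases "a = b") (simp_all, blast+)
      then show "e \<in> dom E"
      proof cases
        case 1
        then show ?thesis using Q[of "Suc x"] edge[OF 1(1)] by (auto simp: U1_def)
      next
        case 2
        then show ?thesis using central by auto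
      qed
    qed
    have "diameter U1 F1 \<le> D"
    proof (rule centred_diameter[OF c])
      show "2 * ?k + (if a = b then 0 else 1) \<le> D"
        using central by (cases "a = b") (auto elim: oddE)
    qed
    then have "(\<Sum>e\<in>F1. the (E e)) \<in> dcst_weights {..<n} E T D"
      using n1 by (intro dcst_weightsI[OF _ dom centred_tree[OF c] T1]) auto
    moreover have "(\<Sum>e\<in>F1. the (E e)) \<le> w"
    proof -
      have "w = (\<Sum>x\<in>U1 - {a, b}. f x) + (\<Sum>x\<in>{a, b}. f x)"
        unfolding w1 using abU(1,2) fin1 by (intro sum.subset_diff) auto
      moreover have "(\<Sum>x\<in>U1 - {a, b}. f x) = (\<Sum>x\<in>U1 - {a, b}. the (E {x, p1 x}))"
        by (intro sum.cong refl) (simp add: f_def edge)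
      \<comment> \<open>Only an inequality: with \<open>v\<close> as the only child, the edge from
        the root may cost the weight of \<open>{u, v}\<close> although this edge is not in the
        tree.\<close>
      moreover have "(if a = b then 0 else the (E {a, b})) \<le> (\<Sum>x\<in>{a, b}. f x)"
        using central f0[OF abU(1)] by (cases "a = b") auto
      ultimately show ?thesis unfolding centred_sum[OF c] by simp
    qed
    ultimately show ?thesis by blast
  qed
qed

text \<open>The centre of the tree says which query to look at. Here both ends of the centre become
  children of the root, so the charged weight replaces that of the central edge and the weights
  agree exactly.\<close>

lemma query_complete:
  assumes inst: "dcst_instance {..<n} E T D" and w: "w \<in> dcst_weights {..<n} E T D"
  shows "\<exists>u<n. \<exists>v<n.
    w \<in> ddcst_weights {..<Suc n} (query_weights n E (odd D) u v) (Suc ` T) 0 (Suc (D div 2))"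
proof -
  obtain U F where w: "w = (\<Sum>e\<in>F. the (E e))" and UF: "U \<subseteq> {..<n}" "F \<subseteq> dom E" "tree U F" "T \<subseteq> U"
    and d: "diameter U F \<le> D"
    using w unfolding dcst_weights_def by blast
  have "\<exists>u v p h. centred U F u v p h (D div 2) \<and> (u \<noteq> v \<longrightarrow> odd D)"
    using d unfolding diameter_le_iff[OF UF(3)] by (intro tree_centred UF(3)) blast
  then obtain u v p h where c: "centred U F u v p h (D div 2)"
    and odd: "u \<noteq> v \<longrightarrow> odd D" by (elim exE conjE) (rule that)
  note cD = centredD[OF c]
  let ?Q = "query_weights n E (odd D) u v"
  define p' where "p' y = (case y of 0 \<Rightarrow> 0 | Suc x \<Rightarrow> if x \<in> {u, v} then 0 else Suc (p x))" for y
  define h' where "h' y = (case y of 0 \<Rightarrow> 0 | Suc x \<Rightarrow> Suc (h x))" for y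
  define U' where "U' = insert 0 (Suc ` U)"
  define F' where "F' = (\<lambda>y. (p' y, y)) ` (U' - {0})"
  have parent: "p' y \<in> U' \<and> h' y = Suc (h' (p' y))" if y: "y \<in> U' - {0}" for y
  proof -
    obtain x where x: "y = Suc x" "x \<in> U" using y by (auto simp: U'_def)
    show ?thesis
    proof (cases "x \<in> {u, v}")
      case True
      then have "h x = 0" using cD(4,5) by blast
      then show ?thesis using x(1) True by (simp add: p'_def h'_def U'_def)
    next
      case False
      then have "x \<in> U - {u, v}" using x(2) by blast
      from centred_parent[OF c this] show ?thesis
        using x(1) False by (simp add: p'_def h'_def U'_def)
    qed
  qed
  have a: "arbo U' F' 0 p' h'"
    unfolding arbo_def
  proof (intro conjI ballI)
    show "finite U'" "0 \<in> U'" "h' 0 = 0" using cD(1) by (simp_all add: U'_def h'_def)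
    show "p' y \<in> U'" if "y \<in> U' - {0}" for y by (rule conjunct1[OF parent[OF that]])
    show "h' y = Suc (h' (p' y))" if "y \<in> U' - {0}" for y by (rule conjunct2[OF parent[OF that]])
  qed (rule F'_def)
  have lt: "x < n" if "x \<in> U" for x using that UF(1) by blast
  have edge: "?Q (p' (Suc x), Suc x) = E {x, p x} \<and> E {x, p x} \<noteq> None" if x: "x \<in> U - {u, v}" for x
  proof -
    have "p x \<noteq> x" using centred_parent(2)[OF c x] by (metis n_not_Suc_n)
    then have "?Q (Suc (p x), Suc x) = E {p x, x}"
      using x lt centred_parent(1)[OF c x] by (intro query_weights_edge) auto
    moreover have "p' (Suc x) = Suc (p x)" using x by (auto simp: p'_def)
    moreover have "{x, p x} \<in> dom E" using UF(2) x unfolding cD(7) by blast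
    ultimately show ?thesis by (auto simp: insert_commute)
  qed
  have root: "?Q (p' (Suc u), Suc u) = Some 0"
    using lt[OF cD(2)] by (simp add: p'_def query_weights_root row0_def)
  have central: "?Q (p' (Suc v), Suc v) = E {u, v} \<and> E {u, v} \<noteq> None" if "u \<noteq> v"
  proof -
    have "{u, v} \<in> dom E" using UF(2) that unfolding cD(7) by simp
    then show ?thesis
      using lt[OF cD(3)] that odd by (auto simp: p'_def query_weights_root row0_def)
  qed
  have "(\<Sum>y\<in>U' - {0}. the (?Q (p' y, y))) \<in>
      ddcst_weights {..<Suc n} ?Q (Suc ` T) 0 (Suc (D div 2))"
  proof (rule ddcst_weights_arboI[OF a])
    show "U' \<subseteq> {..<Suc n}" using lt by (auto simp: U'_def)
    show "Suc ` T \<subseteq> U'" using UF(4) by (auto simp: U'_def)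
    show "h' y \<le> Suc (D div 2)" if "y \<in> U'" for y
      using that cD(6) by (auto simp: U'_def h'_def)
    show "?Q (p' y, y) \<noteq> None" if y: "y \<in> U'" "y \<noteq> 0" for y
    proof -
      obtain x where x: "y = Suc x" "x \<in> U" using y by (auto simp: U'_def)
      consider "x \<in> U - {u, v}" | "x = u" | "x = v" "u \<noteq> v" using x(2) by blast
      then show ?thesis
      proof cases
        case 1
        then show ?thesis using edge[OF 1] x(1) by simp
      next
        case 2
        then show ?thesis using root x(1) by simp
      next
        case 3
        then show ?thesis using central x(1) by simp
      qed
    qed
  qed
  moreover have "(\<Sum>y\<in>U' - {0}. the (?Q (p' y, y))) = w"
  proof -
    have U0: "U' - {0} = Suc ` U" by (auto simp: U'_def)
    have "(\<Sum>y\<in>U' - {0}. the (?Q (p' y, y))) = (\<Sum>x\<in>U. the (?Q (p' (Suc x), Suc x)))"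
      unfolding U0 by (simp add: sum.reindex)
    also have "\<dots> = (\<Sum>x\<in>U - {u, v}. the (?Q (p' (Suc x), Suc x))) + (\<Sum>x\<in>{u, v}. the (?Q (p' (Suc x), Suc x)))"
      using cD(1-3) by (intro sum.subset_diff) auto
    also have "(\<Sum>x\<in>U - {u, v}. the (?Q (p' (Suc x), Suc x))) = (\<Sum>x\<in>U - {u, v}. the (E {x, p x}))"
      by (intro sum.cong refl) (simp only: edge)
    also have "(\<Sum>x\<in>{u, v}. the (?Q (p' (Suc x), Suc x))) = (if u = v then 0 else the (E {u, v}))"
      using root central by (cases "u = v") simp_all
    finally show ?thesis unfolding w centred_sum[OF c] by simp
  qed
  ultimately show ?thesis using lt cD(2,3) by blast
qed

subsection \<open>The minimum over all centres\<close>

text \<open>The set of upper bounds determines the value and treats FAIL as infinity. It turns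
  minima into unions, so nested minima are compared as sets without cases for FAIL.\<close>

definition up :: "rat option \<Rightarrow> rat set" where
  "up x = {c. \<exists>m. x = Some m \<and> m \<le> c}"

lemma up_None [simp]: "up None = {}"
  by (simp add: up_def)

lemma up_inject: "up x = up y \<Longrightarrow> x = y"
proof -
  assume eq: "up x = up y"
  have "m \<in> up (Some m)" for m by (simp add: up_def)
  then have "x = Some m \<Longrightarrow> \<exists>m'. y = Some m' \<and> m' \<le> m" "y = Some m \<Longrightarrow> \<exists>m'. x = Some m' \<and> m' \<le> m" for m
    using eq by (auto simp: up_def)
  then show "x = y"
    by (cases x; cases y) force+
qed

lemma up_min_or_fail: "finite W \<Longrightarrow> up (min_or_fail W) = {c. \<exists>w\<in>W. w \<le> c}"
  by (auto simp: up_def min_or_fail_def Min_le_iff)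

lemma up_omin: "up (omin x y) = up x \<union> up y"
  by (auto simp: up_def omin_def min_le_iff_disj split: option.split)

lemma mem_up_omin: "c \<in> up (omin x y) \<longleftrightarrow> (\<exists>m. (x = Some m \<or> y = Some m) \<and> m \<le> c)"
  unfolding up_omin by (auto simp: up_def)

lemma up_foldl:
  assumes "\<And>x u. up (g x u) = up x \<union> G u"
  shows "up (foldl g x us) = up x \<union> (\<Union>u\<in>set us. G u)"
  by (induction us arbitrary: x) (auto simp: assms)

definition query_value :: "nat \<Rightarrow> (nat set \<rightharpoonup> rat) \<Rightarrow> nat set \<Rightarrow> nat \<Rightarrow> nat \<Rightarrow> nat \<Rightarrow> rat option" where
  "query_value n E T D u v =
     ddcst {..<Suc n} (query_weights n E (odd D) u v) (Suc ` T) 0 (Suc (D div 2))"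

text \<open>The weights in the queries need not all be weights of undirected trees, because of
  overcharged centres. Their upward closures nevertheless agree: soundness gives one inclusion and
  completeness the other.\<close>

lemma dcst_eq_minimum:
  assumes inst: "dcst_instance {..<n} E T D"
  shows "dcst {..<n} E T D =
    foldl (\<lambda>x u. foldl (\<lambda>x v. omin x (query_value n E T D u v)) x [0..<n]) None [0..<n]"
proof (rule up_inject)
  let ?W = "\<lambda>u v. ddcst_weights {..<Suc n} (query_weights n E (odd D) u v) (Suc ` T) 0 (Suc (D div 2))"
  have ans: "up (query_value n E T D u v) = {c. \<exists>w\<in>?W u v. w \<le> c}" for u v
    unfolding query_value_def ddcst_def
    by (intro up_min_or_fail finite_ddcst_weights[OF query_instance[OF inst]])
  have "up (foldl (\<lambda>x u. foldl (\<lambda>x v. omin x (query_value n E T D u v)) x [0..<n]) None [0..<n]) =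
      up None \<union> (\<Union>u\<in>set [0..<n]. \<Union>v\<in>set [0..<n]. up (query_value n E T D u v))"
    by (intro up_foldl up_omin)
  also have "\<dots> = {c. \<exists>u\<in>{0..<n}. \<exists>v\<in>{0..<n}. \<exists>w\<in>?W u v. w \<le> c}"
    unfolding ans set_upt up_None by blast
  also have "\<dots> = {c. \<exists>u<n. \<exists>v<n. \<exists>w\<in>?W u v. w \<le> c}"
    by (simp only: Bex_def atLeastLessThan_iff le0 simp_thms)
  also have "\<dots> = {c. \<exists>w\<in>dcst_weights {..<n} E T D. w \<le> c}"
    using query_sound[OF inst] query_complete[OF inst] by (blast intro: order_trans)
  also have "\<dots> = up (dcst {..<n} E T D)"
    unfolding dcst_def by (intro up_min_or_fail[symmetric] finite_dcst_weights[OF inst])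
  finally show "up (dcst {..<n} E T D) =
      up (foldl (\<lambda>x u. foldl (\<lambda>x v. omin x (query_value n E T D u v)) x [0..<n]) None [0..<n])" ..
qed

text \<open>The instance that makes the oracle compute a minimum: vertex 1 is reached from the root 0
  directly at cost \<open>x\<close> or via vertex 2 at cost \<open>y\<close>.\<close>

definition min_weights :: "rat option \<Rightarrow> rat option \<Rightarrow> (nat \<times> nat \<rightharpoonup> rat)" where
  "min_weights x y = (\<lambda>(i, j).
     if i < 3 \<and> i = j \<or> i = 2 \<and> j = 1 then Some 0
     else if i = 0 \<and> j = 1 then x else if i = 0 \<and> j = 2 then y else None)"

lemma min_instance:
  assumes "\<And>c. x = Some c \<Longrightarrow> 0 \<le> c" "\<And>c. y = Some c \<Longrightarrow> 0 \<le> c"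
  shows "ddcst_instance {..<3} (min_weights x y) {1} 0 2"
proof -
  have "0 \<le> c" if "min_weights x y e = Some c" for e c
    using that assms by (auto simp: min_weights_def split: if_splits prod.splits)
  then have "\<forall>c\<in>ran (min_weights x y). 0 \<le> c"
    by (auto simp: ran_def)
  moreover have "dom (min_weights x y) \<subseteq> {..<3} \<times> {..<3}"
    by (auto simp: min_weights_def split: if_splits)
  moreover have "min_weights x y (i, i) = Some 0" if "i \<in> {..<3}" for i
    using that by (simp add: min_weights_def)
  ultimately show ?thesis by (auto simp: ddcst_instance_def)
qed

text \<open>A tree with vertex 1 enters it from 0, at cost \<open>x\<close>, or from 2, which can
  then only be entered from 0, at cost \<open>y\<close>. All other edges are non-negative, so this
  cost is a lower bound, and both values are attained.\<close>

lemma ddcst_min_weights: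
  assumes nonneg: "\<And>c. x = Some c \<Longrightarrow> 0 \<le> c" "\<And>c. y = Some c \<Longrightarrow> 0 \<le> c"
  shows "ddcst {..<3} (min_weights x y) {1} 0 2 = omin x y"
proof (rule up_inject)
  let ?Q = "min_weights x y"
  let ?W = "ddcst_weights {..<3} ?Q {1} 0 2"
  note inst = min_instance[OF nonneg]
  have direct: "m \<in> ?W" if x: "x = Some m" for m
  proof -
    have U: "{0, 1 :: nat} - {0} = {1}" by auto
    have "arbo {0, 1 :: nat} {(0, 1)} 0 (\<lambda>_. 0) (\<lambda>z. z)"
      unfolding arbo_def U by auto
    then have "(\<Sum>z\<in>{0, 1} - {0}. the (?Q ((\<lambda>_. 0) z, z))) \<in> ?W"
      by (rule ddcst_weights_arboI) (auto simp: min_weights_def x)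
    then show ?thesis unfolding U by (simp add: min_weights_def x)
  qed
  have detour: "m \<in> ?W" if y: "y = Some m" for m
  proof -
    have U: "{0, 1, 2 :: nat} - {0} = {1, 2}" by auto
    have "arbo {0, 1, 2 :: nat} {(2, 1), (0, 2)} 0 (\<lambda>z. if z = 1 then 2 else 0)
        (\<lambda>z. if z = 0 then 0 else if z = 1 then 2 else 1)"
      unfolding arbo_def U by auto
    then have "(\<Sum>z\<in>{0, 1, 2} - {0}. the (?Q ((\<lambda>z. if z = 1 then 2 else 0) z, z))) \<in> ?W"
      by (rule ddcst_weights_arboI) (auto simp: min_weights_def y)
    then show ?thesis unfolding U by (simp add: min_weights_def y)
  qed
  have lower: "\<exists>m. (x = Some m \<or> y = Some m) \<and> m \<le> w" if w: "w \<in> ?W" for w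
  proof -
    obtain U p h where U: "finite U" "U \<subseteq> {..<3}" "(0 :: nat) \<in> U" "{1} \<subseteq> U" "h 0 = (0 :: nat)"
      and p: "\<And>x. x \<in> U \<Longrightarrow> x \<noteq> 0 \<Longrightarrow> p x \<in> U"
      and h: "\<And>x. x \<in> U \<Longrightarrow> x \<noteq> 0 \<Longrightarrow> h x = Suc (h (p x))"
      and Q: "\<And>x. x \<in> U \<Longrightarrow> x \<noteq> 0 \<Longrightarrow> ?Q (p x, x) \<noteq> None"
      and hk: "\<And>x. x \<in> U \<Longrightarrow> h x \<le> 2"
      and sum: "w = (\<Sum>x\<in>U - {0}. the (?Q (p x, x)))"
      by (rule ddcst_weights_arboE[OF w]) (rule that)
    have le: "the (?Q (p z, z)) \<le> w" if "z \<in> U" "z \<noteq> 0" for z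
    proof -
      have nn: "0 \<le> the (?Q (p i, i))" if i: "i \<in> U - {0}" for i
      proof -
        have "?Q (p i, i) \<noteq> None" using i by (intro Q) auto
        then obtain c where c: "?Q (p i, i) = Some c" by blast
        then show ?thesis using ddcst_instance_nonneg[OF inst c] by simp
      qed
      show ?thesis
        unfolding sum using that U(1)
        by (intro member_le_sum[of z "U - {0}" "\<lambda>i. the (?Q (p i, i))"] nn) auto
    qed
    have irrefl: "p z \<noteq> z" if "z \<in> U" "z \<noteq> 0" for z
      using h[OF that] by (metis n_not_Suc_n)
    have "1 \<in> U" using U(4) by blast
    have "p 1 = 0 \<and> x \<noteq> None \<or> p 1 = 2"
      using Q[OF \<open>1 \<in> U\<close>] irrefl[OF \<open>1 \<in> U\<close>]
      by (auto simp: min_weights_def split: if_splits)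
    then show ?thesis
    proof
      assume "p 1 = 0 \<and> x \<noteq> None"
      then show ?thesis using le[OF \<open>1 \<in> U\<close>] by (auto simp: min_weights_def)
    next
      assume "p 1 = 2"
      then have "2 \<in> U" using p[OF \<open>1 \<in> U\<close>] by simp
      have "p 2 = 0 \<and> y \<noteq> None"
        using Q[OF \<open>2 \<in> U\<close>] irrefl[OF \<open>2 \<in> U\<close>]
        by (auto simp: min_weights_def split: if_splits)
      then show ?thesis using le[OF \<open>2 \<in> U\<close>] by (auto simp: min_weights_def)
    qed
  qed
  have "up (ddcst {..<3} ?Q {1} 0 2) = {c. \<exists>w\<in>?W. w \<le> c}"
    unfolding ddcst_def by (intro up_min_or_fail finite_ddcst_weights[OF inst])
  also have "\<dots> = up (omin x y)"
  proof (intro equalityI subsetI)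
    fix c assume "c \<in> {c. \<exists>w\<in>?W. w \<le> c}"
    then obtain w where "w \<in> ?W" "w \<le> c" by blast
    moreover obtain m where "x = Some m \<or> y = Some m" "m \<le> w"
      using lower[OF \<open>w \<in> ?W\<close>] by blast
    ultimately show "c \<in> up (omin x y)"
      unfolding mem_up_omin by (blast intro: order_trans)
  next
    fix c assume "c \<in> up (omin x y)"
    then obtain m where "x = Some m \<or> y = Some m" "m \<le> c"
      unfolding mem_up_omin by blast
    then show "c \<in> {c. \<exists>w\<in>?W. w \<le> c}"
      using direct detour by blast
  qed
  finally show "up (ddcst {..<3} ?Q {1} 0 2) = up (omin x y)" .
qed

subsection \<open>The queries as encoded instances\<close>

text \<open>Positivity of \<open>D\<close> guarantees the first digit that the program reads as the
  parity.\<close>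

lemma enc_dcst_eq:
  assumes "0 < D"
  shows "enc_dcst n E T D = in_rows n (\<lambda>i j. E {i, j}) 0 @ False # bits (map (\<lambda>i. i \<in> T) [0..<n]) @
    False # True # odd D # bits (bin (D div 2)) @ [False]"
proof -
  have "bin D = odd D # bin (D div 2)"
    using assms by (subst bin.simps) simp
  then show ?thesis
    by (simp add: enc_dcst_def enc_matrix_def enc_subset_def enc_nat_def enc_list_bool enc_bool_def
        enc_list_concat[of "enc_list entry"] in_rows_def o_def)
qed

lemma upt_Suc_map: "[0..<Suc n] = 0 # map Suc [0..<n]"
  by (simp only: map_Suc_upt upt_conv_Cons[OF zero_less_Suc])

lemma enc_query_instance:
  "enc_ddcst (Suc n) (query_weights n E p u v) (Suc ` T) 0 (Suc (D div 2)) =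
     graph_query n (suffix n (\<lambda>i j. E {i, j}) (map (\<lambda>i. i \<in> T) [0..<n]) D) p u v (E {u, v})"
proof -
  let ?Q = "query_weights n E p u v" and ?A = "\<lambda>i j. E {i, j}"
  have "map (\<lambda>j. ?Q (0, j)) [0..<Suc n] = Some 0 # map (row0 u v p (E {u, v})) [0..<n]"
    unfolding upt_Suc_map by (simp add: query_weights_root) (simp add: query_weights_def)
  moreover have "map (\<lambda>j. ?Q (Suc i, j)) [0..<Suc n] = None # map (zero_diag ?A i) [0..<n]" if "i < n" for i
    unfolding upt_Suc_map using that by (simp add: query_weights_def zero_diag_def)
  ultimately have "map (\<lambda>i. map (\<lambda>j. ?Q (i, j)) [0..<Suc n]) [0..<Suc n] =
      (Some 0 # map (row0 u v p (E {u, v})) [0..<n]) #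
      map (\<lambda>i. None # map (zero_diag ?A i) [0..<n]) [0..<n]"
    by (subst (2) upt_Suc_map) simp
  then have "enc_matrix (Suc n) (\<lambda>i j. ?Q (i, j)) =
      True # True # entry (Some 0) @ items (map (row0 u v p (E {u, v})) [0..<n]) @ False #
      out_rows n ?A 0 @ [False]"
    by (simp only: enc_matrix_def enc_list.simps enc_list_entry)
      (simp add: enc_list_concat[of "enc_list entry"] out_rows_def o_def)
  moreover have "map (\<lambda>i. i \<in> Suc ` T) [0..<Suc n] = False # map (\<lambda>i. i \<in> T) [0..<n]"
    unfolding upt_Suc_map by (auto simp: inj_image_mem_iff)
  then have "enc_subset (Suc n) (Suc ` T) = True # False # bits (map (\<lambda>i. i \<in> T) [0..<n]) @ [False]"
    by (simp only: enc_subset_def enc_list_bool) simp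
  moreover have "enc_nat 0 = [False]"
    by (simp add: enc_nat_def bin.simps[of 0])
  ultimately show ?thesis
    by (simp add: enc_ddcst_def graph_query_def suffix_def)
qed

lemma enc_min_instance: "enc_ddcst 3 (min_weights x y) {1} 0 2 = min_query x y"
proof -
  have "[0..<3] = [0, 1, 2 :: nat]" by (simp add: numeral_3_eq_3 numeral_2_eq_2)
  then have "map (\<lambda>i. map (\<lambda>j. min_weights x y (i, j)) [0..<3]) [0..<3] =
      [[Some 0, x, y], [None, Some 0, None], [None, Some 0, Some 0]]"
    by (simp add: min_weights_def)
  then show ?thesis
    by (simp add: enc_ddcst_def enc_matrix_def min_query_def min_pre_def min_post_def)
qed

subsection \<open>The length of the answers\<close>

text \<open>Numerator plus denominator: a size that at most multiplies when non-negative fractions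
  are added, so its logarithm, and with it the length of the code, behaves additively.\<close>

definition rat_size :: "rat \<Rightarrow> int" where
  "rat_size q = fst (quotient_of q) + snd (quotient_of q)"

lemma quotient_of_nonneg:
  assumes "0 \<le> q"
  shows "0 \<le> fst (quotient_of q)" "0 < snd (quotient_of q)"
proof -
  obtain a b where q: "quotient_of q = (a, b)" by fastforce
  then have "0 < b" "q = of_int a / of_int b"
    by (auto simp: quotient_of_denom_pos quotient_of_div)
  then have "0 \<le> a" "0 < b"
    using assms by (auto simp: zero_le_divide_iff)
  then show "0 \<le> fst (quotient_of q)" "0 < snd (quotient_of q)"
    by (simp_all add: q)
qed

text \<open>Cancelling the gcd only shrinks both parts, and \<open>(a * d + c * b) + b * d\<close>
  consists of three of the four non-negative terms of \<open>(a + b) * (c + d)\<close>.\<close>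

lemma rat_size_add:
  assumes "0 \<le> x" "0 \<le> y"
  shows "rat_size (x + y) \<le> rat_size x * rat_size y"
proof -
  obtain a b c d where q: "quotient_of x = (a, b)" "quotient_of y = (c, d)" by fastforce
  have pos: "0 \<le> a" "0 < b" "0 \<le> c" "0 < d"
    using quotient_of_nonneg[OF assms(1)] quotient_of_nonneg[OF assms(2)] by (auto simp: q)
  have "x + y = of_int a / of_int b + of_int c / of_int d"
    using quotient_of_div[OF q(1)] quotient_of_div[OF q(2)] by (simp only:)
  also have "\<dots> = Fract (a * d + c * b) (b * d)"
    using pos by (simp add: Fract_of_int_quotient add_frac_eq)
  finally have "quotient_of (x + y) = Rat.normalize (a * d + c * b, b * d)"
    by (simp add: quotient_of_Fract)
  moreover have "0 < b * d" using pos by simp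
  ultimately have "quotient_of (x + y) =
      ((a * d + c * b) div gcd (a * d + c * b) (b * d), b * d div gcd (a * d + c * b) (b * d))"
    by (simp add: Rat.normalize_def Let_def)
  moreover have div_le: "m div gcd m' (b * d) \<le> m" if "0 \<le> m" for m m'
  proof -
    have "gcd m' (b * d) \<noteq> 0" using pos by simp
    then have "1 \<le> gcd m' (b * d)" using gcd_ge_0_int[of m' "b * d"] by linarith
    then show ?thesis using zdiv_mono2[of m 1 "gcd m' (b * d)"] that by simp
  qed
  ultimately have "rat_size (x + y) \<le> (a * d + c * b) + b * d"
    unfolding rat_size_def using pos by (simp only: fst_conv snd_conv) (intro add_mono div_le; simp)
  also have "\<dots> \<le> (a + b) * (c + d)"
    using pos by (simp add: algebra_simps)
  finally show ?thesis by (simp add: rat_size_def q)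
qed

lemma rat_size_pos: "0 \<le> q \<Longrightarrow> 0 < rat_size q"
  using quotient_of_nonneg[of q] by (simp add: rat_size_def)

lemma rat_size_sum:
  assumes "finite X" "\<And>x. x \<in> X \<Longrightarrow> 0 \<le> g x"
  shows "rat_size (\<Sum>x\<in>X. g x) \<le> (\<Prod>x\<in>X. rat_size (g x))"
  using assms
proof (induction X rule: finite_induct)
  case empty
  show ?case by (simp add: rat_size_def rat_zero_code)
next
  case (insert x X)
  have "rat_size (g x + (\<Sum>x\<in>X. g x)) \<le> rat_size (g x) * rat_size (\<Sum>x\<in>X. g x)"
    using insert.prems by (intro rat_size_add sum_nonneg) auto
  also have "\<dots> \<le> rat_size (g x) * (\<Prod>x\<in>X. rat_size (g x))"
    using insert.IH insert.prems rat_size_pos[of "g x"] by (intro mult_left_mono) auto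
  finally show ?case using insert.hyps by simp
qed

lemma less_power_length_bin: "m < 2 ^ length (bin m)"
proof (induction m rule: less_induct)
  case (less m)
  show ?case
  proof (cases "m = 0")
    case False
    then have "m div 2 < 2 ^ length (bin (m div 2))" by (intro less.IH) simp
    then have "m < 2 ^ length (bin (m div 2)) * 2"
      by (simp add: div_less_iff_less_mult)
    moreover have "length (bin m) = Suc (length (bin (m div 2)))"
      using False by (subst bin.simps) simp
    ultimately show ?thesis by simp
  qed (simp add: bin.simps)
qed

lemma length_bin_le: "m < 2 ^ k \<Longrightarrow> length (bin m) \<le> k"
proof (induction k arbitrary: m)
  case (Suc k)
  then have "m div 2 < 2 ^ k" by simp
  with Suc.IH show ?case by (subst bin.simps) simp
qed (simp add: bin.simps)

lemma length_enc_nat: "length (enc_nat m) = 2 * length (bin m) + 1"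
  by (simp add: enc_nat_def enc_list_bool length_bits)

lemma rat_size_le:
  assumes "0 \<le> q"
  shows "rat_size q \<le> 2 ^ length (enc_rat q)"
proof -
  obtain a b where q: "quotient_of q = (a, b)" by fastforce
  have pos: "0 \<le> a" "0 < b" using quotient_of_nonneg[OF assms] by (auto simp: q)
  let ?a = "length (bin (nat a))" and ?b = "length (bin (nat b))"
  have len: "length (enc_rat q) = 2 * ?a + 2 * ?b + 2"
    by (simp add: enc_rat_def q length_enc_nat)
  have "int (nat a) < int (2 ^ ?a)" "int (nat b) < int (2 ^ ?b)"
    using less_power_length_bin by (simp_all only: of_nat_less_iff)
  then have "a < 2 ^ ?a" "b < 2 ^ ?b" using pos by simp_all
  moreover have "(2 :: int) ^ ?a \<le> 2 ^ (?a + ?b)" "(2 :: int) ^ ?b \<le> 2 ^ (?a + ?b)"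
    by (intro power_increasing; simp)+
  ultimately have "a + b \<le> 2 * 2 ^ (?a + ?b)" by linarith
  also have "\<dots> = 2 ^ Suc (?a + ?b)" by simp
  also have "\<dots> \<le> 2 ^ length (enc_rat q)"
    unfolding len by (intro power_increasing) auto
  finally show ?thesis by (simp add: rat_size_def q)
qed

text \<open>Both parts have at most \<open>k + 1\<close> digits, and coding such a number takes at
  most \<open>2 * (k + 1) + 1\<close> bits.\<close>

lemma length_enc_rat_le:
  assumes "0 \<le> q" "rat_size q \<le> 2 ^ k"
  shows "length (enc_rat q) \<le> 4 * k + 6"
proof -
  obtain a b where q: "quotient_of q = (a, b)" by fastforce
  have pos: "0 \<le> a" "0 < b" using quotient_of_nonneg[OF assms(1)] by (auto simp: q)
  have "a + b \<le> 2 ^ k" using assms(2) by (simp add: rat_size_def q)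
  then have "a < 2 ^ Suc k" "b < 2 ^ Suc k" using pos by simp_all
  then have "int (nat a) < int (2 ^ Suc k)" "int (nat b) < int (2 ^ Suc k)" using pos by simp_all
  then have "length (bin (nat a)) \<le> Suc k" "length (bin (nat b)) \<le> Suc k"
    by (intro length_bin_le; simp only: of_nat_less_iff)+
  then show ?thesis by (simp add: enc_rat_def q length_enc_nat)
qed

lemma length_enc_rat_sum:
  assumes "finite X" "\<And>x. x \<in> X \<Longrightarrow> 0 \<le> g x"
  shows "length (enc_rat (\<Sum>x\<in>X. g x)) \<le> 4 * (\<Sum>x\<in>X. length (enc_rat (g x))) + 6"
proof (rule length_enc_rat_le)
  show "0 \<le> (\<Sum>x\<in>X. g x)" using assms(2) by (rule sum_nonneg)
  have "rat_size (\<Sum>x\<in>X. g x) \<le> (\<Prod>x\<in>X. rat_size (g x))"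
    using assms by (rule rat_size_sum)
  also have "\<dots> \<le> (\<Prod>x\<in>X. 2 ^ length (enc_rat (g x)))"
    using assms(2) rat_size_le rat_size_pos by (intro prod_mono) (auto intro: less_imp_le)
  also have "\<dots> = 2 ^ (\<Sum>x\<in>X. length (enc_rat (g x)))"
    by (rule power_sum[symmetric])
  finally show "rat_size (\<Sum>x\<in>X. g x) \<le> 2 ^ (\<Sum>x\<in>X. length (enc_rat (g x)))" .
qed

text \<open>An answer is the weight of some tree with at most \<open>n\<close> edges, one for each
  vertex other than the root. Each weight is an input weight or 0, and \<open>L + 5\<close> covers
  both codes. Being non-negative, answers may serve as weights in the query for a minimum.\<close>

lemma query_value_bound:
  assumes inst: "dcst_instance {..<n} E T D" and uv: "u < n" "v < n"
    and L: "\<And>i j. i < n \<Longrightarrow> j < n \<Longrightarrow> length (entry (E {i, j})) \<le> L"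
    and z: "query_value n E T D u v = Some w"
  shows "0 \<le> w" "length (enc_rat w) \<le> 4 * (n * (L + 5)) + 6"
proof -
  let ?Q = "query_weights n E (odd D) u v"
  note inst' = query_instance[OF inst, of "odd D" u v "D div 2"]
  let ?W = "ddcst_weights {..<Suc n} ?Q (Suc ` T) 0 (Suc (D div 2))"
  have "?W \<noteq> {}" "w = Min ?W"
    using z by (auto simp: query_value_def ddcst_def min_or_fail_def split: if_splits)
  then have w: "w \<in> ?W" using finite_ddcst_weights[OF inst'] Min_in by blast
  obtain U p h where U: "finite U" "U \<subseteq> {..<Suc n}" "(0 :: nat) \<in> U" "Suc ` T \<subseteq> U" "h 0 = (0 :: nat)"
    and p: "\<And>x. x \<in> U \<Longrightarrow> x \<noteq> 0 \<Longrightarrow> p x \<in> U"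
    and h: "\<And>x. x \<in> U \<Longrightarrow> x \<noteq> 0 \<Longrightarrow> h x = Suc (h (p x))"
    and Q: "\<And>x. x \<in> U \<Longrightarrow> x \<noteq> 0 \<Longrightarrow> ?Q (p x, x) \<noteq> None"
    and hk: "\<And>x. x \<in> U \<Longrightarrow> h x \<le> Suc (D div 2)"
    and sum: "w = (\<Sum>x\<in>U - {0}. the (?Q (p x, x)))"
    by (rule ddcst_weights_arboE[OF w]) (rule that)
  have edge: "length (enc_rat c) \<le> L + 5" if "?Q e = Some c" for e c
  proof -
    have "c = 0 \<or> (\<exists>i<n. \<exists>j<n. E {i, j} = Some c)"
      using that uv
      by (auto simp: query_weights_def row0_def split: if_splits prod.splits)
    then show ?thesis
    proof (elim disjE exE conjE)
      fix i j assume "i < n" "j < n" "E {i, j} = Some c"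
      then show ?thesis using L[of i j] by simp
    qed (simp add: enc_rat_zero)
  qed
  have X: "0 \<le> the (?Q (p x, x)) \<and> length (enc_rat (the (?Q (p x, x)))) \<le> L + 5"
    if x: "x \<in> U - {0}" for x
  proof -
    have "?Q (p x, x) \<noteq> None" using x by (intro Q) auto
    then obtain c where c: "?Q (p x, x) = Some c" by blast
    then show ?thesis using ddcst_instance_nonneg[OF inst' c] edge[OF c] by simp
  qed
  show "0 \<le> w" unfolding sum using X by (intro sum_nonneg) blast
  have "length (enc_rat w) \<le> 4 * (\<Sum>x\<in>U - {0}. length (enc_rat (the (?Q (p x, x))))) + 6"
    unfolding sum using U(1) X by (intro length_enc_rat_sum) auto
  also have "(\<Sum>x\<in>U - {0}. length (enc_rat (the (?Q (p x, x))))) \<le> card (U - {0}) * (L + 5)"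
    using sum_bounded_above[of "U - {0}" "\<lambda>x. length (enc_rat (the (?Q (p x, x))))" "L + 5"] X by simp
  also have "card (U - {0}) \<le> n"
    using card_mono[of "{..<Suc n}" U] U by simp
  finally show "length (enc_rat w) \<le> 4 * (n * (L + 5)) + 6" by simp
qed

lemma length_concat_le:
  assumes "\<And>x. x \<in> set xs \<Longrightarrow> length x \<le> K"
  shows "length (concat xs) \<le> length xs * K"
  using assms by (induction xs) (auto intro: add_mono)

lemma length_le_concat: "x \<in> set xs \<Longrightarrow> length x \<le> length (concat xs)"
  by (induction xs) auto

lemma length_entry_in_rows:
  assumes "i < n" "j < n"
  shows "length (entry (A i j)) \<le> length (in_rows n A 0)"
proof -
  have "length (True # entry (A i j)) \<le> length (items (map (A i) [0..<n]))"
    unfolding items_def using assms by (intro length_le_concat) auto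
  also have "\<dots> \<le> length (True # enc_list entry (map (A i) [0..<n]))"
    by (simp add: enc_list_entry)
  also have "\<dots> \<le> length (in_rows n A 0)"
    unfolding in_rows_def using assms by (intro length_le_concat) auto
  finally show ?thesis by simp
qed

lemma length_out_rows:
  assumes "\<And>i j. i < n \<Longrightarrow> j < n \<Longrightarrow> length (entry (A i j)) \<le> L"
  shows "length (out_rows n A 0) \<le> n * (n * (L + 6) + 4)"
proof -
  have "length (items (map (zero_diag A i) [0..<n])) \<le> n * (L + 6)" if "i < n" for i
  proof -
    have "length (True # entry (zero_diag A i j)) \<le> L + 6" if "j < n" for j
      using assms[OF \<open>i < n\<close> that] by (simp add: zero_diag_def enc_rat_zero)
    then have "length (items (map (zero_diag A i) [0..<n])) \<le>
        length (map (\<lambda>w. True # entry w) (map (zero_diag A i) [0..<n])) * (L + 6)"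
      unfolding items_def by (intro length_concat_le) auto
    then show ?thesis by simp
  qed
  then have "length (True # enc_list entry (None # map (zero_diag A i) [0..<n])) \<le> n * (L + 6) + 4"
    if "i < n" for i
    using that by (simp add: enc_list_entry)
  then have "length (out_rows n A 0) \<le>
      length (map (\<lambda>i. True # enc_list entry (None # map (zero_diag A i) [0..<n])) [0..<n]) * (n * (L + 6) + 4)"
    unfolding out_rows_def by (intro length_concat_le) auto
  then show ?thesis by simp
qed

subsection \<open>The reduction\<close>

lemma labels_emits [simp]: "labels (emits i w) = []"
  by (induction w) auto

lemma labels_reduction: "labels reduction = [False, True]"
  by (simp add: reduction_def prepare_def write_suffix_def diag_rows_def diag_row_def copy_item_def
      copy1_def copy_entry_def copy_bits_def copy_subset_def increment_def discard_def rewind_def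
      mark_def row_step_def entry_step_def ask_graph_def write_row0_def copy_all_def move_all_def
      ask_min_def advance_def finish_def)

text \<open>The cubic \<open>20 * (L + 1) ^ 3\<close> bounds the words handled on an input of length
  \<open>L\<close>. The program is quartic in this bound with factor 2000, for quadratically many
  pairs at quadratic cost each; compilation multiplies by 3.\<close>

definition time_bound :: "nat poly" where
  "time_bound = [:6000:] * ([:20:] * [:1, 1:] ^ 3 + 1) ^ 4"

lemma poly_time_bound: "poly time_bound L = 6000 * (20 * (L + 1) ^ 3 + 1) ^ 4"
  by (simp add: time_bound_def)

lemma solvesD: "solves f Q \<Longrightarrow> (x, y) \<in> Q \<Longrightarrow> f x = y"
  by (auto simp: solves_def)

lemma cubic_bounds:
  assumes "n \<le> (L :: nat)"
  shows "4 * (n * (L + 5)) + 7 \<le> 20 * (L + 1) ^ 3"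
    and "n * (n * (L + 6) + 4) + 2 * n + L + 8 \<le> 20 * (L + 1) ^ 3"
    and "L \<le> 20 * (L + 1) ^ 3"
proof -
  have "4 * (n * (L + 5)) + 7 \<le> 4 * (L * (L + 5)) + 7"
    using assms by (intro add_mono mult_le_mono) auto
  also have "\<dots> \<le> 20 * (L + 1) ^ 3"
    by (simp add: power3_eq_cube algebra_simps)
  finally show "4 * (n * (L + 5)) + 7 \<le> 20 * (L + 1) ^ 3" .
  have "n * (n * (L + 6) + 4) + 2 * n + L + 8 \<le> L * (L * (L + 6) + 4) + 2 * L + L + 8"
    using assms by (intro add_mono mult_le_mono) auto
  also have "\<dots> \<le> 20 * (L + 1) ^ 3"
    by (simp add: power3_eq_cube algebra_simps)
  finally show "n * (n * (L + 6) + 4) + 2 * n + L + 8 \<le> 20 * (L + 1) ^ 3" .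
  show "L \<le> 20 * (L + 1) ^ 3"
    by (simp add: power3_eq_cube algebra_simps)
qed

lemma computes_dcst:
  assumes f: "solves f DDCST" and inst: "dcst_instance {..<n} E T D"
  shows "computes_within (machine reduction) f (enc_dcst n E T D) (entry (dcst {..<n} E T D))
    (poly time_bound (length (enc_dcst n E T D)))"
proof -
  let ?x = "enc_dcst n E T D" and ?A = "\<lambda>i j. E {i, j}" and ?bs = "map (\<lambda>i. i \<in> T) [0..<n]"
  let ?S = "suffix n ?A ?bs D" and ?ans = "query_value n E T D"
  let ?L = "length ?x"
  let ?N = "20 * (?L + 1) ^ 3"
  \<comment> \<open>Without non-negativity the query for a minimum would be no valid instance and
    the oracle could answer anything.\<close>
  let ?R = "{z. length (entry z) \<le> ?N \<and> (\<forall>c. z = Some c \<longrightarrow> 0 \<le> c)}"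
  have D: "0 < D" using inst by (simp add: dcst_instance_def)
  note x = enc_dcst_eq[OF D, of n E T]
  have diag: "?A i i = None" for i
  proof (rule ccontr)
    assume "?A i i \<noteq> None"
    then have "{i, i} \<in> dom E" by blast
    then have "card {i, i} = 2" using inst by (auto simp: dcst_instance_def)
    then show False by simp
  qed
  have L: "length (in_rows n ?A 0) \<le> ?L" "2 * n \<le> ?L" "2 * length (bin (D div 2)) \<le> ?L"
    by (simp_all add: x length_bits)
  have entryL: "length (entry (?A i j)) \<le> ?L" if "i < n" "j < n" for i j
    using length_entry_in_rows[OF that, of ?A] L(1) by simp
  have nL: "n \<le> ?L" using L(2) by simp
  note bounds = cubic_bounds[OF nL]
  have query: "f (graph_query n ?S (odd D) u v (?A u v)) = entry (?ans u v)" if "u < n" "v < n" for u v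
  proof -
    have "(enc_ddcst (Suc n) (query_weights n E (odd D) u v) (Suc ` T) 0 (Suc (D div 2)),
        entry (?ans u v)) \<in> DDCST"
      unfolding DDCST_def query_value_def using query_instance[OF inst] by blast
    then have "f (enc_ddcst (Suc n) (query_weights n E (odd D) u v) (Suc ` T) 0 (Suc (D div 2))) =
        entry (?ans u v)"
      by (rule solvesD[OF f])
    then show ?thesis unfolding enc_query_instance .
  qed
  have minimum: "f (min_query y z) = entry (omin y z)" if "y \<in> ?R" "z \<in> ?R" for y z
  proof -
    have nonneg: "\<And>c. y = Some c \<Longrightarrow> 0 \<le> c" "\<And>c. z = Some c \<Longrightarrow> 0 \<le> c"
      using that by auto
    have "(enc_ddcst 3 (min_weights y z) {1} 0 2, entry (ddcst {..<3} (min_weights y z) {1} 0 2)) \<in> DDCST"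
      unfolding DDCST_def using min_instance[OF nonneg] by blast
    then have "f (enc_ddcst 3 (min_weights y z) {1} 0 2) = entry (ddcst {..<3} (min_weights y z) {1} 0 2)"
      by (rule solvesD[OF f])
    moreover have "ddcst {..<3} (min_weights y z) {1} 0 2 = omin y z"
      using nonneg by (rule ddcst_min_weights)
    ultimately show ?thesis by (simp only: enc_min_instance)
  qed
  have ans: "?ans u v \<in> ?R" if "u < n" "v < n" for u v
  proof (cases "?ans u v")
    case None
    then show ?thesis by simp
  next
    case (Some w)
    have "0 \<le> w" "length (enc_rat w) \<le> 4 * (n * (?L + 5)) + 6"
      using query_value_bound[OF inst that entryL Some] by blast+
    then show ?thesis using Some bounds(1) by simp
  qed
  have S: "length ?S \<le> ?N"
  proof -
    \<comment> \<open>An increment adds at most one digit.\<close>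
    have "Suc (D div 2) < 2 ^ Suc (length (bin (D div 2)))"
      using less_power_length_bin[of "D div 2"] by simp
    then have "length (bin (Suc (D div 2))) \<le> Suc (length (bin (D div 2)))"
      by (rule length_bin_le)
    moreover have "length (out_rows n ?A 0) \<le> n * (n * (?L + 6) + 4)"
      using entryL by (rule length_out_rows)
    ultimately have "length ?S \<le> n * (n * (?L + 6) + 4) + 2 * n + ?L + 8"
      using L(3) by (simp add: suffix_def length_bits length_enc_nat)
    also have "\<dots> \<le> ?N"
      by (rule bounds(2))
    finally show ?thesis .
  qed
  have "\<exists>s. run f reduction (initial ?x) (2000 * (?N + 1) ^ 4) s \<and>
      word_of (s 0) = entry (foldl (\<lambda>x u. foldl (\<lambda>x v. omin x (?ans u v)) x [0..<n]) None [0..<n])"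
  proof (rule run_reduction[where A = ?A and R = ?R and S = ?S and p = "odd D" and D = D and bs = ?bs])
    show "length (entry (?A u v)) \<le> ?N" if "u < n" "v < n" for u v
      using entryL[OF that] bounds(3) by (rule le_trans)
    show "length ?x \<le> ?N" by (rule bounds(3))
    show "n \<le> ?N" using nL bounds(3) by (rule le_trans)
  qed (use query ans minimum S diag x in simp_all)
  then obtain s where s: "run f reduction (initial ?x) (2000 * (?N + 1) ^ 4) s"
      "word_of (s 0) = entry (dcst {..<n} E T D)"
    unfolding dcst_eq_minimum[OF inst, symmetric] by (elim exE conjE) (rule that)
  show ?thesis
    by (rule computes_within_machine[OF s(1) _ s(2)]) (simp_all add: labels_reduction poly_time_bound)
qed

theorem theorem3:
  shows "poly_time_Turing_reducible DCST DDCST"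
  unfolding poly_time_Turing_reducible_def
proof (intro exI conjI allI impI)
  show "wf_otm (machine reduction)" by (rule wf_machine)
  fix f assume f: "solves f DDCST"
  show "\<forall>(x, y)\<in>DCST. computes_within (machine reduction) f x y (poly time_bound (length x))"
    unfolding DCST_def using computes_dcst[OF f] by blast
qed

end
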